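(* Let $L>0$, $c\in\mathbb R$, and let $(\phi_c,\psi_c)$ be a positive single-lobe state of the stationary NLS-log system on the tadpole graph $\mathcal G$ (with Neumann–Kirchhoff condition). Consider the self-adjoint operator $$\mathcal L_1=\mathrm{diag}\left(-\partial_x^2+(c-2)-\log|\phi_c|^2,\; -\partial_x^2+(c-2)-\log|\psi_c|^2\right)$$ on $L^2(\mathcal G)$ with domain $\mathcal D$. Then: 1) (Perron–Frobenius property) Let $\beta_0<0$ be the smallest eigenvalue of $\mathcal L_1$, with associated eigenfunction $(f_{\beta_0},g_{\beta_0})$. Then, up to multiplication of the eigenfunction by a nonzero constant, $f_{\beta_0}$ is positive and even on $[-L,L]$, and $g_{\beta_0}(x)>0$ for all $x\in[L,+\infty)$. 2) $\beta_0$ is simple. 3) The Morse index of $\mathcal L_1$ is one. 4) The kernel of $\mathcal L_1$ on $\mathcal D$ is trivial.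
   Context: Tadpole graph: $\mathcal G$ consists of a ring identified with $[-L,L]$ (endpoints $\pm L$ glued) and a half-line $[L,+\infty)$, joined at the single vertex $L$. A function on $\mathcal G$ is a pair $(f,g)$ with $f$ on $[-L,L]$, $g$ on $[L,+\infty)$. $L^2(\mathcal G)=L^2(-L,L)\oplus L^2(L,+\infty)$, $H^n(\mathcal G)=H^n(-L,L)\oplus H^n(L,+\infty)$ with natural norms. $D_0=\{(f,g)\in H^2(\mathcal G): f(L)=f(-L)=g(L),\ f'(L)-f'(-L)=g'(L+)\}$ and $\mathcal D=\{(f,g)\in D_0: x^2g\in L^2(L,+\infty)\}$. Stationary system: real-valued $(\phi,\psi)\in D_0$ with $-\phi''+c\phi-\log(\phi^2)\phi=0$ on $(-L,L)$ and $-\psi''+c\psi-\log(\psi^2)\psi=0$ on $(L,+\infty)$. A positive single-lobe state is a solution $(\phi,\psi)\in D_0$ of this system such that each component is positive on its edge, the maximum of $(\phi,\psi)$ over $\mathcal G$ is attained at a single internal point symmetrically located on $[-L,L]$ (i.e. at $x=0$), $\phi$ is monotonically decreasing on $[0,L]$, and $\psi$ is strictly decreasing on $[L,+\infty)$. In that case $\psi_c(x)=e^{\frac{c+1}{2}}e^{-\frac{(x-L+a)^2}{2}}$ for $x\ge L$, with some $a>0$. The Morse index of a self-adjoint operator is the number of its negative eigenvalues counted with multiplicity. *)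

theory Defs
  imports "HOL-Analysis.Analysis" "HOL-Library.Function_Algebras" "HOL-Library.Extended_Nat"
begin

definition L2_on :: "real set \<Rightarrow> (real \<Rightarrow> 'a::euclidean_space) \<Rightarrow> bool" where
  "L2_on I u \<longleftrightarrow> u \<in> borel_measurable (lebesgue_on I) \<and>
     integrable (lebesgue_on I) (\<lambda>x. (norm (u x))\<^sup>2)"

text \<open>Sobolev spaces on an open interval follow the one-dimensional textbook definition
  (Brezis, Functional Analysis, Sobolev Spaces and PDE, Chapter 8): weak derivatives are
  tested against compactly supported \<open>C\<^sup>1\<close> functions, and \<open>H\<^sup>2\<close> consists of the \<open>H\<^sup>1\<close>
  functions whose weak derivative is again in \<open>H\<^sup>1\<close>.\<close>

definition C1c :: "real set \<Rightarrow> (real \<Rightarrow> real) \<Rightarrow> bool" where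
  "C1c I \<eta> \<longleftrightarrow> \<eta> C1_differentiable_on UNIV \<and>
     (\<exists>K. compact K \<and> K \<subseteq> I \<and> (\<forall>x. x \<notin> K \<longrightarrow> \<eta> x = 0))"

definition is_weak_deriv ::
  "real set \<Rightarrow> (real \<Rightarrow> 'a::euclidean_space) \<Rightarrow> (real \<Rightarrow> 'a) \<Rightarrow> bool" where
  "is_weak_deriv I u v \<longleftrightarrow> L2_on I v \<and>
     (\<forall>\<eta>. C1c I \<eta> \<longrightarrow>
        (\<integral>x. deriv \<eta> x *\<^sub>R u x \<partial>lebesgue_on I) = - (\<integral>x. \<eta> x *\<^sub>R v x \<partial>lebesgue_on I))"

text \<open>A representative of the weak derivative. It is determined only almost everywhere on
  \<open>I\<close>, so below it occurs only under almost-everywhere quantifiers or integrals.\<close>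

definition weak_deriv :: "real set \<Rightarrow> (real \<Rightarrow> 'a::euclidean_space) \<Rightarrow> real \<Rightarrow> 'a" where
  "weak_deriv I u = (SOME v. is_weak_deriv I u v)"

definition H1_on :: "real set \<Rightarrow> (real \<Rightarrow> 'a::euclidean_space) \<Rightarrow> bool" where
  "H1_on I u \<longleftrightarrow> L2_on I u \<and> (\<exists>v. is_weak_deriv I u v)"

definition H2_on :: "real set \<Rightarrow> (real \<Rightarrow> 'a::euclidean_space) \<Rightarrow> bool" where
  "H2_on I u \<longleftrightarrow> H1_on I u \<and> H1_on I (weak_deriv I u)"

abbreviation ring_edge :: "real \<Rightarrow> real set" where
  "ring_edge L \<equiv> {-L<..<L}"

abbreviation half_line :: "real \<Rightarrow> real set" where
  "half_line L \<equiv> {L<..}"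

type_synonym 'a graph_fun = "(real \<Rightarrow> 'a) \<times> (real \<Rightarrow> 'a)"

text \<open>Members of the operator domains are represented by the functions that are continuous
  on the closed edges and vanish off them. Thus every element of \<open>H\<^sup>2\<close> of the graph has exactly
  one representative, vertex values are meaningful, and dimensions of spaces of such
  representatives are the dimensions of the spaces of \<open>L\<^sup>2\<close> classes. The one-sided
  derivatives at the vertex exist, since \<open>H\<^sup>2\<close> functions are \<open>C\<^sup>1\<close> up to the endpoints.\<close>

definition dom0 :: "real \<Rightarrow> 'a::euclidean_space graph_fun set" where
  "dom0 L = {(f, g).
     H2_on (ring_edge L) f \<and> H2_on (half_line L) g \<and>
     continuous_on {-L..L} f \<and> continuous_on {L..} g \<and>
     (\<forall>x. x \<notin> {-L..L} \<longrightarrow> f x = 0) \<and> (\<forall>x. x \<notin> {L..} \<longrightarrow> g x = 0) \<and>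
     f L = f (-L) \<and> f L = g L \<and>
     vector_derivative f (at L within {-L..L}) - vector_derivative f (at (-L) within {-L..L})
       = vector_derivative g (at L within {L..})}"

definition dom_op :: "real \<Rightarrow> 'a::euclidean_space graph_fun set" where
  "dom_op L = {(f, g). (f, g) \<in> dom0 L \<and> L2_on (half_line L) (\<lambda>x. x\<^sup>2 *\<^sub>R g x)}"

definition stationary_on :: "real set \<Rightarrow> real \<Rightarrow> (real \<Rightarrow> real) \<Rightarrow> bool" where
  "stationary_on I c u \<longleftrightarrow>
     (AE x in lebesgue_on I.
        - weak_deriv I (weak_deriv I u) x + c * u x - ln ((u x)\<^sup>2) * u x = 0)"

definition positive_single_lobe ::
  "real \<Rightarrow> real \<Rightarrow> (real \<Rightarrow> real) \<Rightarrow> (real \<Rightarrow> real) \<Rightarrow> bool" where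
  "positive_single_lobe L c \<phi> \<psi> \<longleftrightarrow>
     (\<phi>, \<psi>) \<in> dom0 L \<and>
     stationary_on (ring_edge L) c \<phi> \<and> stationary_on (half_line L) c \<psi> \<and>
     (\<forall>x\<in>{-L..L}. \<phi> x > 0) \<and> (\<forall>x\<in>{L..}. \<psi> x > 0) \<and>
     (\<forall>x\<in>{-L..L}. x \<noteq> 0 \<longrightarrow> \<phi> x < \<phi> 0) \<and> (\<forall>x\<in>{L..}. \<psi> x < \<phi> 0) \<and>
     antimono_on {0..L} \<phi> \<and> strict_antimono_on {L..} \<psi>"

definition schroedinger_on ::
  "real set \<Rightarrow> real \<Rightarrow> (real \<Rightarrow> real) \<Rightarrow> (real \<Rightarrow> complex) \<Rightarrow> real \<Rightarrow> complex" where
  "schroedinger_on I c u f =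
     (\<lambda>x. - weak_deriv I (weak_deriv I f) x + of_real ((c - 2) - ln (\<bar>u x\<bar>\<^sup>2)) * f x)"

definition L1_op ::
  "real \<Rightarrow> real \<Rightarrow> (real \<Rightarrow> real) \<Rightarrow> (real \<Rightarrow> real) \<Rightarrow> complex graph_fun \<Rightarrow> complex graph_fun" where
  "L1_op L c \<phi> \<psi> = (\<lambda>(f, g).
     (schroedinger_on (ring_edge L) c \<phi> f, schroedinger_on (half_line L) c \<psi> g))"

definition graph_scale :: "complex \<Rightarrow> complex graph_fun \<Rightarrow> complex graph_fun" where
  "graph_scale k u = ((\<lambda>x. k * fst u x), (\<lambda>x. k * snd u x))"

global_interpretation graph_fun: vector_space graph_scale
  defines graph_span = graph_fun.span and graph_dim = graph_fun.dim
  by unfold_locales (auto simp: graph_scale_def fun_eq_iff algebra_simps)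

definition eq_L2 :: "real \<Rightarrow> complex graph_fun \<Rightarrow> complex graph_fun \<Rightarrow> bool" where
  "eq_L2 L u v \<longleftrightarrow> (AE x in lebesgue_on (ring_edge L). fst u x = fst v x) \<and>
     (AE x in lebesgue_on (half_line L). snd u x = snd v x)"

definition op_kernel ::
  "real \<Rightarrow> (complex graph_fun \<Rightarrow> complex graph_fun) \<Rightarrow> complex graph_fun set" where
  "op_kernel L A = {u \<in> dom_op L. eq_L2 L (A u) 0}"

text \<open>Only real spectral parameters are considered: the operators of interest are
  self-adjoint.\<close>

definition eigenspace ::
  "real \<Rightarrow> (complex graph_fun \<Rightarrow> complex graph_fun) \<Rightarrow> real \<Rightarrow> complex graph_fun set" where
  "eigenspace L A \<beta> = {u \<in> dom_op L. eq_L2 L (A u) (graph_scale (of_real \<beta>) u)}"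

definition eigenfunction ::
  "real \<Rightarrow> (complex graph_fun \<Rightarrow> complex graph_fun) \<Rightarrow> real \<Rightarrow> complex graph_fun \<Rightarrow> bool" where
  "eigenfunction L A \<beta> u \<longleftrightarrow> u \<in> eigenspace L A \<beta> \<and> u \<noteq> 0"

definition is_eigenvalue ::
  "real \<Rightarrow> (complex graph_fun \<Rightarrow> complex graph_fun) \<Rightarrow> real \<Rightarrow> bool" where
  "is_eigenvalue L A \<beta> \<longleftrightarrow> (\<exists>u. eigenfunction L A \<beta> u)"

definition smallest_eigenvalue ::
  "real \<Rightarrow> (complex graph_fun \<Rightarrow> complex graph_fun) \<Rightarrow> real \<Rightarrow> bool" where
  "smallest_eigenvalue L A \<beta> \<longleftrightarrow>
     is_eigenvalue L A \<beta> \<and> (\<forall>\<gamma>. is_eigenvalue L A \<gamma> \<longrightarrow> \<beta> \<le> \<gamma>)"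

text \<open>The library's \<open>dim\<close> is \<open>0\<close> on infinite-dimensional spaces, hence the case distinction.\<close>

definition eigen_mult ::
  "real \<Rightarrow> (complex graph_fun \<Rightarrow> complex graph_fun) \<Rightarrow> real \<Rightarrow> enat" where
  "eigen_mult L A \<beta> =
     (if \<exists>B. finite B \<and> eigenspace L A \<beta> \<subseteq> graph_span B
      then enat (graph_dim (eigenspace L A \<beta>)) else \<infinity>)"

definition morse_index ::
  "real \<Rightarrow> (complex graph_fun \<Rightarrow> complex graph_fun) \<Rightarrow> enat" where
  "morse_index L A =
     (let N = {\<beta>. \<beta> < 0 \<and> is_eigenvalue L A \<beta>}
      in if finite N then \<Sum>\<beta>\<in>N. eigen_mult L A \<beta> else \<infinity>)"

end

theory Submission
  imports Defs
begin

text \<open>Eigenfunctions for \<open>\<beta> \<le> 0\<close> are classical solutions on the closed edges. Comparison with \<open>\<phi>'\<close>,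
  which solves the linearized equation and vanishes on the ring only at \<open>0\<close>, kills their odd part. So
  every eigenfunction is a multiple of the real pair obtained by shooting: the even solution on the
  ring with value \<open>1\<close> at \<open>0\<close>, continued through the Kirchhoff condition to the half-line, where
  \<open>\<psi>\<close> is a Gaussian and the potential that of a harmonic oscillator.

  The core is a nondegeneracy inequality at the vertex for the even solution with \<open>\<beta> = 0\<close>. In terms
  of \<open>v = const - ln (\<phi>\<^sup>2)\<close> the profile equation is the Toda oscillator \<open>v'' = 2 (1 - exp v)\<close>, and
  the inequality is a lower bound for the derivative of \<open>v\<close> with respect to its initial value,
  obtained from barriers modelled on the derivative of the period integral.

  By Sturm comparison this inequality forces an eigenfunction with \<open>\<beta> \<le> 0\<close> to be positive, and
  excludes \<open>\<beta> = 0\<close>. Two positive eigenfunctions with different eigenvalues contradict the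
  Wronskian identity, so there is at most one such \<open>\<beta>\<close>; it exists as the supremum of the \<open>\<beta>\<close> for
  which the shooting pair is positive.\<close>

section \<open>Weak derivatives\<close>

text \<open>The inequality at the vertex is \<open>p' L < (1 / a - a) / 2 * p L\<close> for the even
  solution \<open>p\<close> at \<open>\<beta> = 0\<close>. Its threshold comes from the half-line:
  the decaying solution there is \<open>y * exp (- y\<^sup>2 / 2)\<close> with
  \<open>y = x - L + a\<close>, a multiple of \<open>\<psi>'\<close>. Its logarithmic derivative at
  the vertex is \<open>1 / a - a\<close>, and Kirchhoff's condition halves this for an even function
  on the ring. Equality would give a kernel element. The sign is a quantitative fact about how the
  profile moves with its maximum; constants such as \<open>1 / 12\<close> and \<open>25 / 36\<close>
  serve only this estimate. On the half-line no boundary term at infinity is evaluated. A Picone or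
  Wronskian quantity is monotone, so a wrong sign persists and bounds the eigenfunction from below,
  against the integrability of \<open>x ^ 4 * (g x)\<^sup>2\<close>, which is the weight condition
  of the domain.\<close>

lemma C1cE:
  assumes "C1c I \<eta>"
  obtains K where "compact K" "K \<subseteq> I" "\<And>x. x \<notin> K \<Longrightarrow> \<eta> x = 0" "\<And>x. x \<notin> K \<Longrightarrow> deriv \<eta> x = 0"
    "\<And>x. (\<eta> has_real_derivative deriv \<eta> x) (at x)" "continuous_on UNIV (deriv \<eta>)"
proof -
  from assms obtain K where K: "compact K" "K \<subseteq> I" "\<And>x. x \<notin> K \<Longrightarrow> \<eta> x = 0"
    and C1: "\<eta> C1_differentiable_on UNIV"
    unfolding C1c_def by blast
  from C1 obtain D where D: "\<And>x. (\<eta> has_vector_derivative D x) (at x)" "continuous_on UNIV D"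
    unfolding C1_differentiable_on_def by auto
  have der: "(\<eta> has_real_derivative D x) (at x)" for x
    using D(1) by (simp add: has_real_derivative_iff_has_vector_derivative)
  then have eq: "deriv \<eta> = D" by (auto intro: DERIV_imp_deriv)
  have "D x = 0" if "x \<notin> K" for x
  proof -
    have "((\<lambda>_. 0) has_real_derivative D x) (at x)"
      by (rule has_field_derivative_transform_within_open[OF der, of "-K"])
        (use that K in \<open>auto simp: compact_imp_closed open_Compl\<close>)
    then show ?thesis using DERIV_unique DERIV_const by blast
  qed
  then show ?thesis using that K der D(2) unfolding eq by blast
qed

lemma C1cI:
  assumes "\<And>x. (\<eta> has_real_derivative D x) (at x)" "continuous_on UNIV D"
    "compact K" "K \<subseteq> I" "\<And>x. x \<notin> K \<Longrightarrow> \<eta> x = 0"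
  shows "C1c I \<eta>"
  using assms unfolding C1c_def C1_differentiable_on_def
  by (auto simp: has_real_derivative_iff_has_vector_derivative)

lemma integrable_on_if_supported:
  fixes g :: "real \<Rightarrow> 'a::euclidean_space"
  assumes "continuous_on I g" "compact K" "K \<subseteq> I" "\<And>x. x \<in> I \<Longrightarrow> x \<notin> K \<Longrightarrow> g x = 0" "I \<in> sets lebesgue"
  shows "integrable (lebesgue_on I) g"
proof -
  have "integrable lborel (\<lambda>x. indicator K x *\<^sub>R g x)"
    using assms(1-3) by (intro borel_integrable_compact) (auto intro: continuous_on_subset)
  then have "integrable lebesgue (\<lambda>x. indicator K x *\<^sub>R g x)"
    by (rule integrable_completion[THEN iffD2, rotated]) (use \<open>integrable lborel _\<close> in auto)
  moreover have "indicator K x *\<^sub>R g x = indicator I x *\<^sub>R g x" for x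
    using assms by (auto simp: indicator_def)
  ultimately show ?thesis using assms(5) by (simp add: integrable_restrict_space)
qed

text \<open>Test functions need only be C^1, so a rational step suffices: the square removes the
  kink of \<open>max 0 y\<close> at the origin.\<close>

definition smooth_step :: "real \<Rightarrow> real" where
  "smooth_step y = (max 0 y)\<^sup>2 / (1 + (max 0 y)\<^sup>2)"

lemma has_real_derivative_max_sq:
  "((\<lambda>y::real. (max 0 y)\<^sup>2) has_real_derivative 2 * max 0 y) (at y)"
proof (cases "y = 0")
  case True
  have "((\<lambda>h. (max 0 h)\<^sup>2 / h) \<longlongrightarrow> 0) (at (0::real))"
  proof (rule tendsto_sandwich[of "\<lambda>h. - \<bar>h\<bar>" _ _ "\<lambda>h. \<bar>h\<bar>"])
    show "\<forall>\<^sub>F h in at (0::real). - \<bar>h\<bar> \<le> (max 0 h)\<^sup>2 / h"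
      by (intro always_eventually allI) (auto simp: max_def power2_eq_square)
    show "\<forall>\<^sub>F h in at (0::real). (max 0 h)\<^sup>2 / h \<le> \<bar>h\<bar>"
      by (intro always_eventually allI) (auto simp: max_def power2_eq_square)
    show "((\<lambda>h. - \<bar>h\<bar>) \<longlongrightarrow> 0) (at (0::real))" "((\<lambda>h. \<bar>h\<bar>) \<longlongrightarrow> 0) (at (0::real))"
      by (auto intro!: tendsto_eq_intros)
  qed
  then show ?thesis using True by (simp add: DERIV_def)
next
  case False
  consider "y > 0" | "y < 0" using False by linarith
  then show ?thesis
  proof cases
    case 1
    have "((\<lambda>y. y\<^sup>2) has_real_derivative 2 * max 0 y) (at y)"
      using 1 by (auto intro!: derivative_eq_intros)
    then show ?thesis
      by (rule has_field_derivative_transform_within_open[of _ _ _ "{0<..}"]) (use 1 in auto)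
  next
    case 2
    have "((\<lambda>y. 0) has_real_derivative 2 * max 0 y) (at y)"
      using 2 by (auto intro!: derivative_eq_intros)
    then show ?thesis
      by (rule has_field_derivative_transform_within_open[of _ _ _ "{..<0}"]) (use 2 in auto)
  qed
qed

lemma one_plus_max_sq_nz: "1 + (max 0 (y::real))\<^sup>2 \<noteq> 0"
  using zero_le_power2[of "max 0 y"] by linarith

lemma smooth_step_deriv:
  "(smooth_step has_real_derivative 2 * max 0 y / (1 + (max 0 y)\<^sup>2)\<^sup>2) (at y)"
  unfolding smooth_step_def[abs_def]
  by (rule derivative_eq_intros has_real_derivative_max_sq refl one_plus_max_sq_nz)+
    (simp add: power2_eq_square algebra_simps)

lemma smooth_step_eq_0: "y \<le> 0 \<Longrightarrow> smooth_step y = 0"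
  by (simp add: smooth_step_def)

lemma smooth_step_nonneg: "0 \<le> smooth_step y" and smooth_step_le_1: "smooth_step y \<le> 1"
  by (auto simp: smooth_step_def intro!: divide_nonneg_nonneg divide_le_eq_1_pos[THEN iffD2] add_pos_nonneg)

lemma smooth_step_tendsto:
  assumes "y > 0" shows "(\<lambda>n. smooth_step (real n * y)) \<longlonglongrightarrow> 1"
proof -
  have lim: "filterlim (\<lambda>n. 1 + (real n * y)\<^sup>2) at_top sequentially"
    by (intro filterlim_tendsto_add_at_top[OF tendsto_const] filterlim_pow_at_top
        filterlim_at_top_mult_tendsto_pos[OF tendsto_const assms] filterlim_real_sequentially) simp
  have "(\<lambda>n. 1 - inverse (1 + (real n * y)\<^sup>2)) \<longlonglongrightarrow> 1 - 0"
    by (intro tendsto_diff tendsto_const tendsto_inverse_0_at_top lim)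
  moreover have "smooth_step (real n * y) = 1 - inverse (1 + (real n * y)\<^sup>2)" for n
  proof -
    have "1 + (real n * y)\<^sup>2 \<noteq> 0" using zero_le_power2[of "real n * y"] by linarith
    then show ?thesis using assms by (simp add: smooth_step_def max_def field_simps)
  qed
  ultimately show ?thesis by simp
qed

text \<open>The scale \<open>n\<close> sharpens both flanks without moving the support. So all bumps
  are test functions once \<open>{s..t}\<close> lies in \<open>I\<close>, and they converge to the
  indicator of the open interval.\<close>

definition bump :: "real \<Rightarrow> real \<Rightarrow> nat \<Rightarrow> real \<Rightarrow> real" where
  "bump s t n x = smooth_step (real n * (x - s)) * smooth_step (real n * (t - x))"

lemma bump_C1:
  obtains D where "\<And>x. (bump s t n has_real_derivative D x) (at x)" "continuous_on UNIV D"
proof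
  let ?d = "\<lambda>y::real. 2 * max 0 y / (1 + (max 0 y)\<^sup>2)\<^sup>2"
  let ?D = "\<lambda>x. (?d (real n * (x - s)) * real n) * smooth_step (real n * (t - x)) +
     (?d (real n * (t - x)) * (- real n)) * smooth_step (real n * (x - s))"
  show "(bump s t n has_real_derivative ?D x) (at x)" for x
  proof -
    have "((\<lambda>x. real n * (x - s)) has_real_derivative real n) (at x)"
      "((\<lambda>x. real n * (t - x)) has_real_derivative - real n) (at x)"
      by (auto intro!: derivative_eq_intros)
    from this[THEN DERIV_chain2[OF smooth_step_deriv]] show ?thesis
      unfolding bump_def[abs_def] by (rule DERIV_mult)
  qed
  have "continuous_on UNIV smooth_step"
    using smooth_step_deriv by (meson DERIV_continuous continuous_at_imp_continuous_on)
  then have c: "continuous_on UNIV (\<lambda>x. smooth_step (f x))" if "continuous_on UNIV f" for f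
    using that by (rule continuous_on_compose2) auto
  show "continuous_on UNIV ?D"
    by (intro continuous_intros c) (simp_all only: power_eq_0_iff one_plus_max_sq_nz simp_thms, simp_all)
qed

lemma bump_eq_0: "x \<notin> {s..t} \<Longrightarrow> bump s t n x = 0"
  unfolding bump_def by (cases "x < s") (auto simp: smooth_step_eq_0 mult_nonneg_nonpos)

lemma bump_C1c: "{s..t} \<subseteq> I \<Longrightarrow> C1c I (bump s t n)"
  by (rule bump_C1[of s t n]) (rule C1cI[where K = "{s..t}"], auto simp: bump_eq_0)

lemma bump_tendsto: "(\<lambda>n. bump s t n x) \<longlonglongrightarrow> indicator {s<..<t} x"
proof (cases "x \<in> {s<..<t}")
  case True
  then have "(\<lambda>n. bump s t n x) \<longlonglongrightarrow> 1 * 1"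
    unfolding bump_def by (intro tendsto_mult smooth_step_tendsto) auto
  then show ?thesis using True by simp
next
  case False
  then have "bump s t n x = 0" for n
    unfolding bump_def by (cases "x \<le> s") (auto simp: smooth_step_eq_0 mult_nonneg_nonpos)
  then show ?thesis using False by simp
qed

lemma bump_bounds: "0 \<le> bump s t n x" "bump s t n x \<le> 1"
  unfolding bump_def using smooth_step_nonneg smooth_step_le_1
  by (auto intro: mult_le_one)

section \<open>Local integrability and the fundamental lemma of the calculus of variations\<close>

lemma indicator_measurable_lebesgue:
  "A \<in> sets borel \<Longrightarrow> indicat_real A \<in> borel_measurable lebesgue"
  by (intro measurable_completion) (simp add: borel_measurable_indicator)

text \<open>The function is extended by zero and the intervals may reach past the ends of
  \<open>I\<close>, so this is integrability up to the boundary, stronger than the usual local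
  notion. It covers \<open>L2_on\<close> functions and continuous functions on the line, whose
  differences are needed later.\<close>

definition loc_integrable :: "real set \<Rightarrow> (real \<Rightarrow> 'a::euclidean_space) \<Rightarrow> bool" where
  "loc_integrable I w \<longleftrightarrow>
     (\<forall>a b. (\<lambda>x. if x \<in> I then w x else 0) absolutely_integrable_on {a..b})"

lemma loc_integrable_L2:
  fixes w :: "real \<Rightarrow> 'a::euclidean_space"
  assumes w: "L2_on I w" and I: "I \<in> sets lebesgue"
  shows "loc_integrable I w"
  unfolding loc_integrable_def
proof (intro allI)
  fix a b :: real
  have "integrable lebesgue (\<lambda>x. indicator I x *\<^sub>R ((norm (w x))\<^sup>2))"
    using w I unfolding L2_on_def by (simp add: integrable_restrict_space)
  moreover have "integrable lebesgue (\<lambda>x. indicator {a..b} x *\<^sub>R (1::real))"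
    using lmeasurable_cbox[of a b] by (simp add: lmeasurable_iff_integrable)
  ultimately have int: "integrable lebesgue (\<lambda>x. indicator I x *\<^sub>R ((norm (w x))\<^sup>2) + indicator {a..b} x *\<^sub>R (1::real))"
    by (rule Bochner_Integration.integrable_add)
  have m: "(\<lambda>x. indicator I x *\<^sub>R w x) \<in> borel_measurable lebesgue"
    using w I unfolding L2_on_def by (simp add: borel_measurable_restrict_space_iff)
  have "(\<lambda>x. if x \<in> I then w x else 0) = (\<lambda>x. indicator I x *\<^sub>R w x)"
    by (auto simp: indicator_def)
  moreover have "integrable lebesgue (\<lambda>x. indicator {a..b} x *\<^sub>R (indicator I x *\<^sub>R w x))"
  proof (rule Bochner_Integration.integrable_bound[OF int])
    show "(\<lambda>x. indicator {a..b} x *\<^sub>R (indicator I x *\<^sub>R w x)) \<in> borel_measurable lebesgue"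
      by (rule borel_measurable_scaleR[OF indicator_measurable_lebesgue m]) simp
    have "n \<le> n\<^sup>2 + 1" for n :: real
    proof -
      have "2 * n \<le> n\<^sup>2 + 1" using zero_le_power2[of "n - 1"] by (simp add: power2_diff)
      then show ?thesis using zero_le_power2[of n] by linarith
    qed
    then show "AE x in lebesgue. norm (indicator {a..b} x *\<^sub>R (indicator I x *\<^sub>R w x))
        \<le> norm (indicator I x *\<^sub>R ((norm (w x))\<^sup>2) + indicator {a..b} x *\<^sub>R (1::real))"
      by (intro AE_I2) (simp add: indicator_def)
  qed
  ultimately show "(\<lambda>x. if x \<in> I then w x else 0) absolutely_integrable_on {a..b}"
    by (simp add: set_integrable_def)
qed

lemma loc_integrable_continuous:
  assumes "continuous_on UNIV w" "I \<in> sets lebesgue"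
  shows "loc_integrable I w"
  unfolding loc_integrable_def
proof (intro allI)
  fix a b :: real
  have "w absolutely_integrable_on {a..b}"
    using assms(1) by (intro absolutely_integrable_continuous_real) (rule continuous_on_subset, auto)
  then have "set_integrable lebesgue ({a..b} \<inter> I) w"
    by (rule set_integrable_subset) (use assms(2) in auto)
  then show "(\<lambda>x. if x \<in> I then w x else 0) absolutely_integrable_on {a..b}"
    unfolding set_integrable_def by (rule Bochner_Integration.integrable_cong[THEN iffD1, rotated 2])
      (auto simp: indicator_def)
qed

lemma loc_integrable_diff:
  assumes "loc_integrable I v" "loc_integrable I w"
  shows "loc_integrable I (\<lambda>x. v x - w x)"
  unfolding loc_integrable_def
proof (intro allI)
  fix a b :: real
  have "(\<lambda>x. (if x \<in> I then v x else 0) - (if x \<in> I then w x else 0)) absolutely_integrable_on {a..b}"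
    using assms unfolding loc_integrable_def by (intro set_integral_diff(1)) auto
  moreover have "(\<lambda>x. (if x \<in> I then v x else 0) - (if x \<in> I then w x else 0)) =
      (\<lambda>x. if x \<in> I then v x - w x else 0)" by auto
  ultimately show "(\<lambda>x. if x \<in> I then v x - w x else 0) absolutely_integrable_on {a..b}"
    by simp
qed

lemma integrable_test_mult:
  fixes w :: "real \<Rightarrow> 'a::euclidean_space"
  assumes "continuous_on UNIV g" "compact K" "K \<subseteq> I" "\<And>x. x \<notin> K \<Longrightarrow> g x = (0::real)"
    and w: "loc_integrable I w" and I: "I \<in> sets lebesgue"
  shows "integrable (lebesgue_on I) (\<lambda>x. g x *\<^sub>R w x)"
proof -
  obtain b where "K \<subseteq> cbox (- b) b"
    using bounded_subset_cbox_symmetric[OF compact_imp_bounded[OF assms(2)]] .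
  then obtain a where ab: "K \<subseteq> {a..b}" by auto
  have "compact (g ` {a..b})"
    using assms(1) by (intro compact_continuous_image) (rule continuous_on_subset, auto)
  then have "bounded (g ` {a..b})" by (rule compact_imp_bounded)
  then obtain M where M: "\<And>x. x \<in> {a..b} \<Longrightarrow> \<bar>g x\<bar> \<le> M"
    unfolding bounded_iff by force
  have gm: "g \<in> borel_measurable lebesgue"
    using assms(1) by (intro measurable_completion) (simp add: borel_measurable_continuous_onI)
  let ?w = "\<lambda>x. indicator {a..b} x *\<^sub>R (if x \<in> I then w x else 0)"
  have int: "integrable lebesgue ?w"
    using w unfolding loc_integrable_def set_integrable_def by blast
  have "integrable lebesgue (\<lambda>x. g x *\<^sub>R ?w x)"
  proof (rule Bochner_Integration.integrable_bound)
    show "integrable lebesgue (\<lambda>x. M *\<^sub>R ?w x)" using int by (rule integrable_scaleR_right)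
    show "(\<lambda>x. g x *\<^sub>R ?w x) \<in> borel_measurable lebesgue"
      by (rule borel_measurable_scaleR[OF gm borel_measurable_integrable[OF int]])
    have "\<bar>g x\<bar> * norm (w x) \<le> \<bar>M\<bar> * norm (w x)" if "x \<in> {a..b}" for x
      using M[OF that] by (intro mult_right_mono) auto
    then show "AE x in lebesgue. norm (g x *\<^sub>R ?w x) \<le> norm (M *\<^sub>R ?w x)"
      by (intro AE_I2) (simp add: indicator_def)
  qed
  moreover have "g x *\<^sub>R ?w x = indicator I x *\<^sub>R (g x *\<^sub>R w x)" for x
    using ab assms(3,4) by (cases "x \<in> K") (auto simp: indicator_def)
  ultimately show ?thesis using I by (simp add: integrable_restrict_space)
qed

text \<open>Testing against the bumps gives vanishing integrals over all compact subintervals, so the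
  claim is Lebesgue's differentiation theorem.\<close>

lemma AE_zero_if_test_integrals_zero:
  fixes w :: "real \<Rightarrow> 'a::euclidean_space"
  assumes w: "loc_integrable I w" and I: "open I"
    and zero: "\<And>\<eta>. C1c I \<eta> \<Longrightarrow> (\<integral>x. \<eta> x *\<^sub>R w x \<partial>lebesgue_on I) = 0"
  shows "AE x in lebesgue_on I. w x = 0"
proof -
  have Im: "I \<in> sets lebesgue" using I by auto
  define w0 where "w0 = (\<lambda>x. if x \<in> I then w x else 0)"
  have w0: "w0 absolutely_integrable_on {a..b}" for a b
    using w unfolding w0_def loc_integrable_def by blast
  have int0: "integral {s..t} w0 = 0" if st: "{s..t} \<subseteq> I" for s t
  proof -
    have aint: "integrable lebesgue (\<lambda>x. indicator {s..t} x *\<^sub>R w0 x)"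
      using w0[of s t] by (simp add: set_integrable_def)
    have "(\<lambda>n. \<integral>x. bump s t n x *\<^sub>R (indicator {s..t} x *\<^sub>R w0 x) \<partial>lebesgue) \<longlonglongrightarrow> 
        (\<integral>x. indicator {s<..<t} x *\<^sub>R (indicator {s..t} x *\<^sub>R w0 x) \<partial>lebesgue)"
    proof (rule integral_dominated_convergence)
      show "integrable lebesgue (\<lambda>x. norm (indicator {s..t} x *\<^sub>R w0 x))"
        using aint by (rule integrable_norm)
      show "AE x in lebesgue. (\<lambda>n. bump s t n x *\<^sub>R (indicator {s..t} x *\<^sub>R w0 x))
         \<longlonglongrightarrow> indicator {s<..<t} x *\<^sub>R (indicator {s..t} x *\<^sub>R w0 x)"
        by (intro AE_I2 tendsto_intros bump_tendsto)
      show "AE x in lebesgue. norm (bump s t n x *\<^sub>R (indicator {s..t} x *\<^sub>R w0 x))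
         \<le> norm (indicator {s..t} x *\<^sub>R w0 x)" for n
        using bump_bounds[of s t n]
        by (intro AE_I2) (simp add: mult_left_le_one_le mult.assoc)
      have "continuous_on UNIV (bump s t n)" for n
        by (rule bump_C1[of s t n]) (meson DERIV_continuous continuous_at_imp_continuous_on)
      then have "bump s t n \<in> borel_measurable lebesgue" for n
        by (intro measurable_completion) (simp add: borel_measurable_continuous_onI)
      then show "(\<lambda>x. bump s t n x *\<^sub>R (indicator {s..t} x *\<^sub>R w0 x)) \<in> borel_measurable lebesgue" for n
        by (rule borel_measurable_scaleR[OF _ borel_measurable_integrable[OF aint]])
      show "(\<lambda>x. indicator {s<..<t} x *\<^sub>R (indicator {s..t} x *\<^sub>R w0 x)) \<in> borel_measurable lebesgue"
        by (rule borel_measurable_scaleR[OF indicator_measurable_lebesgue borel_measurable_integrable[OF aint]]) simp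
    qed
    moreover have "(\<integral>x. bump s t n x *\<^sub>R (indicator {s..t} x *\<^sub>R w0 x) \<partial>lebesgue) = 0" for n
    proof -
      have "bump s t n x *\<^sub>R (indicator {s..t} x *\<^sub>R w0 x) = indicator I x *\<^sub>R (bump s t n x *\<^sub>R w x)" for x
        using bump_eq_0[of x s t n] st by (auto simp: indicator_def w0_def)
      then show ?thesis
        using zero[OF bump_C1c[OF st, of n]] Im by (simp add: integral_restrict_space)
    qed
    ultimately have "(\<integral>x. indicator {s<..<t} x *\<^sub>R (indicator {s..t} x *\<^sub>R w0 x) \<partial>lebesgue) = 0"
      by (simp add: LIMSEQ_const_iff)
    moreover have "(\<lambda>x. indicator {s<..<t} x *\<^sub>R (indicator {s..t} x *\<^sub>R w0 x)) = (\<lambda>x. indicator {s<..<t} x *\<^sub>R w0 x)"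
      by (auto simp: indicator_def fun_eq_iff)
    moreover have "w0 absolutely_integrable_on {s<..<t}"
      by (rule set_integrable_subset[OF w0[of s t]]) auto
    ultimately have "integral {s<..<t} w0 = 0"
      using set_lebesgue_integral_eq_integral(2)[of "{s<..<t}" w0] by (simp add: set_lebesgue_integral_def)
    then show ?thesis
      by (simp add: integral_open_interval_real)
  qed
  obtain N where N: "negligible N" "\<And>x e. \<lbrakk>x \<notin> N; 0 < e\<rbrakk> \<Longrightarrow>
     \<exists>d>0. \<forall>h. 0 < h \<and> h < d \<longrightarrow> norm (integral (cbox x (x + h *\<^sub>R One)) w0 /\<^sub>R h ^ DIM(real) - w0 x) < e"
    by (rule integrable_ccontinuous_explicit[of w0])
      (use w0 in \<open>auto simp: absolutely_integrable_on_def\<close>)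
  have "w x = 0" if x: "x \<in> I" "x \<notin> N" for x
  proof (rule ccontr)
    assume "w x \<noteq> 0"
    then have "norm (w0 x) > 0" using x by (simp add: w0_def)
    from N(2)[OF x(2) this] obtain d where d: "d > 0"
      "\<And>h. 0 < h \<and> h < d \<Longrightarrow> norm (integral {x..x+h} w0 /\<^sub>R h - w0 x) < norm (w0 x)"
      by auto
    obtain r where r: "r > 0" "ball x r \<subseteq> I" using I x openE by blast
    define h where "h = min d r / 2"
    have h: "0 < h" "h < d" "h < r" using d r by (auto simp: h_def)
    then have "{x..x+h} \<subseteq> I" using r by (auto simp: dist_real_def subset_iff)
    then have "norm (w0 x) < norm (w0 x)" using d(2)[of h] int0[of x "x+h"] h by simp
    then show False by simp
  qed
  then have sub: "{x \<in> space (lebesgue_on I). \<not> (w x = 0)} \<subseteq> N \<inter> I" by auto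
  have nul: "N \<inter> I \<in> null_sets (lebesgue_on I)"
  proof -
    have "N \<in> null_sets lebesgue" using N(1) negligible_iff_null_sets by blast
    then have "N \<inter> I \<in> null_sets lebesgue" using Im by (rule null_set_Int2)
    then show ?thesis using Im by (simp add: null_sets_restrict_space)
  qed
  from AE_I'[OF nul sub] show ?thesis .
qed

lemma compact_subset_Icc_interval:
  fixes I :: "real set"
  assumes "is_interval I" "compact K" "K \<subseteq> I" "s < t" "{s..t} \<subseteq> I"
  obtains p q where "p < q" "{p..q} \<subseteq> I" "K \<subseteq> {p..q}" "{s..t} \<subseteq> {p..q}"
proof -
  let ?K = "K \<union> {s..t}"
  have c: "compact ?K" using assms by auto
  have ne: "?K \<noteq> {}" using assms by auto
  obtain p where p: "p \<in> ?K" "\<And>x. x \<in> ?K \<Longrightarrow> p \<le> x" using compact_attains_inf[OF c ne] by blast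
  obtain q where q: "q \<in> ?K" "\<And>x. x \<in> ?K \<Longrightarrow> x \<le> q" using compact_attains_sup[OF c ne] by blast
  have pq: "p \<in> I" "q \<in> I" using p q assms by auto
  have "x \<in> I" if "x \<in> {p..q}" for x
    using mem_is_interval_1_I[OF assms(1) pq] that by simp
  then have "{p..q} \<subseteq> I" by blast
  moreover have "p < q" using p(2)[of s] q(2)[of t] assms by auto
  moreover have "?K \<subseteq> {p..q}" using p q by auto
  ultimately show ?thesis using that by blast
qed

lemma lebesgue_integral_supported:
  fixes g :: "real \<Rightarrow> 'a::euclidean_space"
  assumes "integrable (lebesgue_on I) g" "I \<in> sets lebesgue" "{p..q} \<subseteq> I"
    "\<And>x. x \<in> I \<Longrightarrow> x \<notin> {p..q} \<Longrightarrow> g x = 0"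
  shows "(\<integral>x. g x \<partial>lebesgue_on I) = integral {p..q} g"
proof -
  have "(\<integral>x. g x \<partial>lebesgue_on I) = integral I g"
    using assms by (intro lebesgue_integral_eq_integral)
  also have "\<dots> = integral I (\<lambda>x. if x \<in> {p..q} then g x else 0)"
    using assms by (intro integral_cong) auto
  also have "\<dots> = integral {p..q} g"
    using assms(3) by (simp only: integral_restrict_Int Int_absorb2)
  finally show ?thesis .
qed

lemma antiderivative_on_UNIV:
  fixes f :: "real \<Rightarrow> 'a::euclidean_space"
  assumes "continuous_on UNIV f"
  obtains F where "\<And>x. (F has_vector_derivative f x) (at x)"
  using einterval_antiderivative[of "-\<infinity>" "\<infinity>" f] assms
  by (auto simp: continuous_on_eq_continuous_at)

text \<open>A primitive is constant on each side of \<open>{p..q}\<close>. The vanishing integral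
  makes the two constants equal, and subtracting them leaves a compactly supported function.\<close>

lemma C1c_primitive:
  assumes cont: "continuous_on UNIV \<zeta>" and supp: "\<And>x. x \<notin> {p..q} \<Longrightarrow> \<zeta> x = 0"
    and pq: "p \<le> q" "{p..q} \<subseteq> I" and int: "integral {p..q} \<zeta> = 0"
  obtains \<eta> where "C1c I \<eta>" "\<And>x. deriv \<eta> x = \<zeta> x"
proof -
  obtain F where F: "\<And>x. (F has_vector_derivative \<zeta> x) (at x)"
    using antiderivative_on_UNIV[OF cont] by blast
  then have F': "(F has_real_derivative \<zeta> x) (at x)" for x
    by (simp add: has_real_derivative_iff_has_vector_derivative)
  have Fc: "continuous_on A F" for A
    using F' by (meson DERIV_continuous continuous_at_imp_continuous_on)
  have "(\<zeta> has_integral F q - F p) {p..q}"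
    using pq F by (intro fundamental_theorem_of_calculus) (auto intro: has_vector_derivative_at_within)
  then have Fpq: "F q = F p" using int by (simp add: integral_unique)
  have left: "F x = F p" if "x < p" for x
    using DERIV_isconst_end[OF that Fc] F' supp
    by (metis atLeastAtMost_iff linorder_not_le)
  have right: "F x = F q" if "q < x" for x
    using DERIV_isconst_end[OF that Fc] F' supp that
    by (metis atLeastAtMost_iff linorder_not_le)
  have D: "((\<lambda>x. F x - F p) has_real_derivative \<zeta> x) (at x)" for x
    using DERIV_diff[OF F'[of x] DERIV_const[of "F p" "at x"]] by simp
  show ?thesis
  proof
    show "C1c I (\<lambda>x. F x - F p)"
      by (rule C1cI[OF D cont, of "{p..q}"]) (use pq left right Fpq in auto)
    show "deriv (\<lambda>x. F x - F p) x = \<zeta> x" for x by (rule DERIV_imp_deriv[OF D])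
  qed
qed

text \<open>\<open>F\<close> is differentiable on \<open>I\<close> only, but the product with
  \<open>\<eta>\<close>, extended by zero, is differentiable on the whole line because the support
  of \<open>\<eta>\<close> is a compact subset of \<open>I\<close>. The fundamental theorem on an
  interval whose ends avoid the support then has no boundary terms.\<close>

lemma integration_by_parts_C1c:
  fixes F :: "real \<Rightarrow> 'a::euclidean_space"
  assumes I: "open I" and \<eta>: "C1c I \<eta>"
    and F: "\<And>x. x \<in> I \<Longrightarrow> (F has_vector_derivative F' x) (at x)" and F': "continuous_on I F'"
  shows "(\<integral>x. deriv \<eta> x *\<^sub>R F x \<partial>lebesgue_on I) = - (\<integral>x. \<eta> x *\<^sub>R F' x \<partial>lebesgue_on I)"
proof -
  have Im: "I \<in> sets lebesgue" using I by auto
  obtain K where K: "compact K" "K \<subseteq> I" "\<And>x. x \<notin> K \<Longrightarrow> \<eta> x = 0" "\<And>x. x \<notin> K \<Longrightarrow> deriv \<eta> x = 0"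
    "\<And>x. (\<eta> has_real_derivative deriv \<eta> x) (at x)" "continuous_on UNIV (deriv \<eta>)"
    by (rule C1cE[OF \<eta>]) (rule that; simp)
  have c\<eta>: "continuous_on I \<eta>" using K(5) by (meson DERIV_continuous continuous_at_imp_continuous_on)
  have cF: "continuous_on I F"
    using F by (meson continuous_at_imp_continuous_on has_vector_derivative_continuous)
  have i1: "integrable (lebesgue_on I) (\<lambda>x. deriv \<eta> x *\<^sub>R F x)"
    by (rule integrable_on_if_supported[OF _ K(1,2)])
      (use K Im cF in \<open>auto intro!: continuous_intros elim: continuous_on_subset\<close>)
  have i2: "integrable (lebesgue_on I) (\<lambda>x. \<eta> x *\<^sub>R F' x)"
    by (rule integrable_on_if_supported[OF _ K(1,2)])
      (use K Im c\<eta> F' in \<open>auto intro!: continuous_intros elim: continuous_on_subset\<close>)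
  define G where "G = (\<lambda>x. if x \<in> I then \<eta> x *\<^sub>R F x else 0)"
  define g where "g = (\<lambda>x. if x \<in> I then deriv \<eta> x *\<^sub>R F x + \<eta> x *\<^sub>R F' x else 0)"
  have G: "(G has_vector_derivative g x) (at x)" for x
  proof (cases "x \<in> I")
    case True
    have "((\<lambda>x. \<eta> x *\<^sub>R F x) has_vector_derivative \<eta> x *\<^sub>R F' x + deriv \<eta> x *\<^sub>R F x) (at x)"
      by (rule has_vector_derivative_scaleR[OF K(5) F[OF True]])
    then have "((\<lambda>x. \<eta> x *\<^sub>R F x) has_vector_derivative g x) (at x)"
      using True by (simp add: g_def add.commute)
    then show ?thesis
      by (rule has_vector_derivative_transform_within_open[OF _ I True]) (simp add: G_def)
  next
    case False
    then have "x \<in> -K" "g x = 0" using K by (auto simp: g_def)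
    have "((\<lambda>_. 0) has_vector_derivative g x) (at x)" using \<open>g x = 0\<close> by simp
    then show ?thesis
      by (rule has_vector_derivative_transform_within_open[of _ _ _ "-K"])
        (use K \<open>x \<in> -K\<close> in \<open>auto simp: G_def compact_imp_closed open_Compl\<close>)
  qed
  obtain c where "K \<subseteq> cbox (-c) c"
    using bounded_subset_cbox_symmetric[OF compact_imp_bounded[OF K(1)]] .
  then have c: "K \<subseteq> {-c..c}" by simp
  define d where "d = \<bar>c\<bar> + 1"
  have d: "K \<subseteq> {-d..d}" "d \<notin> K" "- d \<notin> K" "-d \<le> d" using c by (force simp: d_def)+
  have "(g has_integral G d - G (-d)) {-d..d}"
    using G d by (intro fundamental_theorem_of_calculus) (auto intro: has_vector_derivative_at_within)
  moreover have "G d = 0" "G (-d) = 0" using d K by (auto simp: G_def)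
  ultimately have z: "integral {-d..d} g = 0" by (simp add: integral_unique)
  let ?g = "\<lambda>x. deriv \<eta> x *\<^sub>R F x + \<eta> x *\<^sub>R F' x"
  have "(\<integral>x. ?g x \<partial>lebesgue_on I) = integral I ?g"
    using i1 i2 Im by (intro lebesgue_integral_eq_integral) auto
  also have "\<dots> = integral UNIV g"
    unfolding g_def by (rule integral_restrict_UNIV[symmetric])
  also have "\<dots> = integral UNIV (\<lambda>x. if x \<in> {-d..d} then g x else 0)"
  proof (intro integral_cong)
    fix x show "g x = (if x \<in> {-d..d} then g x else 0)"
    proof (cases "x \<in> K")
      case True
      then have "x \<in> {-d..d}" using d(1) by blast
      then show ?thesis by simp
    qed (simp add: g_def K(3,4))
  qed
  also have "\<dots> = integral {-d..d} g" by (rule integral_restrict_UNIV)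
  finally have "(\<integral>x. ?g x \<partial>lebesgue_on I) = 0" using z by simp
  then show ?thesis using i1 i2 by (simp add: eq_neg_iff_add_eq_0)
qed

text \<open>The argument of du Bois-Reymond: subtracting from a test function the multiple of a
  fixed bump with the same integral leaves the derivative of another test function. Hence
  \<open>w\<close> minus its bump-weighted mean \<open>C\<close> is annihilated by all test
  functions.\<close>

lemma AE_const_if_test_deriv_zero:
  fixes w :: "real \<Rightarrow> 'a::euclidean_space"
  assumes I: "open I" "is_interval I" and st: "s < t" "{s..t} \<subseteq> I" and w: "loc_integrable I w"
    and zero: "\<And>\<eta>. C1c I \<eta> \<Longrightarrow> (\<integral>x. deriv \<eta> x *\<^sub>R w x \<partial>lebesgue_on I) = 0"
  obtains C where "AE x in lebesgue_on I. w x = C"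
proof -
  have Im: "I \<in> sets lebesgue" using I by auto
  let ?b = "bump s t 1"
  obtain D where D: "\<And>x. (?b has_real_derivative D x) (at x)" using bump_C1 by blast
  have bc: "continuous_on A ?b" for A using D by (meson DERIV_continuous continuous_at_imp_continuous_on)
  have ib: "integral {s..t} ?b \<noteq> 0"
  proof
    assume "integral {s..t} ?b = 0"
    then have "\<forall>x\<in>{s..t}. ?b x = 0"
      using integral_eq_0_iff[OF bc st(1)] bump_bounds by blast
    then have "?b ((s+t)/2) = 0" using st by auto
    moreover have "?b ((s+t)/2) > 0"
      using st one_plus_max_sq_nz by (auto simp: bump_def smooth_step_def max_def divide_simps add_pos_nonneg)
    ultimately show False by simp
  qed
  define c0 where "c0 = integral {s..t} ?b"
  have ibI: "integrable (lebesgue_on I) (\<lambda>x. ?b x *\<^sub>R w x)"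
    by (rule integrable_test_mult[OF bc _ st(2) _ w Im]) (auto simp: bump_eq_0)
  define C where "C = (\<integral>x. ?b x *\<^sub>R w x \<partial>lebesgue_on I) /\<^sub>R c0"
  have "AE x in lebesgue_on I. w x - C = 0"
  proof (rule AE_zero_if_test_integrals_zero[OF _ I(1)])
    show "loc_integrable I (\<lambda>x. w x - C)"
      by (intro loc_integrable_diff w loc_integrable_continuous Im continuous_on_const)
    fix \<eta> assume \<eta>: "C1c I \<eta>"
    obtain K where K: "compact K" "K \<subseteq> I" "\<And>x. x \<notin> K \<Longrightarrow> \<eta> x = 0"
      "\<And>x. (\<eta> has_real_derivative deriv \<eta> x) (at x)"
      by (rule C1cE[OF \<eta>]) (rule that; simp)
    have \<eta>c: "continuous_on A \<eta>" for A using K(4) by (meson DERIV_continuous continuous_at_imp_continuous_on)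
    obtain p q where pq: "p < q" "{p..q} \<subseteq> I" "K \<subseteq> {p..q}" "{s..t} \<subseteq> {p..q}"
      using compact_subset_Icc_interval[OF I(2) K(1,2) st] .
    have bpq: "integral {p..q} ?b = c0"
    proof -
      have "integral {p..q} ?b = integral {p..q} (\<lambda>x. if x \<in> {s..t} then ?b x else 0)"
        by (intro integral_cong) (auto simp: bump_eq_0)
      also have "\<dots> = integral {s..t} ?b" using pq(4) by (simp only: integral_restrict_Int Int_absorb2)
      finally show ?thesis by (simp add: c0_def)
    qed
    define m where "m = integral {p..q} \<eta>"
    define \<zeta> where "\<zeta> = (\<lambda>x. \<eta> x - m / c0 * ?b x)"
    have "integral {p..q} \<zeta> = integral {p..q} \<eta> - integral {p..q} (\<lambda>x. m / c0 * ?b x)"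
      unfolding \<zeta>_def by (intro integral_diff integrable_continuous_interval continuous_intros \<eta>c bc)
    also have "\<dots> = 0" using bpq ib by (simp add: m_def c0_def)
    finally have i0: "integral {p..q} \<zeta> = 0" .
    obtain \<theta> where \<theta>: "C1c I \<theta>" "\<And>x. deriv \<theta> x = \<zeta> x"
    proof (rule C1c_primitive[OF _ _ _ pq(2) i0])
      show "continuous_on UNIV \<zeta>" unfolding \<zeta>_def by (intro continuous_intros \<eta>c bc)
      show "\<zeta> x = 0" if "x \<notin> {p..q}" for x
      proof -
        have "x \<notin> K" "x \<notin> {s..t}" using that pq by blast+
        then show ?thesis using K(3)[of x] bump_eq_0[of x s t 1] by (simp add: \<zeta>_def)
      qed
    qed (use pq in auto)
    have i\<eta>w: "integrable (lebesgue_on I) (\<lambda>x. \<eta> x *\<^sub>R w x)"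
      by (rule integrable_test_mult[OF \<eta>c K(1-3) w Im])
    have i\<eta>: "integrable (lebesgue_on I) \<eta>"
      by (rule integrable_on_if_supported[OF \<eta>c K(1,2) _ Im]) (use K in auto)
    have "(\<integral>x. \<eta> x \<partial>lebesgue_on I) = m"
      unfolding m_def by (rule lebesgue_integral_supported[OF i\<eta> Im pq(2)], rule K(3), use pq(3) in blast)
    moreover have "(\<integral>x. \<eta> x *\<^sub>R w x \<partial>lebesgue_on I) = m *\<^sub>R C"
    proof -
      have "0 = (\<integral>x. \<zeta> x *\<^sub>R w x \<partial>lebesgue_on I)" using zero[OF \<theta>(1)] \<theta>(2) by simp
      also have "\<dots> = (\<integral>x. \<eta> x *\<^sub>R w x - (m / c0) *\<^sub>R (?b x *\<^sub>R w x) \<partial>lebesgue_on I)"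
        by (simp add: \<zeta>_def scaleR_diff_left)
      also have "\<dots> = (\<integral>x. \<eta> x *\<^sub>R w x \<partial>lebesgue_on I) - (m / c0) *\<^sub>R (\<integral>x. ?b x *\<^sub>R w x \<partial>lebesgue_on I)"
        by (simp only: Bochner_Integration.integral_diff[OF i\<eta>w integrable_scaleR_right[OF ibI]] integral_scaleR_right)
      finally show ?thesis by (simp add: C_def divide_inverse)
    qed
    ultimately show "(\<integral>x. \<eta> x *\<^sub>R (w x - C) \<partial>lebesgue_on I) = 0"
      using i\<eta> i\<eta>w by (simp add: scaleR_diff_right)
  qed
  then show ?thesis using that by simp
qed

lemma is_weak_deriv_unique:
  fixes u :: "real \<Rightarrow> 'a::euclidean_space"
  assumes "open I" "is_weak_deriv I u v" "is_weak_deriv I u v'"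
  shows "AE x in lebesgue_on I. v x = v' x"
proof -
  have Im: "I \<in> sets lebesgue" using assms by auto
  have l: "loc_integrable I v" "loc_integrable I v'"
    using assms Im unfolding is_weak_deriv_def by (auto intro: loc_integrable_L2)
  have "AE x in lebesgue_on I. v x - v' x = 0"
  proof (rule AE_zero_if_test_integrals_zero[OF loc_integrable_diff[OF l] assms(1)])
    fix \<eta> assume \<eta>: "C1c I \<eta>"
    obtain K where K: "compact K" "K \<subseteq> I" "\<And>x. x \<notin> K \<Longrightarrow> \<eta> x = 0"
      "\<And>x. (\<eta> has_real_derivative deriv \<eta> x) (at x)"
      by (rule C1cE[OF \<eta>]) (rule that; simp)
    have \<eta>c: "continuous_on UNIV \<eta>" using K(4) by (meson DERIV_continuous continuous_at_imp_continuous_on)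
    have i: "integrable (lebesgue_on I) (\<lambda>x. \<eta> x *\<^sub>R w x)" if "loc_integrable I w" for w :: "real \<Rightarrow> 'a"
      by (rule integrable_test_mult[OF \<eta>c K(1-3) that Im])
    from i[OF l(1)] i[OF l(2)] show "(\<integral>x. \<eta> x *\<^sub>R (v x - v' x) \<partial>lebesgue_on I) = 0"
      using assms(2,3) \<eta> unfolding is_weak_deriv_def by (simp add: scaleR_diff_right)
  qed
  then show ?thesis by simp
qed

section \<open>Passage between weak and classical derivatives\<close>

lemma eq_on_closure_if_AE_eq:
  fixes u v :: "real \<Rightarrow> 'a::euclidean_space"
  assumes "open I" "AE x in lebesgue_on I. u x = v x"
    and "continuous_on (closure I) u" "continuous_on (closure I) v" "x \<in> closure I"
  shows "u x = v x"
proof -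
  have Im: "I \<in> sets lebesgue" using assms(1) by auto
  let ?A = "I \<inter> (\<lambda>x. u x - v x) -` (-{0})"
  have "continuous_on I (\<lambda>x. u x - v x)"
    using assms(3,4) closure_subset[of I] by (intro continuous_intros) (auto elim: continuous_on_subset)
  then have op: "open ?A" using assms(1) by (intro continuous_open_preimage) auto
  obtain N where N: "N \<in> null_sets (lebesgue_on I)" "{x \<in> space (lebesgue_on I). \<not> u x = v x} \<subseteq> N"
    using assms(2) by (auto elim!: AE_E simp: null_sets_def)
  then have "N \<in> null_sets lebesgue" using Im by (simp add: null_sets_restrict_space)
  then have "negligible N" by (simp add: negligible_iff_null_sets)
  moreover have "?A \<subseteq> N" using N(2) by auto
  ultimately have "negligible ?A" by (rule negligible_subset)
  then have "?A = {}" using op open_not_negligible by blast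
  then have eq: "\<And>x. x \<in> I \<Longrightarrow> u x - v x = 0" by auto
  have "continuous_on (closure I) (\<lambda>x. u x - v x)"
    using assms(3,4) by (intro continuous_intros)
  from continuous_constant_on_closure[OF this eq assms(5)] show ?thesis by simp
qed

lemma continuous_on_extend:
  fixes r :: "real \<Rightarrow> 'a::euclidean_space"
  assumes "closed J" "continuous_on J r"
  obtains r' where "continuous_on UNIV r'" "\<And>x. x \<in> J \<Longrightarrow> r' x = r x"
proof -
  have cl: "closedin (top_of_set UNIV) J" using assms(1) by simp
  show ?thesis
    by (rule Dugundji[OF _ _ cl assms(2), where C = UNIV]) (use that in auto)
qed

lemma H1_weak_deriv:
  assumes "H1_on I u" shows "is_weak_deriv I u (weak_deriv I u)"
proof -
  have ex: "\<exists>v. is_weak_deriv I u v" using assms unfolding H1_on_def by blast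
  show ?thesis unfolding weak_deriv_def by (rule someI_ex[OF ex])
qed

text \<open>Subtracting from the weak first derivative a primitive of the right-hand side, and then
  from the function a primitive of the result, leaves functions with vanishing weak derivative.\<close>

lemma H2_classical:
  fixes u r :: "real \<Rightarrow> 'a::euclidean_space"
  assumes I: "open I" "is_interval I" "s < t" "{s..t} \<subseteq> I"
    and H2: "H2_on I u" and cu: "continuous_on (closure I) u" and cr: "continuous_on (closure I) r"
    and eq: "AE x in lebesgue_on I. weak_deriv I (weak_deriv I u) x = r x"
  obtains u' where "\<And>x. x \<in> closure I \<Longrightarrow> (u has_vector_derivative u' x) (at x within closure I)"
    "\<And>x. x \<in> closure I \<Longrightarrow> (u' has_vector_derivative r x) (at x within closure I)"
proof -
  have Im: "I \<in> sets lebesgue" using I by auto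
  define v where "v = weak_deriv I u"
  define w where "w = weak_deriv I v"
  have v: "is_weak_deriv I u v" and w: "is_weak_deriv I v w"
    using H2 unfolding H2_on_def v_def w_def by (auto intro: H1_weak_deriv)
  have li: "loc_integrable I u" "loc_integrable I v" "loc_integrable I w"
    using H2 v w Im unfolding H2_on_def H1_on_def is_weak_deriv_def by (auto intro!: loc_integrable_L2)
  \<comment> \<open>With the right-hand side extended continuously to the whole line its primitives
    are C^1 there, so the one-sided derivatives at the ends of the interval come for free by
    restriction.\<close>
  obtain r' where r': "continuous_on UNIV r'" "\<And>x. x \<in> closure I \<Longrightarrow> r' x = r x"
    using continuous_on_extend[OF closed_closure cr] by metis
  obtain H where H: "\<And>x. (H has_vector_derivative r' x) (at x)"
    using antiderivative_on_UNIV[OF r'(1)] by blast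
  have Hc: "continuous_on UNIV H"
    using H by (meson continuous_at_imp_continuous_on has_vector_derivative_continuous)
  have wr: "AE x in lebesgue_on I. w x = r' x"
  proof (rule AE_mp[OF eq])
    show "AE x in lebesgue_on I. weak_deriv I (weak_deriv I u) x = r x \<longrightarrow> w x = r' x"
      using r'(2) closure_subset[of I] by (intro AE_I2) (auto simp: v_def w_def)
  qed
  have step: thesis' if "is_weak_deriv I f g" "loc_integrable I f" "AE x in lebesgue_on I. g x = G' x"
    "\<And>x. (G has_vector_derivative G' x) (at x)" "continuous_on UNIV G'"
    "\<And>C. AE x in lebesgue_on I. f x = G x + C \<Longrightarrow> thesis'" for f g G G' :: "real \<Rightarrow> 'a" and thesis'
  proof -
    note hyp = that
    have Gc: "continuous_on UNIV G"
      using hyp(4) by (meson continuous_at_imp_continuous_on has_vector_derivative_continuous)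
    have Gl: "loc_integrable I G" by (rule loc_integrable_continuous[OF Gc Im])
    have Gl': "loc_integrable I G'" by (rule loc_integrable_continuous[OF hyp(5) Im])
    obtain C where "AE x in lebesgue_on I. f x - G x = C"
    proof (rule AE_const_if_test_deriv_zero[OF I loc_integrable_diff[OF hyp(2) Gl]])
      fix \<eta> assume \<eta>: "C1c I \<eta>"
      obtain K where K: "compact K" "K \<subseteq> I" "\<And>x. x \<notin> K \<Longrightarrow> \<eta> x = 0" "\<And>x. x \<notin> K \<Longrightarrow> deriv \<eta> x = 0"
        "\<And>x. (\<eta> has_real_derivative deriv \<eta> x) (at x)" "continuous_on UNIV (deriv \<eta>)"
        by (rule C1cE[OF \<eta>]) (rule that; simp)
      have i: "integrable (lebesgue_on I) (\<lambda>x. deriv \<eta> x *\<^sub>R h x)" if "loc_integrable I h" for h :: "real \<Rightarrow> 'a"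
        by (rule integrable_test_mult[OF K(6) K(1,2) K(4) that Im])
      have "(\<integral>x. deriv \<eta> x *\<^sub>R (f x - G x) \<partial>lebesgue_on I) =
          (\<integral>x. deriv \<eta> x *\<^sub>R f x \<partial>lebesgue_on I) - (\<integral>x. deriv \<eta> x *\<^sub>R G x \<partial>lebesgue_on I)"
        using i[OF hyp(2)] i[OF Gl] by (simp add: scaleR_diff_right)
      also have "(\<integral>x. deriv \<eta> x *\<^sub>R G x \<partial>lebesgue_on I) = - (\<integral>x. \<eta> x *\<^sub>R G' x \<partial>lebesgue_on I)"
        by (rule integration_by_parts_C1c[OF I(1) \<eta> hyp(4)])
          (use hyp(5) in \<open>auto elim: continuous_on_subset\<close>)
      also have "(\<integral>x. \<eta> x *\<^sub>R G' x \<partial>lebesgue_on I) = (\<integral>x. \<eta> x *\<^sub>R g x \<partial>lebesgue_on I)"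
      proof (rule integral_cong_AE)
        have \<eta>c: "continuous_on UNIV \<eta>" using K(5) by (meson DERIV_continuous continuous_at_imp_continuous_on)
        show "(\<lambda>x. \<eta> x *\<^sub>R G' x) \<in> borel_measurable (lebesgue_on I)"
          by (rule borel_measurable_integrable, rule integrable_test_mult[OF \<eta>c K(1-3) Gl' Im])
        have "loc_integrable I g"
          using hyp(1) Im unfolding is_weak_deriv_def by (auto intro: loc_integrable_L2)
        then show "(\<lambda>x. \<eta> x *\<^sub>R g x) \<in> borel_measurable (lebesgue_on I)"
          using integrable_test_mult[OF \<eta>c K(1-3) _ Im] by (intro borel_measurable_integrable) simp
        show "AE x in lebesgue_on I. \<eta> x *\<^sub>R G' x = \<eta> x *\<^sub>R g x"
          using hyp(3) by eventually_elim simp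
      qed
      finally show "(\<integral>x. deriv \<eta> x *\<^sub>R (f x - G x) \<partial>lebesgue_on I) = 0"
        using hyp(1) \<eta> unfolding is_weak_deriv_def by simp
    qed blast
    then have "AE x in lebesgue_on I. f x = G x + C" by eventually_elim (simp add: algebra_simps)
    then show thesis' by (rule hyp(6))
  qed
  obtain C where C: "AE x in lebesgue_on I. v x = H x + C"
    by (rule step[OF w li(2) wr H r'(1)]) (rule that)
  have H': "((\<lambda>x. H x + C) has_vector_derivative r' x) (at x)" for x
    using has_vector_derivative_add[OF H[of x] has_vector_derivative_const[of C]] by simp
  have Hc': "continuous_on UNIV (\<lambda>x. H x + C)" using Hc by (intro continuous_intros)
  obtain U where U: "\<And>x. (U has_vector_derivative H x + C) (at x)"
    using antiderivative_on_UNIV[OF Hc'] by blast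
  have Uc: "continuous_on UNIV U"
    using U by (meson continuous_at_imp_continuous_on has_vector_derivative_continuous)
  obtain C' where C': "AE x in lebesgue_on I. u x = U x + C'"
    by (rule step[OF v li(1) C U Hc']) (rule that)
  have ueq: "u x = U x + C'" if "x \<in> closure I" for x
    by (rule eq_on_closure_if_AE_eq[OF I(1) C' cu _ that])
      (use Uc in \<open>auto intro!: continuous_intros elim: continuous_on_subset\<close>)
  show ?thesis
  proof (rule that[of "\<lambda>x. H x + C"])
    fix x assume x: "x \<in> closure I"
    have "((\<lambda>x. U x + C') has_vector_derivative H x + C) (at x within closure I)"
      using has_vector_derivative_add[OF U[of x] has_vector_derivative_const[of C']]
      by (simp add: has_vector_derivative_at_within)
    then show "(u has_vector_derivative H x + C) (at x within closure I)"
      by (rule has_vector_derivative_transform[OF x, rotated]) (simp add: ueq)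
    show "((\<lambda>x. H x + C) has_vector_derivative r x) (at x within closure I)"
      using H'[of x] r'(2)[OF x] by (simp add: has_vector_derivative_at_within)
  qed
qed

lemma H1_classical:
  fixes u u' :: "real \<Rightarrow> 'a::euclidean_space"
  assumes I: "open I" and u: "\<And>x. x \<in> I \<Longrightarrow> (u has_vector_derivative u' x) (at x)"
    and c: "continuous_on I u'" and L2: "L2_on I u" "L2_on I u'"
  shows "H1_on I u" "AE x in lebesgue_on I. weak_deriv I u x = u' x"
proof -
  have wd: "is_weak_deriv I u u'"
    using integration_by_parts_C1c[OF I _ u c] L2(2) unfolding is_weak_deriv_def by blast
  then show "H1_on I u" using L2(1) unfolding H1_on_def by blast
  have "is_weak_deriv I u (weak_deriv I u)"
    by (rule H1_weak_deriv[OF \<open>H1_on I u\<close>])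
  from is_weak_deriv_unique[OF I this wd]
  show "AE x in lebesgue_on I. weak_deriv I u x = u' x" .
qed

text \<open>\<open>weak_deriv\<close> is an arbitrary choice that agrees with the classical
  derivative only almost everywhere. This transfers the second weak derivative from the classical
  first derivative to the chosen one.\<close>

lemma is_weak_deriv_cong_AE:
  fixes u v :: "real \<Rightarrow> 'a::euclidean_space"
  assumes I: "open I" and eq: "AE x in lebesgue_on I. u x = v x"
    and L2: "L2_on I u" "L2_on I v" and w: "is_weak_deriv I v w"
  shows "is_weak_deriv I u w"
  unfolding is_weak_deriv_def
proof (intro conjI allI impI)
  have Im: "I \<in> sets lebesgue" using I by auto
  show "L2_on I w" using w unfolding is_weak_deriv_def by blast
  fix \<eta> assume \<eta>: "C1c I \<eta>"
  obtain K where K: "compact K" "K \<subseteq> I" "\<And>x. x \<notin> K \<Longrightarrow> \<eta> x = 0" "\<And>x. x \<notin> K \<Longrightarrow> deriv \<eta> x = 0"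
    "\<And>x. (\<eta> has_real_derivative deriv \<eta> x) (at x)" "continuous_on UNIV (deriv \<eta>)"
    by (rule C1cE[OF \<eta>]) (rule that; simp)
  have m: "(\<lambda>x. deriv \<eta> x *\<^sub>R h x) \<in> borel_measurable (lebesgue_on I)" if "L2_on I h" for h :: "real \<Rightarrow> 'a"
    by (rule borel_measurable_integrable, rule integrable_test_mult[OF K(6) K(1,2) K(4) loc_integrable_L2[OF that Im] Im])
  have "(\<integral>x. deriv \<eta> x *\<^sub>R u x \<partial>lebesgue_on I) = (\<integral>x. deriv \<eta> x *\<^sub>R v x \<partial>lebesgue_on I)"
    by (intro integral_cong_AE m L2) (use eq in eventually_elim, simp)
  also have "\<dots> = - (\<integral>x. \<eta> x *\<^sub>R w x \<partial>lebesgue_on I)"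
    using w \<eta> unfolding is_weak_deriv_def by blast
  finally show "(\<integral>x. deriv \<eta> x *\<^sub>R u x \<partial>lebesgue_on I) = - (\<integral>x. \<eta> x *\<^sub>R w x \<partial>lebesgue_on I)" .
qed

lemma classical_H2:
  fixes u u' u'' :: "real \<Rightarrow> 'a::euclidean_space"
  assumes I: "open I" and u: "\<And>x. x \<in> I \<Longrightarrow> (u has_vector_derivative u' x) (at x)"
    and u': "\<And>x. x \<in> I \<Longrightarrow> (u' has_vector_derivative u'' x) (at x)"
    and c: "continuous_on I u''" and L2: "L2_on I u" "L2_on I u'" "L2_on I u''"
  shows "H2_on I u" "AE x in lebesgue_on I. weak_deriv I (weak_deriv I u) x = u'' x"
proof -
  have c': "continuous_on I u'"
    using u' by (meson continuous_at_imp_continuous_on has_vector_derivative_continuous)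
  have wd': "is_weak_deriv I u' u''"
    using integration_by_parts_C1c[OF I _ u' c] L2(3) unfolding is_weak_deriv_def by blast
  have wd: "is_weak_deriv I u u'"
    using integration_by_parts_C1c[OF I _ u c'] L2(2) unfolding is_weak_deriv_def by blast
  then have wu: "is_weak_deriv I u (weak_deriv I u)"
    using L2(1) by (intro H1_weak_deriv) (auto simp: H1_on_def)
  have L2w: "L2_on I (weak_deriv I u)" using wu unfolding is_weak_deriv_def by blast
  have w2: "is_weak_deriv I (weak_deriv I u) u''"
    by (rule is_weak_deriv_cong_AE[OF I H1_classical(2)[OF I u c' L2(1,2)] L2w L2(2) wd'])
  then have H1w: "H1_on I (weak_deriv I u)" using L2w unfolding H1_on_def by blast
  then show "H2_on I u"
    using H1_classical(1)[OF I u c' L2(1,2)] unfolding H2_on_def by blast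
  have "is_weak_deriv I (weak_deriv I u) (weak_deriv I (weak_deriv I u))"
    by (rule H1_weak_deriv[OF H1w])
  from is_weak_deriv_unique[OF I this w2]
  show "AE x in lebesgue_on I. weak_deriv I (weak_deriv I u) x = u'' x" .
qed

section \<open>Linear second order equations\<close>

lemma deriv_within_at:
  "(f has_real_derivative D) (at x within {a..b}) \<Longrightarrow> a < x \<Longrightarrow> x < b \<Longrightarrow>
    (f has_real_derivative D) (at x)"
  by (simp add: at_within_Icc_at)

text \<open>The derivative is taken within \<open>T\<close> and its sign is needed only strictly
  between the two points. This covers one-sided derivatives at the vertex and sign conditions that
  fail at an endpoint.\<close>

lemma nonneg_deriv_mono:
  fixes f :: "real \<Rightarrow> real"
  assumes "is_interval T" "x \<in> T" "y \<in> T" "x \<le> y"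
    and D: "\<And>z. z \<in> T \<Longrightarrow> (f has_real_derivative f' z) (at z within T)"
    and nn: "\<And>z. z \<in> T \<Longrightarrow> x < z \<Longrightarrow> z < y \<Longrightarrow> 0 \<le> f' z"
  shows "f x \<le> f y"
proof -
  have sub: "{x..y} \<subseteq> T" using mem_is_interval_1_I[OF assms(1-3)] by auto
  have D': "(f has_real_derivative f' z) (at z within {x..y})" if "z \<in> {x..y}" for z
    by (rule DERIV_subset[OF D sub]) (use that sub in auto)
  show ?thesis
  proof (rule DERIV_nonneg_imp_increasing_open[OF assms(4)])
    show "continuous_on {x..y} f" using D' by (rule DERIV_continuous_on)
    fix z assume z: "x < z" "z < y"
    show "\<exists>d. (f has_real_derivative d) (at z) \<and> 0 \<le> d"
    proof -
      have "z \<in> {x..y}" using z by simp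
      moreover from this have "z \<in> T" using sub by blast
      ultimately show ?thesis using deriv_within_at[OF D' z] nn[of z] z by blast
    qed
  qed
qed

lemma pos_deriv_strict_mono:
  fixes f :: "real \<Rightarrow> real"
  assumes "is_interval T" "x \<in> T" "y \<in> T" "x < y"
    and D: "\<And>z. z \<in> T \<Longrightarrow> (f has_real_derivative f' z) (at z within T)"
    and nn: "\<And>z. z \<in> T \<Longrightarrow> x < z \<Longrightarrow> z < y \<Longrightarrow> 0 < f' z"
  shows "f x < f y"
proof -
  have sub: "{x..y} \<subseteq> T" using mem_is_interval_1_I[OF assms(1-3)] by auto
  have D': "(f has_real_derivative f' z) (at z within {x..y})" if "z \<in> {x..y}" for z
    by (rule DERIV_subset[OF D sub]) (use that sub in auto)
  show ?thesis
  proof (rule DERIV_pos_imp_increasing_open[OF assms(4)])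
    show "continuous_on {x..y} f" using D' by (rule DERIV_continuous_on)
    fix z assume z: "x < z" "z < y"
    show "\<exists>d. (f has_real_derivative d) (at z) \<and> 0 < d"
    proof -
      have "z \<in> {x..y}" using z by simp
      moreover from this have "z \<in> T" using sub by blast
      ultimately show ?thesis using deriv_within_at[OF D' z] nn[of z] z by blast
    qed
  qed
qed

text \<open>The derivative is an explicit argument, so Wronskians and vertex data can be written
  without \<open>deriv\<close>. Differentiation within \<open>T\<close> includes the one-sided
  derivatives at endpoints.\<close>

definition ode2 :: "real set \<Rightarrow> (real \<Rightarrow> real) \<Rightarrow> (real \<Rightarrow> real) \<Rightarrow> (real \<Rightarrow> real) \<Rightarrow> bool" where
  "ode2 T V u u' \<longleftrightarrow> (\<forall>x\<in>T. (u has_real_derivative u' x) (at x within T) \<and>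
      (u' has_real_derivative V x * u x) (at x within T))"

lemma ode2D:
  assumes "ode2 T V u u'" "x \<in> T"
  shows "(u has_real_derivative u' x) (at x within T)"
    "(u' has_real_derivative V x * u x) (at x within T)"
  using assms by (auto simp: ode2_def)

lemma ode2_subset: "ode2 T V u u' \<Longrightarrow> S \<subseteq> T \<Longrightarrow> ode2 S V u u'"
  unfolding ode2_def by (meson DERIV_subset subsetD)

lemma ode2_continuous:
  assumes "ode2 T V u u'" shows "continuous_on T u" "continuous_on T u'"
  by (rule DERIV_continuous_on, rule ode2D[OF assms], assumption)+

lemma ode2_cong:
  assumes "ode2 T V u u'" "\<And>x. x \<in> T \<Longrightarrow> V x = W x" shows "ode2 T W u u'"
  using assms unfolding ode2_def by auto

lemma ode2_wronskian:
  assumes "ode2 T V u u'" "ode2 T W v v'" "x \<in> T"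
  shows "((\<lambda>x. u' x * v x - u x * v' x) has_real_derivative (V x - W x) * u x * v x) (at x within T)"
  by (rule derivative_eq_intros ode2D[OF assms(1,3)] ode2D[OF assms(2,3)] refl)+ (simp add: algebra_simps)

text \<open>\<open>N = d\<^sup>2 + d'\<^sup>2\<close> satisfies
  \<open>N' \<le> (M + 2) * N + e\<^sup>2\<close>, by two uses of
  \<open>2 * r * s \<le> r\<^sup>2 + s\<^sup>2\<close>. Multiplying by the exponential turns this
  into monotonicity of \<open>h\<close>, so no integral is formed.\<close>

lemma gronwall2:
  assumes ab: "a \<le> b" "x \<in> {a..b}"
    and d: "\<And>x. x \<in> {a..b} \<Longrightarrow> (d has_real_derivative d' x) (at x within {a..b})"
    and d': "\<And>x. x \<in> {a..b} \<Longrightarrow> (d' has_real_derivative d'' x) (at x within {a..b})"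
    and bd: "\<And>x. x \<in> {a..b} \<Longrightarrow> \<bar>d'' x\<bar> \<le> M * \<bar>d x\<bar> + e" and M: "M \<ge> 0" "e \<ge> 0"
  shows "(d x)\<^sup>2 + (d' x)\<^sup>2 \<le> exp ((M + 2) * (b - a)) * ((d a)\<^sup>2 + (d' a)\<^sup>2 + e\<^sup>2 * (b - a))"
proof -
  define K where "K = M + 2"
  define N where "N = (\<lambda>x. (d x)\<^sup>2 + (d' x)\<^sup>2)"
  define h where "h = (\<lambda>x. e\<^sup>2 * (x - a) - N x * exp (- K * (x - a)))"
  have "h a \<le> h x"
  proof (rule nonneg_deriv_mono[where f = h and T = "{a..b}"])
    fix z assume z: "z \<in> {a..b}"
    show "(h has_real_derivative
        e\<^sup>2 - ((2 * d z * d' z + 2 * d' z * d'' z) - K * N z) * exp (- K * (z - a))) (at z within {a..b})"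
      unfolding h_def N_def
      by (rule derivative_eq_intros d[OF z] d'[OF z] refl)+ (simp add: algebra_simps power2_eq_square)
    have 1: "2 * d z * d' z \<le> (d z)\<^sup>2 + (d' z)\<^sup>2" by (rule sum_squares_bound)
    have "2 * d' z * d'' z \<le> 2 * \<bar>d' z\<bar> * \<bar>d'' z\<bar>"
      by (metis abs_ge_self abs_mult abs_numeral)
    also have "\<dots> \<le> 2 * \<bar>d' z\<bar> * (M * \<bar>d z\<bar> + e)"
      using bd[OF z] by (intro mult_left_mono) auto
    also have "\<dots> = M * (2 * \<bar>d z\<bar> * \<bar>d' z\<bar>) + 2 * \<bar>d' z\<bar> * e" by (simp add: algebra_simps)
    also have "\<dots> \<le> M * (\<bar>d z\<bar>\<^sup>2 + \<bar>d' z\<bar>\<^sup>2) + (\<bar>d' z\<bar>\<^sup>2 + e\<^sup>2)"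
      using M by (intro add_mono mult_left_mono sum_squares_bound)
    finally have "2 * d' z * d'' z \<le> M * ((d z)\<^sup>2 + (d' z)\<^sup>2) + (d' z)\<^sup>2 + e\<^sup>2" by simp
    then have "(2 * d z * d' z + 2 * d' z * d'' z) - K * N z \<le> e\<^sup>2"
    proof -
      have "K * N z = M * N z + 2 * N z" by (simp add: K_def algebra_simps)
      moreover have "2 * d' z * d'' z \<le> M * N z + (d' z)\<^sup>2 + e\<^sup>2"
        unfolding N_def by fact
      moreover have "2 * d z * d' z \<le> N z" "(d' z)\<^sup>2 \<le> N z" using 1 by (simp_all add: N_def)
      ultimately show ?thesis by linarith
    qed
    then have "((2 * d z * d' z + 2 * d' z * d'' z) - K * N z) * exp (- K * (z - a)) \<le> e\<^sup>2 * exp (- K * (z - a))"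
      by (intro mult_right_mono) auto
    also have "\<dots> \<le> e\<^sup>2 * 1"
      using z M by (intro mult_left_mono) (auto simp: K_def intro!: mult_nonpos_nonneg)
    finally show "0 \<le> e\<^sup>2 - ((2 * d z * d' z + 2 * d' z * d'' z) - K * N z) * exp (- K * (z - a))" by simp
  qed (use ab in \<open>auto simp: is_interval_cc\<close>)
  then have "N x * exp (- K * (x - a)) \<le> N a + e\<^sup>2 * (x - a)" by (simp add: h_def)
  also have "\<dots> \<le> N a + e\<^sup>2 * (b - a)" using ab by (intro add_left_mono mult_left_mono) auto
  finally have 2: "N x * exp (- K * (x - a)) \<le> N a + e\<^sup>2 * (b - a)" .
  have "N x = exp (K * (x - a)) * (N x * exp (- K * (x - a)))"
  proof -
    have "exp (K * (x - a)) * exp (- K * (x - a)) = 1" by (simp flip: exp_add)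
    then show ?thesis by (metis mult.left_commute mult.right_neutral)
  qed
  also have "\<dots> \<le> exp (K * (x - a)) * (N a + e\<^sup>2 * (b - a))"
    using 2 by (intro mult_left_mono) auto
  also have "\<dots> \<le> exp (K * (b - a)) * (N a + e\<^sup>2 * (b - a))"
    using ab M by (intro mult_right_mono) (auto simp: K_def N_def intro!: mult_left_mono)
  finally show ?thesis by (simp add: N_def K_def)
qed

lemma zero_if_gronwall2:
  assumes ab: "a \<le> b" "x \<in> {a..b}"
    and d: "\<And>x. x \<in> {a..b} \<Longrightarrow> (d has_real_derivative d' x) (at x within {a..b})"
    and d': "\<And>x. x \<in> {a..b} \<Longrightarrow> (d' has_real_derivative d'' x) (at x within {a..b})"
    and bd: "\<And>x. x \<in> {a..b} \<Longrightarrow> \<bar>d'' x\<bar> \<le> M * \<bar>d x\<bar>" and init: "d a = 0" "d' a = 0"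
  shows "d x = 0 \<and> d' x = 0"
proof -
  have "\<bar>d'' x\<bar> \<le> \<bar>M\<bar> * \<bar>d x\<bar> + 0" if "x \<in> {a..b}" for x
    using bd[OF that] mult_right_mono[OF abs_ge_self[of M], of "\<bar>d x\<bar>"] by simp
  from gronwall2[OF ab d d' this] init have "(d x)\<^sup>2 + (d' x)\<^sup>2 \<le> 0" by simp
  then show ?thesis by (simp add: sum_power2_le_zero_iff)
qed

lemma continuous_on_Icc_bounded:
  fixes V :: "real \<Rightarrow> real"
  assumes "continuous_on {a..b} V"
  obtains M where "M \<ge> 0" "\<And>x. x \<in> {a..b} \<Longrightarrow> \<bar>V x\<bar> \<le> M"
proof -
  have "bounded (V ` {a..b})" using assms by (intro compact_imp_bounded compact_continuous_image) auto
  then obtain M where "\<forall>y\<in>V ` {a..b}. norm y \<le> M" by (auto simp: bounded_iff)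
  then show ?thesis using that[of "\<bar>M\<bar>"] by force
qed

lemma ode2_unique:
  assumes V: "continuous_on {a..b} V" and u: "ode2 {a..b} V u u'" and v: "ode2 {a..b} V v v'"
    and init: "u a = v a" "u' a = v' a" and x: "x \<in> {a..b}"
  shows "u x = v x" "u' x = v' x"
proof -
  obtain M where M: "\<And>x. x \<in> {a..b} \<Longrightarrow> \<bar>V x\<bar> \<le> M" using continuous_on_Icc_bounded[OF V] by metis
  let ?d = "\<lambda>x. u x - v x" and ?d' = "\<lambda>x. u' x - v' x"
  have ab: "a \<le> b" using x by simp
  have "?d x = 0 \<and> ?d' x = 0"
  proof (rule zero_if_gronwall2[OF ab x])
    fix z assume z: "z \<in> {a..b}"
    show "((\<lambda>x. u x - v x) has_real_derivative u' z - v' z) (at z within {a..b})"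
      by (rule DERIV_diff[OF ode2D(1)[OF u z] ode2D(1)[OF v z]])
    show "((\<lambda>x. u' x - v' x) has_real_derivative V z * u z - V z * v z) (at z within {a..b})"
      by (rule DERIV_diff[OF ode2D(2)[OF u z] ode2D(2)[OF v z]])
    show "\<bar>V z * u z - V z * v z\<bar> \<le> M * \<bar>u z - v z\<bar>"
      using M[OF z] by (simp flip: right_diff_distrib add: abs_mult mult_right_mono)
  qed (use init in auto)
  then show "u x = v x" "u' x = v' x" by auto
qed

lemma has_real_derivative_reflect:
  assumes "(f has_real_derivative D) (at (- x) within uminus ` S)"
  shows "((\<lambda>t. f (- t)) has_real_derivative - D) (at (x::real) within S)"
proof -
  have "(uminus has_real_derivative - 1) (at x within S)"
    by (auto intro!: derivative_eq_intros)
  from DERIV_image_chain[OF assms this] show ?thesis by (simp add: o_def)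
qed


text \<open>To the right of \<open>z\<close> this is uniqueness against the zero solution; the left
  side is reduced to it by reflection.\<close>

lemma ode2_double_zero:
  assumes T: "is_interval T" and V: "continuous_on T V" and u: "ode2 T V u u'"
    and init: "z \<in> T" "u z = 0" "u' z = 0" and x: "x \<in> T"
  shows "u x = 0" "u' x = 0"
proof -
  have zero: "ode2 S W (\<lambda>_. 0) (\<lambda>_. 0)" for S W by (simp add: ode2_def)
  have "u x = 0 \<and> u' x = 0"
  proof (cases "z \<le> x")
    case True
    then have sub: "{z..x} \<subseteq> T" using mem_is_interval_1_I[OF T init(1) x] by auto
    show ?thesis
      using ode2_unique[OF continuous_on_subset[OF V sub] ode2_subset[OF u sub] zero, of x] init True by auto
  next
    case False
    then have sub: "{x..z} \<subseteq> T" using mem_is_interval_1_I[OF T x init(1)] by auto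
    have refl: "ode2 {-z..-x} (\<lambda>t. V (- t)) (\<lambda>t. u (- t)) (\<lambda>t. - u' (- t))"
      unfolding ode2_def
    proof
      fix t assume t: "t \<in> {-z..-x}"
      then have t': "- t \<in> {x..z}" by auto
      have im: "uminus ` {-z..-x} = {x..z}" by simp
      note D = ode2D[OF ode2_subset[OF u sub] t', folded im, THEN has_real_derivative_reflect]
      note 1 = D(1) and 2 = D(2)
      from 1 DERIV_minus[OF 2]
      show "((\<lambda>t. u (- t)) has_real_derivative - u' (- t)) (at t within {-z..-x}) \<and>
        ((\<lambda>t. - u' (- t)) has_real_derivative V (- t) * u (- t)) (at t within {-z..-x})" by simp
    qed
    have Vc: "continuous_on {-z..-x} (\<lambda>t. V (- t))"
      by (rule continuous_on_compose2[OF V]) (use sub in \<open>auto intro!: continuous_intros\<close>)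
    show ?thesis
      using ode2_unique[OF Vc refl zero, of "- x"] init False by auto
  qed
  then show "u x = 0" "u' x = 0" by auto
qed

text \<open>\<open>\<delta>\<close> is a shift of the spectral parameter. The difference of the two
  solutions satisfies the perturbed equation with inhomogeneity \<open>\<delta> * u\<close>, to
  which the Gronwall estimate applies.\<close>

lemma ode2_continuous_dependence:
  assumes ab: "a \<le> b" and V: "continuous_on {a..b} V" and u: "ode2 {a..b} V u u'" and e: "e > 0"
  obtains \<eta> where "\<eta> > 0" "\<And>\<delta> v v' x. \<lbrakk>\<bar>\<delta>\<bar> < \<eta>; ode2 {a..b} (\<lambda>x. V x + \<delta>) v v';
     \<bar>v a - u a\<bar> < \<eta>; \<bar>v' a - u' a\<bar> < \<eta>; x \<in> {a..b}\<rbrakk> \<Longrightarrow> \<bar>v x - u x\<bar> < e \<and> \<bar>v' x - u' x\<bar> < e"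
proof -
  obtain M where M: "M \<ge> 0" "\<And>x. x \<in> {a..b} \<Longrightarrow> \<bar>V x\<bar> \<le> M" using continuous_on_Icc_bounded[OF V] by metis
  obtain U where U: "U \<ge> 0" "\<And>x. x \<in> {a..b} \<Longrightarrow> \<bar>u x\<bar> \<le> U"
    using continuous_on_Icc_bounded[OF ode2_continuous(1)[OF u]] by metis
  define C where "C = exp ((M + 1 + 2) * (b - a)) * (2 + U\<^sup>2 * (b - a))"
  have C: "C > 0" using ab unfolding C_def by (intro mult_pos_pos add_pos_nonneg) auto
  define \<eta> where "\<eta> = min 1 (e / (2 * sqrt C))"
  have \<eta>: "\<eta> > 0" "\<eta> \<le> 1" using e C by (auto simp: \<eta>_def)
  have "C * \<eta>\<^sup>2 < e\<^sup>2"
  proof -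
    have "\<eta> \<le> e / (2 * sqrt C)" by (simp add: \<eta>_def)
    then have "\<eta>\<^sup>2 \<le> (e / (2 * sqrt C))\<^sup>2" using \<eta> by (intro power_mono) auto
    also have "\<dots> = e\<^sup>2 / (4 * C)" using C by (simp add: power_divide power_mult_distrib)
    finally have "C * \<eta>\<^sup>2 \<le> C * (e\<^sup>2 / (4 * C))" using C by (intro mult_left_mono) auto
    also have "\<dots> = e\<^sup>2 / 4" using C by simp
    also have "\<dots> < e\<^sup>2" using e by simp
    finally show ?thesis .
  qed note small = this
  show ?thesis
  proof (rule that[OF \<eta>(1)])
    fix \<delta> v v' x assume \<delta>: "\<bar>\<delta>\<bar> < \<eta>" and v: "ode2 {a..b} (\<lambda>x. V x + \<delta>) v v'"
      and init: "\<bar>v a - u a\<bar> < \<eta>" "\<bar>v' a - u' a\<bar> < \<eta>" and x: "x \<in> {a..b}"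
    have "(v x - u x)\<^sup>2 + (v' x - u' x)\<^sup>2 \<le>
      exp ((M + 1 + 2) * (b - a)) * ((v a - u a)\<^sup>2 + (v' a - u' a)\<^sup>2 + (\<bar>\<delta>\<bar> * U)\<^sup>2 * (b - a))"
    proof (rule gronwall2[OF ab x])
      fix z assume z: "z \<in> {a..b}"
      show "((\<lambda>x. v x - u x) has_real_derivative v' z - u' z) (at z within {a..b})"
        by (rule DERIV_diff[OF ode2D(1)[OF v z] ode2D(1)[OF u z]])
      show "((\<lambda>x. v' x - u' x) has_real_derivative (V z + \<delta>) * v z - V z * u z) (at z within {a..b})"
        by (rule DERIV_diff[OF ode2D(2)[OF v z] ode2D(2)[OF u z]])
      have "\<bar>(V z + \<delta>) * v z - V z * u z\<bar> = \<bar>(V z + \<delta>) * (v z - u z) + \<delta> * u z\<bar>"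
        by (simp add: algebra_simps)
      also have "\<dots> \<le> \<bar>V z + \<delta>\<bar> * \<bar>v z - u z\<bar> + \<bar>\<delta>\<bar> * \<bar>u z\<bar>"
        by (metis abs_mult abs_triangle_ineq)
      also have "\<dots> \<le> (M + 1) * \<bar>v z - u z\<bar> + \<bar>\<delta>\<bar> * U"
        using M(2)[OF z] U(2)[OF z] \<delta> \<eta> by (intro add_mono mult_right_mono mult_left_mono) auto
      finally show "\<bar>(V z + \<delta>) * v z - V z * u z\<bar> \<le> (M + 1) * \<bar>v z - u z\<bar> + \<bar>\<delta>\<bar> * U" .
    qed (use M U in auto)
    also have "\<dots> \<le> exp ((M + 1 + 2) * (b - a)) * (\<eta>\<^sup>2 + \<eta>\<^sup>2 + (\<eta> * U)\<^sup>2 * (b - a))"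
      using init \<delta> U ab \<eta> by (intro mult_left_mono add_mono mult_right_mono power_mono power2_le_iff_abs_le[THEN iffD2])
        (auto intro!: mult_right_mono)
    also have "\<dots> = C * \<eta>\<^sup>2" by (simp add: C_def algebra_simps power_mult_distrib)
    finally have le: "(v x - u x)\<^sup>2 + (v' x - u' x)\<^sup>2 < e\<^sup>2" using small by linarith
    have "(v x - u x)\<^sup>2 < e\<^sup>2" "(v' x - u' x)\<^sup>2 < e\<^sup>2"
      using le zero_le_power2[of "v x - u x"] zero_le_power2[of "v' x - u' x"] by linarith+
    then show "\<bar>v x - u x\<bar> < e \<and> \<bar>v' x - u' x\<bar> < e"
      using e power_less_imp_less_base[of "\<bar>v x - u x\<bar>" 2 e]
        power_less_imp_less_base[of "\<bar>v' x - u' x\<bar>" 2 e] by simp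
  qed
qed

text \<open>\<open>u * u'\<close> has derivative \<open>u'\<^sup>2 + V * u\<^sup>2 \<ge> 0\<close>,
  so it stays nonnegative and \<open>u\<^sup>2\<close> does not decrease; hence \<open>u\<close>
  cannot reach zero.\<close>

lemma ode2_growth:
  assumes T: "is_interval T" and u: "ode2 T V u u'" and V: "\<And>x. x \<in> T \<Longrightarrow> a \<le> x \<Longrightarrow> V x \<ge> 0"
    and a: "a \<in> T" "u a > 0" "u' a \<ge> 0" and x: "x \<in> T" "a \<le> x"
  shows "u x \<ge> u a" "u' x \<ge> 0"
proof -
  have prod: "u y * u' y \<ge> 0" if y: "y \<in> T" "a \<le> y" for y
  proof -
    have "u a * u' a \<le> u y * u' y"
    proof (rule nonneg_deriv_mono[where f = "\<lambda>x. u x * u' x", OF T a(1) y])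
      fix z assume z: "z \<in> T"
      show "((\<lambda>x. u x * u' x) has_real_derivative (u' z)\<^sup>2 + V z * (u z)\<^sup>2) (at z within T)"
        by (rule derivative_eq_intros ode2D[OF u z] refl)+ (simp add: power2_eq_square algebra_simps)
      assume "a < z"
      then show "0 \<le> (u' z)\<^sup>2 + V z * (u z)\<^sup>2" using V[OF z] by simp
    qed
    moreover have "0 \<le> u a * u' a" using a by simp
    ultimately show ?thesis by linarith
  qed
  have sq: "(u a)\<^sup>2 \<le> (u y)\<^sup>2" if y: "y \<in> T" "a \<le> y" for y
  proof (rule nonneg_deriv_mono[where f = "\<lambda>x. (u x)\<^sup>2", OF T a(1) y])
    fix z assume z: "z \<in> T"
    show "((\<lambda>x. (u x)\<^sup>2) has_real_derivative 2 * (u z * u' z)) (at z within T)"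
      by (rule derivative_eq_intros ode2D[OF u z] refl)+ simp
    assume "a < z" then show "0 \<le> 2 * (u z * u' z)" using prod[OF z] by simp
  qed
  have pos: "u x > 0"
  proof (rule ccontr)
    assume "\<not> u x > 0"
    have sub: "{a..x} \<subseteq> T" using mem_is_interval_1_I[OF T a(1) x(1)] by auto
    have "continuous_on {a..x} u" using ode2_continuous(1)[OF u] sub by (rule continuous_on_subset)
    then obtain y where y: "a \<le> y" "y \<le> x" "u y = 0"
      using IVT2'[of u x 0 a] \<open>\<not> u x > 0\<close> a x by auto
    then show False using sq[of y] sub a by auto
  qed
  show "u x \<ge> u a" using sq[OF x] pos a by (simp add: power2_le_iff_abs_le)
  show "u' x \<ge> 0" using prod[OF x] pos by (simp add: zero_le_mult_iff)
qed

text \<open>These are the increments of the Picard iteration for the pair \<open>(u, u')\<close>,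
  not the iterates: the initial data enter only at stage \<open>0\<close>, and the solution is the
  sum over \<open>n\<close>.\<close>

fun picard :: "(real \<Rightarrow> real) \<Rightarrow> real \<Rightarrow> real \<Rightarrow> real \<Rightarrow> nat \<Rightarrow> real \<Rightarrow> real \<times> real" where
  "picard V a A B 0 x = (A, B)"
| "picard V a A B (Suc n) x =
     (integral {a..x} (\<lambda>t. snd (picard V a A B n t)), integral {a..x} (\<lambda>t. V t * fst (picard V a A B n t)))"

lemma picard_continuous:
  assumes V: "continuous_on {a..b} V"
  shows "continuous_on {a..b} (\<lambda>x. fst (picard V a A B n x)) \<and>
    continuous_on {a..b} (\<lambda>x. snd (picard V a A B n x))"
proof (induction n)
  case (Suc n)
  have i: "continuous_on {a..b} (\<lambda>x. integral {a..x} f)" if "continuous_on {a..b} f" for f :: "real \<Rightarrow> real"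
    by (rule DERIV_continuous_on[OF integral_has_real_derivative[OF that]])
  show ?case using Suc V by (auto intro!: i continuous_intros)
qed simp

lemma picard_bound:
  assumes V: "continuous_on {a..b} V" and M: "M \<ge> 1" "\<And>x. x \<in> {a..b} \<Longrightarrow> \<bar>V x\<bar> \<le> M"
    and x: "x \<in> {a..b}" and C: "\<bar>A\<bar> \<le> C" "\<bar>B\<bar> \<le> C"
  shows "\<bar>fst (picard V a A B n x)\<bar> \<le> C * ((M * (x - a)) ^ n / fact n) \<and>
    \<bar>snd (picard V a A B n x)\<bar> \<le> C * ((M * (x - a)) ^ n / fact n)"
  using x
proof (induction n arbitrary: x)
  case 0
  then show ?case using C by simp
next
  case (Suc n)
  let ?g = "\<lambda>t. C * M * ((M * (t - a)) ^ n / fact n)"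
  have C0: "C \<ge> 0" using C by linarith
  have sub: "{a..x} \<subseteq> {a..b}" using Suc.prems by auto
  have gi: "(?g has_integral C * ((M * (x - a)) ^ Suc n / fact (Suc n)) - C * ((M * (a - a)) ^ Suc n / fact (Suc n))) {a..x}"
  proof (rule fundamental_theorem_of_calculus)
    show "a \<le> x" using Suc.prems by simp
    fix t assume "t \<in> {a..x}"
    have "((\<lambda>t. C * ((M * (t - a)) ^ Suc n / fact (Suc n))) has_real_derivative
       C * (real (Suc n) * (M * (t - a)) ^ n * M / fact (Suc n))) (at t within {a..x})"
      by (rule derivative_eq_intros refl | simp)+
    moreover have "C * (real (Suc n) * (M * (t - a)) ^ n * M / fact (Suc n)) = ?g t"
      by (simp add: field_simps del: of_nat_Suc)
    ultimately show "((\<lambda>t. C * ((M * (t - a)) ^ Suc n / fact (Suc n))) has_vector_derivative ?g t) (at t within {a..x})"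
      by (simp only: has_real_derivative_iff_has_vector_derivative)
  qed
  have bound: "\<bar>integral {a..x} f\<bar> \<le> C * ((M * (x - a)) ^ Suc n / fact (Suc n))"
    if "continuous_on {a..x} f" "\<And>t. t \<in> {a..x} \<Longrightarrow> \<bar>f t\<bar> \<le> ?g t" for f
  proof -
    have "norm (integral {a..x} f) \<le> integral {a..x} ?g"
      using that by (intro integral_norm_bound_integral integrable_continuous_interval
        has_integral_integrable[OF gi]) auto
    then show ?thesis using integral_unique[OF gi] by simp
  qed
  note IH = Suc.IH[OF subsetD[OF sub]]
  note cont = picard_continuous[OF V, of A B n, THEN conjunct1] picard_continuous[OF V, of A B n, THEN conjunct2]
  have nn: "0 \<le> C * ((M * (t - a)) ^ n / fact n)" if "t \<in> {a..x}" for t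
    using that C0 M by (intro mult_nonneg_nonneg divide_nonneg_nonneg zero_le_power) auto
  show ?case
  proof
    show "\<bar>fst (picard V a A B (Suc n) x)\<bar> \<le> C * ((M * (x - a)) ^ Suc n / fact (Suc n))"
      unfolding picard.simps fst_conv
    proof (rule bound)
      show "continuous_on {a..x} (\<lambda>t. snd (picard V a A B n t))" using cont(2) sub by (rule continuous_on_subset)
      fix t assume t: "t \<in> {a..x}"
      have "\<bar>snd (picard V a A B n t)\<bar> \<le> 1 * (C * ((M * (t - a)) ^ n / fact n))" using IH[OF t] by simp
      also have "\<dots> \<le> M * (C * ((M * (t - a)) ^ n / fact n))" using M(1) nn[OF t] by (rule mult_right_mono)
      finally show "\<bar>snd (picard V a A B n t)\<bar> \<le> ?g t" by (simp add: mult_ac)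
    qed
    show "\<bar>snd (picard V a A B (Suc n) x)\<bar> \<le> C * ((M * (x - a)) ^ Suc n / fact (Suc n))"
      unfolding picard.simps snd_conv
    proof (rule bound)
      show "continuous_on {a..x} (\<lambda>t. V t * fst (picard V a A B n t))"
        by (intro continuous_on_mult continuous_on_subset[OF cont(1) sub] continuous_on_subset[OF V sub])
      fix t assume t: "t \<in> {a..x}"
      have "\<bar>V t * fst (picard V a A B n t)\<bar> \<le> M * (C * ((M * (t - a)) ^ n / fact n))"
        unfolding abs_mult using IH[OF t] M(2)[OF subsetD[OF sub t]] M(1) by (intro mult_mono) auto
      then show "\<bar>V t * fst (picard V a A B n t)\<bar> \<le> ?g t" by (simp add: mult_ac)
    qed
  qed
qed

lemma picard_deriv:
  assumes V: "continuous_on {a..b} V" and x: "x \<in> {a..b}"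
  shows "((\<lambda>x. fst (picard V a A B (Suc n) x)) has_real_derivative snd (picard V a A B n x)) (at x within {a..b})"
    "((\<lambda>x. snd (picard V a A B (Suc n) x)) has_real_derivative V x * fst (picard V a A B n x)) (at x within {a..b})"
  using picard_continuous[OF V, of A B n] V x
  by (auto intro!: integral_has_real_derivative continuous_intros)

lemma ode2_exists_Icc:
  assumes V: "continuous_on {a..b} V" and ab: "a \<le> b"
  shows "ode2 {a..b} V (\<lambda>x. \<Sum>n. fst (picard V a A B n x)) (\<lambda>x. \<Sum>n. snd (picard V a A B n x))"
proof -
  obtain M0 where M0: "M0 \<ge> 0" "\<And>x. x \<in> {a..b} \<Longrightarrow> \<bar>V x\<bar> \<le> M0" using continuous_on_Icc_bounded[OF V] by metis
  define M where "M = M0 + 1"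
  have M: "M \<ge> 1" "\<And>x. x \<in> {a..b} \<Longrightarrow> \<bar>V x\<bar> \<le> M" using M0 by (force simp: M_def)+
  define C where "C = max \<bar>A\<bar> \<bar>B\<bar>"
  have C: "\<bar>A\<bar> \<le> C" "\<bar>B\<bar> \<le> C" "0 \<le> C" by (auto simp: C_def)
  let ?P = "\<lambda>n x. fst (picard V a A B n x)" and ?Q = "\<lambda>n x. snd (picard V a A B n x)"
  define E where "E = (\<lambda>n. C * ((M * (b - a)) ^ n / fact n))"
  have Es: "summable E" unfolding E_def
    using summable_exp_generic[of "M * (b - a)"] by (intro summable_mult) (simp add: divide_inverse mult.commute)
  have bd: "\<bar>?P n x\<bar> \<le> E n" "\<bar>?Q n x\<bar> \<le> E n" if x: "x \<in> {a..b}" for n x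
  proof -
    have "C * ((M * (x - a)) ^ n / fact n) \<le> E n" unfolding E_def
      using x M C by (intro mult_left_mono divide_right_mono power_mono) auto
    then show "\<bar>?P n x\<bar> \<le> E n" "\<bar>?Q n x\<bar> \<le> E n"
      using picard_bound[OF V M x C(1,2), of n] by linarith+
  qed
  have sP: "summable (\<lambda>n. ?P n x)" and sQ: "summable (\<lambda>n. ?Q n x)" if "x \<in> {a..b}" for x
    using bd[OF that] by (auto intro!: summable_comparison_test'[OF Es, of 0])
  \<comment> \<open>Both components have this form: the derivative of term \<open>n + 1\<close> is
    built from term \<open>n\<close>. The constant term \<open>0\<close> is therefore split off
    before the series is differentiated term by term.\<close>
  have main: "(((\<lambda>x. \<Sum>n. f n x) has_real_derivative (\<Sum>n. g n x)) (at x within {a..b}))"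
    if x: "x \<in> {a..b}" and s: "\<And>x. x \<in> {a..b} \<Longrightarrow> summable (\<lambda>n. f n x)"
      and f0: "\<And>x. f 0 x = c"
      and D: "\<And>n x. x \<in> {a..b} \<Longrightarrow> (f (Suc n) has_real_derivative g n x) (at x within {a..b})"
      and K: "\<And>n x. x \<in> {a..b} \<Longrightarrow> \<bar>g n x\<bar> \<le> K * E n" for f g :: "nat \<Rightarrow> real \<Rightarrow> real" and x c K
  proof -
    have KE: "summable (\<lambda>n. K * E n)" using Es by (rule summable_mult)
    have ul: "uniform_limit {a..b} (\<lambda>n x. \<Sum>i<n. g i x) (\<lambda>x. \<Sum>i. g i x) sequentially"
      by (rule Weierstrass_m_test[OF _ KE]) (use K in auto)
    obtain h where h: "\<And>y. y \<in> {a..b} \<Longrightarrow> (\<lambda>n. f (Suc n) y) sums h y \<and>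
        (h has_field_derivative (\<Sum>i. g i y)) (at y within {a..b})"
    proof -
      have ss: "summable (\<lambda>n. f (Suc n) a)"
        by (subst summable_Suc_iff[of "\<lambda>n. f n a"], rule s) (use ab in simp)
      have "\<exists>h. \<forall>y\<in>{a..b}. (\<lambda>n. f (Suc n) y) sums h y \<and> (h has_field_derivative (\<Sum>i. g i y)) (at y within {a..b})"
        by (rule has_field_derivative_series[OF _ D ul _ ss]) (use ab in auto)
      then show ?thesis using that by blast
    qed
    have eq: "(\<Sum>n. f n y) = c + h y" if "y \<in> {a..b}" for y
      using suminf_split_head[OF s[OF that]] h[OF that] f0 by (simp add: sums_iff)
    have "((\<lambda>y. c + h y) has_real_derivative (\<Sum>i. g i x)) (at x within {a..b})"
      using h[OF x] by (auto intro!: derivative_eq_intros)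
    then show ?thesis
      by (rule has_field_derivative_transform_within[OF _ zero_less_one x]) (simp add: eq)
  qed
  show ?thesis
    unfolding ode2_def
  proof (intro ballI conjI)
    fix x assume x: "x \<in> {a..b}"
    show "((\<lambda>x. \<Sum>n. ?P n x) has_real_derivative (\<Sum>n. ?Q n x)) (at x within {a..b})"
      by (rule main[OF x sP, where c=A and K=1]) (use picard_deriv(1)[OF V] bd in auto)
    have "((\<lambda>x. \<Sum>n. ?Q n x) has_real_derivative (\<Sum>n. V x * ?P n x)) (at x within {a..b})"
    proof (rule main[OF x sQ, where c=B and K=M])
      show "\<bar>V x * ?P n x\<bar> \<le> M * E n" if "x \<in> {a..b}" for n x
        unfolding abs_mult using M(1) M(2)[OF that] bd(1)[OF that] by (intro mult_mono) auto
    qed (use picard_deriv(2)[OF V] in auto)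
    then show "((\<lambda>x. \<Sum>n. ?Q n x) has_real_derivative V x * (\<Sum>n. ?P n x)) (at x within {a..b})"
      using suminf_mult[OF sP[OF x], of "V x"] by simp
  qed
qed

lemma at_within_Ici_eq:
  fixes a x b :: real assumes "x < b"
  shows "at x within {a..} = at x within {a..b}"
  by (rule at_within_nhd[of _ "{..<b}"]) (use assms in auto)

lemma ode2_atLeastI:
  assumes "\<And>b. b > a \<Longrightarrow> ode2 {a..b} V u u'"
  shows "ode2 {a..} V u u'"
  unfolding ode2_def
proof
  fix x assume x: "x \<in> {a..}"
  have "x < x + 1" by simp
  from at_within_Ici_eq[OF this, of a] ode2D[OF assms[of "x+1"], of x] x
  show "(u has_real_derivative u' x) (at x within {a..}) \<and> (u' has_real_derivative V x * u x) (at x within {a..})"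
    by auto
qed

lemma ode2_exists:
  assumes V: "continuous_on {a..} V"
  obtains u u' where "ode2 {a..} V u u'" "u a = A" "u' a = B"
proof
  \<comment> \<open>The series does not mention a right endpoint, so the same two functions solve
    the equation on every \<open>{a..b}\<close>. At \<open>a\<close> only the term with
    \<open>n = 0\<close> survives.\<close>
  let ?u = "\<lambda>x. \<Sum>n. fst (picard V a A B n x)" and ?u' = "\<lambda>x. \<Sum>n. snd (picard V a A B n x)"
  show "ode2 {a..} V ?u ?u'"
    by (intro ode2_atLeastI ode2_exists_Icc continuous_on_subset[OF V]) auto
  have z: "picard V a A B n a = (0, 0)" if "n > 0" for n using that by (cases n) auto
  have "(\<Sum>n. fst (picard V a A B n a)) = (\<Sum>n\<in>{0}. fst (picard V a A B n a))"
    by (rule suminf_finite) (use z in auto)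
  then show "?u a = A" by simp
  have "(\<Sum>n. snd (picard V a A B n a)) = (\<Sum>n\<in>{0}. snd (picard V a A B n a))"
    by (rule suminf_finite) (use z in auto)
  then show "?u' a = B" by simp
qed

section \<open>The profile\<close>

text \<open>Over an interval of length \<open>r\<close> the integral would be at least
  \<open>\<kappa> * r\<close>. This is the only way in which integrability at infinity is exploited
  below.\<close>

lemma integrable_half_line_lower_bound:
  fixes h :: "real \<Rightarrow> real"
  assumes int: "integrable (lebesgue_on {L<..}) h" and nn: "\<And>x. x > L \<Longrightarrow> 0 \<le> h x"
    and X: "\<And>x. x > L \<Longrightarrow> x \<ge> X \<Longrightarrow> \<kappa> \<le> h x"
  shows "\<kappa> \<le> 0"
proof (rule ccontr)
  assume "\<not> \<kappa> \<le> 0"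
  then have \<kappa>: "\<kappa> > 0" by simp
  define I where "I = (\<integral>x. h x \<partial>lebesgue_on {L<..})"
  have L: "{L<..} \<in> sets lebesgue" by simp
  have le: "\<kappa> * r \<le> I" if r: "r > 0" for r
  proof -
    define Y where "Y = max X L + 1"
    let ?S = "{Y..Y+r}"
    have S: "?S \<subseteq> {L<..}" by (auto simp: Y_def)
    have iS: "integrable lebesgue (\<lambda>x. indicator ?S x * \<kappa>)"
      using lmeasurable_cbox[of Y "Y + r"] by (simp add: lmeasurable_iff_integrable)
    have iI: "integrable lebesgue (\<lambda>x. indicator {L<..} x * h x)"
      using int L by (simp add: integrable_restrict_space)
    have "(\<integral>x. indicator ?S x * \<kappa> \<partial>lebesgue) \<le> (\<integral>x. indicator {L<..} x * h x \<partial>lebesgue)"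
      by (rule integral_mono[OF iS iI]) (use S X nn in \<open>auto simp: indicator_def Y_def\<close>)
    also have "\<dots> = I" using L by (simp add: I_def integral_restrict_space)
    finally show ?thesis using r by (simp add: mult.commute)
  qed
  have "\<kappa> * ((\<bar>I\<bar> + 1) / \<kappa>) \<le> I" using \<kappa> by (intro le) auto
  then show False using \<kappa> by simp
qed

lemma deriv_nonpos_if_antimono:
  fixes f :: "real \<Rightarrow> real"
  assumes "(f has_real_derivative D) (at x within S)" "\<And>y. y \<in> S \<Longrightarrow> x \<le> y \<Longrightarrow> f y \<le> f x"
    and "\<And>d. d > 0 \<Longrightarrow> \<exists>h. 0 < h \<and> h < d \<and> x + h \<in> S"
  shows "D \<le> 0"
proof (rule ccontr)
  assume "\<not> D \<le> 0"
  then obtain d where d: "d > 0" "\<And>h. 0 < h \<Longrightarrow> x + h \<in> S \<Longrightarrow> h < d \<Longrightarrow> f x < f (x + h)"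
    using has_real_derivative_pos_inc_right[OF assms(1)] by auto
  obtain h where h: "0 < h" "h < d" "x + h \<in> S" using assms(3)[OF d(1)] by blast
  show False using d(2)[OF h(1,3,2)] assms(2)[OF h(3)] h by simp
qed

lemma energy_deriv:
  assumes "(f has_real_derivative f' x) (at x within T)"
    "(f' has_real_derivative (c - ln ((f x)\<^sup>2)) * f x) (at x within T)" "f x > 0"
  shows "((\<lambda>x. (f' x)\<^sup>2 + (f x)\<^sup>2 * (ln ((f x)\<^sup>2) - c - 1)) has_real_derivative 0) (at x within T)"
proof -
  have "((\<lambda>x. ln ((f x)\<^sup>2)) has_real_derivative 2 * f' x / f x) (at x within T)"
    by (rule derivative_eq_intros assms(1) refl | use assms(3) in \<open>simp add: power2_eq_square field_simps\<close>)+
  note ln = this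
  show ?thesis
    by (rule derivative_eq_intros assms(1,2) ln refl)+
      (use assms(3) in \<open>simp add: power2_eq_square field_simps\<close>)
qed

text \<open>\<open>s * (- ln s) \<le> 1\<close> follows from
  \<open>ln (1 / s) \<le> 1 / s - 1\<close>. The bound shows that the potential part of the energy
  vanishes as the solution tends to zero.\<close>

lemma log_nonlinearity_small:
  fixes s :: real
  assumes "0 < s" "s \<le> 1"
  shows "\<bar>s\<^sup>2 * (ln (s\<^sup>2) - c - 1)\<bar> \<le> (2 + \<bar>c + 1\<bar>) * s"
proof -
  have "- ln s \<le> 1 / s - 1" using ln_le_minus_one[of "1/s"] assms by (simp add: ln_div)
  then have "s * (- ln s) \<le> s * (1 / s - 1)" using assms by (intro mult_left_mono) auto
  also have "\<dots> \<le> 1" using assms by (simp add: field_simps)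
  finally have 1: "s * (- ln s) \<le> 1" .
  have 0: "0 \<le> s * (- ln s)" using assms by (simp add: mult_nonneg_nonpos)
  have "s\<^sup>2 * (ln (s\<^sup>2) - c - 1) = - (2 * (s * (- ln s)) * s) - (c + 1) * s * s"
    using assms by (simp add: power2_eq_square ln_mult algebra_simps)
  also have "\<bar>\<dots>\<bar> \<le> 2 * (s * (- ln s)) * s + \<bar>c + 1\<bar> * s * s"
  proof -
    have "0 \<le> 2 * (s * (- ln s)) * s" using 0 assms by (intro mult_nonneg_nonneg) auto
    moreover have "\<bar>(c + 1) * s * s\<bar> = \<bar>c + 1\<bar> * s * s" using assms by (simp add: abs_mult)
    ultimately show ?thesis
      using abs_triangle_ineq4[of "- (2 * (s * (- ln s)) * s)" "(c + 1) * s * s"] by linarith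
  qed
  also have "\<dots> \<le> 2 * 1 * s + \<bar>c + 1\<bar> * s * 1"
    using 0 1 assms by (intro add_mono mult_mono) auto
  finally show ?thesis by (simp add: algebra_simps)
qed

text \<open>Monotone and square integrable, \<open>\<psi>\<close> tends to zero, which forces the
  conserved energy to be zero. The equation becomes first order, and its solutions are
  Gaussians.\<close>

lemma log_nls_tail:
  fixes \<psi> \<psi>' :: "real \<Rightarrow> real"
  assumes pos: "\<And>x. x \<ge> L \<Longrightarrow> \<psi> x > 0" and anti: "strict_antimono_on {L..} \<psi>"
    and D: "\<And>x. x \<in> {L..} \<Longrightarrow> (\<psi> has_real_derivative \<psi>' x) (at x within {L..})"
    and D': "\<And>x. x \<in> {L..} \<Longrightarrow> (\<psi>' has_real_derivative (c - ln ((\<psi> x)\<^sup>2)) * \<psi> x) (at x within {L..})"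
    and int: "integrable (lebesgue_on {L<..}) (\<lambda>x. (\<psi> x)\<^sup>2)"
  obtains a where "a \<ge> 0" "\<And>x. x \<ge> L \<Longrightarrow> \<psi>' x = - (x - L + a) * \<psi> x"
    "\<And>x. x \<ge> L \<Longrightarrow> ln ((\<psi> x)\<^sup>2) = c + 1 - (x - L + a)\<^sup>2"
proof -
  have mono: "\<psi> y \<le> \<psi> x" if "L \<le> x" "x \<le> y" for x y
    using anti that unfolding monotone_on_def by (cases "x = y") (auto simp: less_imp_le)
  have neg: "\<psi>' x \<le> 0" if "x \<ge> L" for x
  proof (rule deriv_nonpos_if_antimono[OF D])
    show "\<exists>h. 0 < h \<and> h < d \<and> x + h \<in> {L..}" if "d > 0" for d
      using that \<open>x \<ge> L\<close> by (intro exI[of _ "d/2"]) auto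
  qed (use that mono in auto)
  define En where "En = (\<lambda>x. (\<psi>' x)\<^sup>2 + (\<psi> x)\<^sup>2 * (ln ((\<psi> x)\<^sup>2) - c - 1))"
  have Econst: "En x = En L" if "x \<ge> L" for x
  proof -
    have "(En has_real_derivative 0) (at z within {L..})" if "z \<in> {L..}" for z
      unfolding En_def using D[OF that] D'[OF that] pos[of z] that by (intro energy_deriv) auto
    then have "\<exists>k. \<forall>z\<in>{L..}. En z = k"
      by (intro has_field_derivative_zero_constant convex_real_interval) auto
    then show ?thesis using that by auto
  qed
  define e where "e = En L"
  define K where "K = 2 + \<bar>c + 1\<bar>"
  have K: "K \<ge> 2" by (simp add: K_def)
  have small: "\<exists>X\<ge>L. \<forall>x\<ge>X. \<psi> x < \<delta>" if \<delta>: "\<delta> > 0" for \<delta>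
  proof (rule ccontr)
    assume "\<not> ?thesis"
    then have ex: "\<exists>y\<ge>x. \<psi> y \<ge> \<delta>" if "x \<ge> L" for x
      using that by (auto simp: not_less)
    have "\<psi> x \<ge> \<delta>" if "x \<ge> L" for x
      using ex[OF that] mono[OF that] by fastforce
    then have "\<delta>\<^sup>2 \<le> (\<psi> x)\<^sup>2" if "x \<ge> L" for x using that \<delta> by (intro power_mono) auto
    then have "\<delta>\<^sup>2 \<le> 0" by (intro integrable_half_line_lower_bound[OF int, of L]) auto
    then show False using \<delta> by simp
  qed
  have tail: "\<exists>X\<ge>L. \<forall>x\<ge>X. \<bar>(\<psi> x)\<^sup>2 * (ln ((\<psi> x)\<^sup>2) - c - 1)\<bar> < \<delta>" if \<delta>: "\<delta> > 0" for \<delta>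
  proof -
    obtain X where X: "X \<ge> L" "\<And>x. x \<ge> X \<Longrightarrow> \<psi> x < min 1 (\<delta> / K)"
      using small[of "min 1 (\<delta> / K)"] \<delta> K by auto
    have "\<bar>(\<psi> x)\<^sup>2 * (ln ((\<psi> x)\<^sup>2) - c - 1)\<bar> < \<delta>" if "x \<ge> X" for x
    proof -
      have "\<bar>(\<psi> x)\<^sup>2 * (ln ((\<psi> x)\<^sup>2) - c - 1)\<bar> \<le> K * \<psi> x"
        unfolding K_def using X(2)[OF that] X(1) that pos[of x] by (intro log_nonlinearity_small) auto
      also have "\<dots> < K * (\<delta> / K)" using X(2)[OF that] K by (intro mult_strict_left_mono) auto
      finally show ?thesis using K by simp
    qed
    then show ?thesis using X(1) by blast
  qed
  \<comment> \<open>The square of \<open>\<psi>'\<close> tends to \<open>e\<close>, so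
    \<open>e\<close> is not negative. If it were positive, the slope would stay below
    \<open>- sqrt (e / 2)\<close> and \<open>\<psi>\<close> would reach zero at \<open>Y\<close> at
    the latest.\<close>
  have e0: "e = 0"
  proof (rule ccontr)
    assume "e \<noteq> 0"
    then obtain X where X: "X \<ge> L" "\<And>x. x \<ge> X \<Longrightarrow> \<bar>(\<psi> x)\<^sup>2 * (ln ((\<psi> x)\<^sup>2) - c - 1)\<bar> < \<bar>e\<bar> / 2"
      using tail[of "\<bar>e\<bar> / 2"] by auto
    have eq: "(\<psi>' x)\<^sup>2 = e - (\<psi> x)\<^sup>2 * (ln ((\<psi> x)\<^sup>2) - c - 1)" if "x \<ge> X" for x
      using Econst[of x] that X(1) by (simp add: En_def e_def)
    have epos: "e > 0"
      using eq[of X] X(2)[of X] \<open>e \<noteq> 0\<close> zero_le_power2[of "\<psi>' X"] by (auto simp: abs_if split: if_splits)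
    define s where "s = sqrt (e / 2)"
    have s: "s > 0" using epos by (simp add: s_def)
    have le: "\<psi>' x \<le> - s" if "x \<ge> X" for x
    proof -
      have "e - \<bar>e\<bar> / 2 \<le> (\<psi>' x)\<^sup>2"
        unfolding eq[OF that] using X(2)[OF that] by (intro diff_left_mono) (rule abs_le_D1, simp)
      then have "s\<^sup>2 \<le> \<bar>\<psi>' x\<bar>\<^sup>2" using epos by (simp add: s_def)
      then have "s \<le> \<bar>\<psi>' x\<bar>" by (rule power2_le_imp_le) simp
      then show ?thesis using neg[of x] that X(1) by simp
    qed
    define Y where "Y = X + \<psi> X / s"
    have Y: "Y \<ge> X" using s pos[of X] X(1) by (simp add: Y_def)
    have "- \<psi> X - s * X \<le> - \<psi> Y - s * Y"
    proof (rule nonneg_deriv_mono[where f = "\<lambda>x. - \<psi> x - s * x" and T = "{L..}"])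
      fix z assume z: "z \<in> {L..}"
      show "((\<lambda>x. - \<psi> x - s * x) has_real_derivative - \<psi>' z - s) (at z within {L..})"
        by (rule derivative_eq_intros D[OF z] refl)+ simp
      assume "X < z" then show "0 \<le> - \<psi>' z - s" using le[of z] by simp
    qed (use Y X(1) in \<open>auto simp: is_interval_ci\<close>)
    then have "\<psi> Y \<le> \<psi> X - s * (Y - X)" by (simp add: algebra_simps)
    also have "\<dots> = 0" using s by (simp add: Y_def)
    finally show False using pos[of Y] Y X(1) by simp
  qed
  \<comment> \<open>At zero energy the logarithmic derivative satisfies a Riccati equation that
    collapses to \<open>P' = -1\<close>.\<close>
  define P where "P = (\<lambda>x. \<psi>' x / \<psi> x)"
  have P2: "(P x)\<^sup>2 = c + 1 - ln ((\<psi> x)\<^sup>2)" if "x \<ge> L" for x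
    using Econst[OF that] e0 pos[OF that] by (simp add: En_def e_def P_def power_divide field_simps)
  have PD: "((\<lambda>x. P x + x) has_real_derivative 0) (at x within {L..})" if x: "x \<in> {L..}" for x
  proof -
    have p: "\<psi> x > 0" using pos x by simp
    have "((\<lambda>x. P x + x) has_real_derivative
       ((c - ln ((\<psi> x)\<^sup>2)) * \<psi> x * \<psi> x - \<psi>' x * \<psi>' x) / (\<psi> x * \<psi> x) + 1) (at x within {L..})"
      unfolding P_def
      by (rule derivative_eq_intros D[OF x] D'[OF x] refl | use p in simp)+
    also have "((c - ln ((\<psi> x)\<^sup>2)) * \<psi> x * \<psi> x - \<psi>' x * \<psi>' x) / (\<psi> x * \<psi> x) + 1 = c + 1 - ln ((\<psi> x)\<^sup>2) - (P x)\<^sup>2"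
      using p by (simp add: P_def power2_eq_square field_simps)
    also have "\<dots> = 0" using P2[of x] x by simp
    finally show ?thesis .
  qed
  have "\<exists>k. \<forall>z\<in>{L..}. P z + z = k"
    using PD by (intro has_field_derivative_zero_constant convex_real_interval) auto
  then have PL: "P x = P L + L - x" if "x \<ge> L" for x using that by force
  show ?thesis
  proof (rule that[of "- P L"])
    show "- P L \<ge> 0" using neg[of L] pos[of L] by (simp add: P_def divide_nonpos_pos)
    fix x assume x: "x \<ge> L"
    show "\<psi>' x = - (x - L + - P L) * \<psi> x"
      using PL[OF x] pos[OF x] by (simp add: P_def field_simps)
    show "ln ((\<psi> x)\<^sup>2) = c + 1 - (x - L + - P L)\<^sup>2"
      using P2[OF x] PL[OF x] by (simp add: power2_commute algebra_simps)
  qed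
qed

lemma at_within_interior_Icc: "- L < x \<Longrightarrow> x < (L::real) \<Longrightarrow> at x within {-L..L} = at x"
  by (simp add: at_within_Icc_at)

text \<open>The derivative \<open>c - ln (s\<^sup>2) - 2\<close> is unbounded at \<open>0\<close>,
  hence the lower end \<open>m > 0\<close>. On the compact ring a positive profile stays in such an
  interval.\<close>

lemma log_nonlinearity_lipschitz:
  fixes m h :: real
  assumes "0 < m"
  obtains K where "\<And>s t. \<lbrakk>s \<in> {m..h}; t \<in> {m..h}\<rbrakk> \<Longrightarrow>
    \<bar>(c - ln (s\<^sup>2)) * s - (c - ln (t\<^sup>2)) * t\<bar> \<le> K * \<bar>s - t\<bar>"
proof -
  have "continuous_on {m..h} (\<lambda>s. c - ln (s\<^sup>2) - 2)"
    using assms by (intro continuous_intros) auto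
  then obtain K where "K \<ge> 0" and K: "\<And>s. s \<in> {m..h} \<Longrightarrow> \<bar>c - ln (s\<^sup>2) - 2\<bar> \<le> K"
    by (rule continuous_on_Icc_bounded) (rule that; simp)
  have D: "((\<lambda>s. (c - ln (s\<^sup>2)) * s) has_real_derivative c - ln (s\<^sup>2) - 2) (at s within {m..h})"
    if "s \<in> {m..h}" for s
    by (rule derivative_eq_intros refl | use that assms in \<open>simp add: power2_eq_square\<close>)+
  have "norm ((c - ln (s\<^sup>2)) * s - (c - ln (t\<^sup>2)) * t) \<le> K * norm (s - t)"
    if "s \<in> {m..h}" "t \<in> {m..h}" for s t
    by (rule field_differentiable_bound[OF _ D]) (use K that in auto)
  then show ?thesis using that by auto
qed

text \<open>The ring part of a single-lobe state, with the half-line eliminated: the Gaussian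
  survives only through \<open>a\<close>. \<open>vertex\<close> is the Kirchhoff condition for an
  even profile with \<open>\<psi>' L = - a * \<psi> L\<close>, and \<open>vertex_value\<close> is
  the value of the Gaussian at \<open>L\<close>.\<close>

locale log_lobe =
  fixes L c a :: real and \<phi> \<phi>' :: "real \<Rightarrow> real"
  assumes L_pos: "0 < L" and a_pos: "0 < a"
    and pos: "\<And>x. x \<in> {-L..L} \<Longrightarrow> \<phi> x > 0"
    and D: "\<And>x. x \<in> {-L..L} \<Longrightarrow> (\<phi> has_real_derivative \<phi>' x) (at x within {-L..L})"
    and D': "\<And>x. x \<in> {-L..L} \<Longrightarrow>
      (\<phi>' has_real_derivative (c - ln ((\<phi> x)\<^sup>2)) * \<phi> x) (at x within {-L..L})"
    and even: "\<And>x. x \<in> {-L..L} \<Longrightarrow> \<phi> (- x) = \<phi> x"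
    and slope_0: "\<phi>' 0 = 0" and slope_neg: "\<And>x. 0 < x \<Longrightarrow> x \<le> L \<Longrightarrow> \<phi>' x < 0"
    and vertex: "2 * \<phi>' L = - a * \<phi> L" and vertex_value: "ln ((\<phi> L)\<^sup>2) = c + 1 - a\<^sup>2"
begin

definition V :: "real \<Rightarrow> real" where "V x = c - 2 - ln ((\<phi> x)\<^sup>2)"

end

lemma linearization_deriv:
  assumes "(\<phi> has_real_derivative \<phi>' x) (at x within T)" "(\<phi> x :: real) > 0"
  shows "((\<lambda>x. (c - ln ((\<phi> x)\<^sup>2)) * \<phi> x) has_real_derivative (c - 2 - ln ((\<phi> x)\<^sup>2)) * \<phi>' x) (at x within T)"
  by (rule derivative_eq_intros assms(1) refl | use assms(2) in \<open>simp add: power2_eq_square field_simps\<close>)+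

text \<open>Evenness, strict monotonicity and \<open>a > 0\<close> are derived here: by uniqueness
  for the nonlinear equation, by uniqueness for the linearized equation solved by
  \<open>\<phi>'\<close>, and by the conserved energy.\<close>

lemma log_lobeI:
  fixes \<phi> \<phi>' :: "real \<Rightarrow> real"
  assumes L: "0 < L" and pos: "\<And>x. x \<in> {-L..L} \<Longrightarrow> \<phi> x > 0"
    and D: "\<And>x. x \<in> {-L..L} \<Longrightarrow> (\<phi> has_real_derivative \<phi>' x) (at x within {-L..L})"
    and D': "\<And>x. x \<in> {-L..L} \<Longrightarrow>
      (\<phi>' has_real_derivative (c - ln ((\<phi> x)\<^sup>2)) * \<phi> x) (at x within {-L..L})"
    and max: "\<And>x. x \<in> {-L..L} \<Longrightarrow> x \<noteq> 0 \<Longrightarrow> \<phi> x < \<phi> 0"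
    and anti: "antimono_on {0..L} \<phi>" and glue: "\<phi> L = \<phi> (- L)"
    and kirchhoff: "\<phi>' L - \<phi>' (- L) = - a * \<phi> L" and a: "a \<ge> 0"
    and vval: "ln ((\<phi> L)\<^sup>2) = c + 1 - a\<^sup>2"
  shows "log_lobe L c a \<phi> \<phi>'"
proof -
  have s0: "\<phi>' 0 = 0"
  proof (rule DERIV_local_max)
    show "(\<phi> has_real_derivative \<phi>' 0) (at 0)" using D[of 0] L by (simp add: at_within_interior_Icc)
    show "0 < L" by (rule L)
    show "\<forall>y. \<bar>0 - y\<bar> < L \<longrightarrow> \<phi> y \<le> \<phi> 0"
      using max by (metis abs_less_iff abs_minus_commute atLeastAtMost_iff diff_zero less_imp_le minus_less_iff order_refl)
  qed
  have refl: "((\<lambda>x. \<phi> (- x)) has_real_derivative - \<phi>' (- x)) (at x within {-L..L})"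
    "((\<lambda>x. \<phi>' (- x)) has_real_derivative - ((c - ln ((\<phi> (- x))\<^sup>2)) * \<phi> (- x))) (at x within {-L..L})"
    if "x \<in> {-L..L}" for x
    using that D[of "- x"] D'[of "- x"] by (auto intro!: has_real_derivative_reflect)
  have sub: "{0..L} \<subseteq> {-L..L}" using L by auto
  have c\<phi>: "continuous_on {-L..L} \<phi>" using D by (rule DERIV_continuous_on)
  obtain x0 where x0: "x0 \<in> {-L..L}" "\<And>y. y \<in> {-L..L} \<Longrightarrow> \<phi> x0 \<le> \<phi> y"
    using continuous_attains_inf[OF _ _ c\<phi>] L by auto
  obtain K where K: "\<And>s t. \<lbrakk>s \<in> {\<phi> x0..\<phi> 0}; t \<in> {\<phi> x0..\<phi> 0}\<rbrakk> \<Longrightarrow>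
    \<bar>(c - ln (s\<^sup>2)) * s - (c - ln (t\<^sup>2)) * t\<bar> \<le> K * \<bar>s - t\<bar>"
    by (rule log_nonlinearity_lipschitz[OF pos[OF x0(1)], of "\<phi> 0" c]) (rule that; simp)
  have rng: "\<phi> x \<in> {\<phi> x0..\<phi> 0}" if "x \<in> {-L..L}" for x
    using x0(2)[OF that] max[OF that] by (cases "x = 0") auto
  \<comment> \<open>\<open>\<phi>\<close> and its reflection solve the same equation with the same
    data at the critical point \<open>0\<close>, so their difference vanishes by Gronwall.\<close>
  have ev: "\<phi> x - \<phi> (- x) = 0 \<and> \<phi>' x + \<phi>' (- x) = 0" if x: "x \<in> {0..L}" for x
  proof (rule zero_if_gronwall2[where a = 0 and b = L and x = x and
        d = "\<lambda>x. \<phi> x - \<phi> (- x)" and d' = "\<lambda>x. \<phi>' x + \<phi>' (- x)" and d'' = "\<lambda>x. (c - ln ((\<phi> x)\<^sup>2)) * \<phi> x - (c - ln ((\<phi> (- x))\<^sup>2)) * \<phi> (- x)" and M = K])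
    fix z assume z: "z \<in> {0..L}"
    then have z': "z \<in> {-L..L}" "- z \<in> {-L..L}" by auto
    show "((\<lambda>x. \<phi> x - \<phi> (- x)) has_real_derivative \<phi>' z + \<phi>' (- z)) (at z within {0..L})"
      using DERIV_diff[OF D[OF z'(1)] refl(1)[OF z'(1)]] by (auto intro: DERIV_subset[OF _ sub])
    show "((\<lambda>x. \<phi>' x + \<phi>' (- x)) has_real_derivative
       (c - ln ((\<phi> z)\<^sup>2)) * \<phi> z - (c - ln ((\<phi> (- z))\<^sup>2)) * \<phi> (- z)) (at z within {0..L})"
      using DERIV_add[OF D'[OF z'(1)] refl(2)[OF z'(1)]] by (auto intro: DERIV_subset[OF _ sub])
    show "\<bar>(c - ln ((\<phi> z)\<^sup>2)) * \<phi> z - (c - ln ((\<phi> (- z))\<^sup>2)) * \<phi> (- z)\<bar> \<le> K * \<bar>\<phi> z - \<phi> (- z)\<bar>"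
      using z' by (intro K rng)
  qed (use x L s0 in auto)
  have even: "\<phi> (- x) = \<phi> x" if "x \<in> {-L..L}" for x
    using ev[of "\<bar>x\<bar>"] that by (cases "x \<ge> 0") auto
  have vtx: "2 * \<phi>' L = - a * \<phi> L" using ev[of L] kirchhoff L by simp
  \<comment> \<open>For \<open>a = 0\<close> the energy vanishes at \<open>L\<close>, hence at
    \<open>0\<close>, where the slope is zero too. That gives \<open>\<phi> 0 = \<phi> L\<close>,
    against strictness of the maximum.\<close>
  have apos: "a > 0"
  proof (rule ccontr)
    assume "\<not> a > 0"
    then have a0: "a = 0" using a by simp
    define En where "En = (\<lambda>x. (\<phi>' x)\<^sup>2 + (\<phi> x)\<^sup>2 * (ln ((\<phi> x)\<^sup>2) - c - 1))"
    have "(En has_real_derivative 0) (at z within {-L..L})" if "z \<in> {-L..L}" for z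
      unfolding En_def using D[OF that] D'[OF that] pos[OF that] by (rule energy_deriv)
    then have "\<exists>k. \<forall>z\<in>{-L..L}. En z = k"
      by (intro has_field_derivative_zero_constant) auto
    then have "En 0 = En L" using L by force
    moreover have "En L = 0" using vtx a0 vval by (simp add: En_def)
    ultimately have "(\<phi> 0)\<^sup>2 * (ln ((\<phi> 0)\<^sup>2) - c - 1) = 0" using s0 by (simp add: En_def)
    then have "ln ((\<phi> 0)\<^sup>2) = ln ((\<phi> L)\<^sup>2)" using pos[of 0] L vval a0 by simp
    then have "(\<phi> 0)\<^sup>2 = (\<phi> L)\<^sup>2" using pos[of 0] pos[of L] L by simp
    then show False using max[of L] pos[of L] L by (simp add: power2_eq_iff)
  qed
  have nonpos: "\<phi>' x \<le> 0" if x: "0 \<le> x" "x < L" for x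
  proof (rule deriv_nonpos_if_antimono)
    show "(\<phi> has_real_derivative \<phi>' x) (at x within {0..L})"
      using D[of x] x by (auto intro: DERIV_subset[OF _ sub])
    show "\<phi> y \<le> \<phi> x" if "y \<in> {0..L}" "x \<le> y" for y
      using anti that x unfolding monotone_on_def by auto
    show "\<exists>h. 0 < h \<and> h < d \<and> x + h \<in> {0..L}" if "d > 0" for d
      using that x by (intro exI[of _ "min d (L - x) / 2"]) (auto simp: min_def field_simps)
  qed
  have "0 < a * \<phi> L" using apos pos[of L] L by simp
  then have negL: "\<phi>' L < 0" using vtx by simp
  \<comment> \<open>An interior zero of \<open>\<phi>' \<le> 0\<close> is a maximum of
    \<open>\<phi>'\<close>, so \<open>\<phi>'\<close> and its derivative both vanish there. A double
    zero of a linear equation would make \<open>\<phi>'\<close> vanish at \<open>L\<close> as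
    well.\<close>
  have neg: "\<phi>' x < 0" if x: "0 < x" "x \<le> L" for x
  proof (rule ccontr)
    assume "\<not> \<phi>' x < 0"
    with x negL have xL: "x < L" by (cases "x = L") auto
    then have z: "\<phi>' x = 0" using nonpos[of x] x \<open>\<not> \<phi>' x < 0\<close> by simp
    have xi: "x \<in> {-L..L}" using x by auto
    have z': "(c - ln ((\<phi> x)\<^sup>2)) * \<phi> x = 0"
    proof (rule DERIV_local_max)
      show "(\<phi>' has_real_derivative (c - ln ((\<phi> x)\<^sup>2)) * \<phi> x) (at x)"
        using D'[OF xi] x xL by (simp add: at_within_interior_Icc)
      show "0 < min x (L - x)" using x xL by simp
      show "\<forall>y. \<bar>x - y\<bar> < min x (L - x) \<longrightarrow> \<phi>' y \<le> \<phi>' x" using nonpos z by (auto simp: abs_less_iff)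
    qed
    have ode: "ode2 {-L..L} (\<lambda>x. c - 2 - ln ((\<phi> x)\<^sup>2)) \<phi>' (\<lambda>x. (c - ln ((\<phi> x)\<^sup>2)) * \<phi> x)"
      unfolding ode2_def
    proof (intro ballI conjI)
      fix y assume y: "y \<in> {-L..L}"
      show "(\<phi>' has_real_derivative (c - ln ((\<phi> y)\<^sup>2)) * \<phi> y) (at y within {-L..L})" by (rule D'[OF y])
      show "((\<lambda>x. (c - ln ((\<phi> x)\<^sup>2)) * \<phi> x) has_real_derivative (c - 2 - ln ((\<phi> y)\<^sup>2)) * \<phi>' y) (at y within {-L..L})"
        by (rule linearization_deriv[where \<phi> = \<phi> and \<phi>' = \<phi>', OF D[OF y] pos[OF y]])
    qed
    have cont: "continuous_on {-L..L} (\<lambda>x. c - 2 - ln ((\<phi> x)\<^sup>2))"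
      using pos by (intro continuous_intros c\<phi>) (auto simp: less_imp_neq[symmetric])
    have "\<phi>' L = 0"
      by (rule ode2_double_zero(1)[OF is_interval_cc cont ode xi z z']) (use L in simp)
    then show False using negL by simp
  qed
  show ?thesis
    by unfold_locales (use L pos D D' even s0 neg vtx vval apos in auto)
qed

section \<open>A Toda oscillator\<close>

text \<open>The Wronskian condition says that \<open>g / w\<close> does not decrease, so
  \<open>g b < 0\<close> would give \<open>g \<le> - \<delta> * w\<close> all the way back to
  \<open>a\<close>. If \<open>w a = 0\<close>, the contradiction comes from the first-order
  behaviour of \<open>g + \<delta> * w\<close> at \<open>a\<close>; this covers the start at rest,
  where the velocity \<open>w\<close> vanishes.\<close>

lemma barrier:
  fixes g w :: "real \<Rightarrow> real"
  assumes ab: "a < b" and g: "\<And>x. x \<in> {a..b} \<Longrightarrow> (g has_real_derivative g' x) (at x within {a..b})"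
    and w: "\<And>x. x \<in> {a..b} \<Longrightarrow> (w has_real_derivative w' x) (at x within {a..b})"
    and wpos: "\<And>x. a < x \<Longrightarrow> x \<le> b \<Longrightarrow> w x > 0"
    and wr: "\<And>x. a < x \<Longrightarrow> x < b \<Longrightarrow> 0 \<le> w x * g' x - w' x * g x"
    and init: "w a > 0 \<and> g a \<ge> 0 \<or> w a = 0 \<and> g a = 0 \<and> g' a = 0 \<and> w' a > 0"
  shows "g b \<ge> 0"
proof (rule ccontr)
  assume "\<not> g b \<ge> 0"
  define \<delta> where "\<delta> = - g b / w b"
  have wb: "w b > 0" using wpos ab by simp
  then have \<delta>: "\<delta> > 0" using \<open>\<not> g b \<ge> 0\<close> by (simp add: \<delta>_def divide_neg_pos)
  have le: "g y \<le> - \<delta> * w y" if y: "a \<le> y" "y \<le> b" "w y > 0" for y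
  proof -
    have wp: "w z > 0" if "z \<in> {y..b}" for z
      using wpos[of z] y that by (cases "z = y") auto
    have "g y / w y \<le> g b / w b"
    proof (rule nonneg_deriv_mono[where f = "\<lambda>x. g x / w x" and T = "{y..b}"])
      fix z assume z: "z \<in> {y..b}"
      then have z': "z \<in> {a..b}" using y by simp
      have sub: "{y..b} \<subseteq> {a..b}" using y by auto
      show "((\<lambda>x. g x / w x) has_real_derivative (g' z * w z - g z * w' z) / (w z * w z)) (at z within {y..b})"
        by (rule DERIV_divide DERIV_subset[OF g[OF z'] sub] DERIV_subset[OF w[OF z'] sub])+ (use wp[OF z] in simp)
      assume "y < z" "z < b"
      then show "0 \<le> (g' z * w z - g z * w' z) / (w z * w z)"
        using wr[of z] y by (intro divide_nonneg_nonneg) (auto simp: mult.commute)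
    qed (use y in \<open>auto simp: is_interval_cc\<close>)
    then show ?thesis using y by (simp add: \<delta>_def pos_divide_le_eq)
  qed
  show False
  proof (cases "w a > 0")
    case True
    then have "g a \<le> - \<delta> * w a" using le[of a] ab by simp
    moreover have "\<delta> * w a > 0" using True \<delta> by simp
    ultimately show False using init True by auto
  next
    case False
    then have i: "w a = 0" "g a = 0" "g' a = 0" "w' a > 0" using init by auto
    have "((\<lambda>x. g x + \<delta> * w x) has_real_derivative g' a + \<delta> * w' a) (at a within {a..b})"
      by (rule derivative_eq_intros g w refl | use ab in simp)+
    moreover have "g' a + \<delta> * w' a > 0" using i \<delta> by simp
    ultimately obtain d where d: "d > 0"
      "\<And>h. 0 < h \<Longrightarrow> a + h \<in> {a..b} \<Longrightarrow> h < d \<Longrightarrow> g a + \<delta> * w a < g (a + h) + \<delta> * w (a + h)"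
      using has_real_derivative_pos_inc_right[of "\<lambda>x. g x + \<delta> * w x"] by blast
    define h where "h = min d (b - a) / 2"
    have h: "0 < h" "h < d" "h \<le> b - a" using d ab by (auto simp: h_def min_def field_simps)
    have "0 < g (a + h) + \<delta> * w (a + h)" using d(2)[of h] h i by auto
    moreover have "w (a + h) > 0" using wpos[of "a + h"] h by simp
    ultimately show False using le[of "a + h"] h by auto
  qed
qed

text \<open>The second derivative \<open>6 * y\<^sup>2 / (1 + y)\<close> is nonnegative, and value
  and slope vanish at \<open>0\<close>. With \<open>y = exp v - 1\<close> this is the inequality
  behind the barrier for negative \<open>v\<close>.\<close>

lemma cubic_log_ineq:
  fixes y :: real assumes "y > -1"
  shows "0 \<le> y ^ 3 - 3 * y\<^sup>2 - 6 * y + 6 * (1 + y) * ln (1 + y)"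
proof -
  let ?T = "{-1<..} :: real set"
  define f where "f = (\<lambda>y::real. y ^ 3 - 3 * y\<^sup>2 - 6 * y + 6 * (1 + y) * ln (1 + y))"
  define f' where "f' = (\<lambda>y::real. 3 * y\<^sup>2 - 6 * y + 6 * ln (1 + y))"
  have D: "(f has_real_derivative f' z) (at z within ?T)" if "z \<in> ?T" for z
    unfolding f_def f'_def
    by (rule derivative_eq_intros refl | use that in \<open>simp add: field_simps\<close>)+
  have D': "(f' has_real_derivative 6 * z\<^sup>2 / (1 + z)) (at z within ?T)" if "z \<in> ?T" for z
    unfolding f'_def
    by (rule derivative_eq_intros refl | use that in \<open>simp add: field_simps power2_eq_square\<close>)+
  have iv: "is_interval ?T" by (simp add: is_interval_oi)
  have m: "f' x \<le> f' z" if "x \<in> ?T" "z \<in> ?T" "x \<le> z" for x z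
    by (rule nonneg_deriv_mono[OF iv that D']) auto
  have f0: "f 0 = 0" "f' 0 = 0" by (auto simp: f_def f'_def)
  have "f y \<ge> 0"
  proof (cases "y \<ge> 0")
    case True
    have "f 0 \<le> f y"
      by (rule nonneg_deriv_mono[where f = f, OF iv _ _ True D]) (use m[of 0] f0 True in auto)
    then show ?thesis by (simp add: f0)
  next
    case False
    have "- f y \<le> - f 0"
    proof (rule nonneg_deriv_mono[where f = "\<lambda>y. - f y", OF iv])
      show "((\<lambda>y. - f y) has_real_derivative - f' z) (at z within ?T)" if "z \<in> ?T" for z
        using D[OF that] by (rule DERIV_minus)
      show "0 \<le> - f' z" if "z \<in> ?T" "y < z" "z < 0" for z using m[of z 0] that f0 by simp
    qed (use False assms in auto)
    then show ?thesis by (simp add: f0)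
  qed
  then show ?thesis by (simp add: f_def)
qed

text \<open>The tangent of \<open>ln\<close> at \<open>2\<close>, with
  \<open>ln 2 \<le> 25 / 36\<close>, replaces the logarithm by a line. The remaining cubic in
  \<open>t = y - 1\<close> is \<open>t\<close> times a completed square with a positive remainder,
  plus a positive constant.\<close>

lemma toda_endpoint_ineq:
  fixes y :: real assumes y: "y \<ge> 1"
  shows "ln y < (4 * y / 3 - 1) * (y / 9 + 1 / y)"
proof -
  have "ln y = ln (y / 2) + ln 2" using y by (simp add: ln_div)
  also have "\<dots> \<le> (y / 2 - 1) + 25 / 36"
    using y by (intro add_mono ln_le_minus_one ln2_le_25_over_36) auto
  finally have 1: "ln y \<le> y / 2 - 11 / 36" by simp
  define t where "t = y - 1"
  have t: "t \<ge> 0" using y by (simp add: t_def)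
  have "0 \<le> (t - 9 / 16)\<^sup>2" by simp
  then have "0 \<le> t * (4 / 27 * (t - 9 / 16)\<^sup>2 + 31 / 36 - 3 / 64)"
    using t by (intro mult_nonneg_nonneg add_nonneg_nonneg) auto
  then have 2: "0 < t * (4 / 27 * (t - 9 / 16)\<^sup>2 + 31 / 36 - 3 / 64) + 19 / 108" by simp
  have "y * ((4 * y / 3 - 1) * (y / 9 + 1 / y)) - y * (y / 2 - 11 / 36) =
     4 / 27 * y ^ 3 - 11 / 18 * y\<^sup>2 + 59 / 36 * y - 1"
    using y by (simp add: field_simps power2_eq_square power3_eq_cube)
  also have "\<dots> = t * (4 / 27 * (t - 9 / 16)\<^sup>2 + 31 / 36 - 3 / 64) + 19 / 108"
    by (simp add: t_def field_simps power2_eq_square power3_eq_cube)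
  finally have "y * (y / 2 - 11 / 36) < y * ((4 * y / 3 - 1) * (y / 9 + 1 / y))" using 2 by linarith
  then have "y / 2 - 11 / 36 < (4 * y / 3 - 1) * (y / 9 + 1 / y)" using y by simp
  then show ?thesis using 1 by linarith
qed

text \<open>Here \<open>v'' = 2 (1 - exp v)\<close> is a Toda oscillator released from rest, \<open>q\<close> the variation of \<open>v\<close>
  with respect to its initial value, and \<open>v'\<^sup>2 / 4 + U v\<close> with \<open>U v = exp v - 1 - v\<close> is the
  conserved energy. The barriers for \<open>q\<close> have the form \<open>(k / E) (v'\<^sup>2 / 12 - B v)\<close>: for \<open>v < 0\<close>
  with \<open>B = U / U'\<close>, which comes from differentiating the period integral, and for \<open>v \<ge> 0\<close> with
  the simpler \<open>B v = 1 - exp (- v)\<close>.\<close>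

lemma toda_variation:
  fixes v w q q' :: "real \<Rightarrow> real" and k a L :: real
  assumes L: "L > 0" and v: "\<And>x. x \<in> {0..L} \<Longrightarrow> (v has_real_derivative w x) (at x within {0..L})"
    and w: "\<And>x. x \<in> {0..L} \<Longrightarrow> (w has_real_derivative 2 * (1 - exp (v x))) (at x within {0..L})"
    and q: "\<And>x. x \<in> {0..L} \<Longrightarrow> (q has_real_derivative q' x) (at x within {0..L})"
    and w0: "w 0 = 0" and wpos: "\<And>x. 0 < x \<Longrightarrow> x \<le> L \<Longrightarrow> w x > 0"
    and k: "k = 1 - exp (v 0)" "k > 0" and q0: "q 0 = 1" "q' 0 = 0"
    and wr: "\<And>x. x \<in> {0..L} \<Longrightarrow> w x * q' x - 2 * (1 - exp (v x)) * q x = - 2 * k"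
    and a: "a > 0" "w L = a" "exp (v L) = 3 * a\<^sup>2 / 4"
  shows "0 < (a\<^sup>2 - 1) * q L + k"
proof -
  define U where "U = (\<lambda>v::real. exp v - 1 - v)"
  have fac: "r * (K * X) - s * (K * Z) = K * (r * X - s * Z)" for r s K X Z :: real
    by (simp add: algebra_simps)
  have U0: "U t \<ge> 0" for t unfolding U_def using exp_ge_add_one_self[of t] by linarith
  have vmono: "v x < v y" if "0 \<le> x" "x < y" "y \<le> L" for x y
    by (rule pos_deriv_strict_mono[where f = v and T = "{0..L}", OF _ _ _ that(2) v])
      (use that wpos in \<open>auto simp: is_interval_cc\<close>)
  have v0: "v 0 < 0" using k by simp
  define E where "E = U (v 0)"
  have ED: "((\<lambda>x. (w x)\<^sup>2 / 4 + U (v x)) has_real_derivative 0) (at x within {0..L})" if x: "x \<in> {0..L}" for x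
    unfolding U_def
    by (rule derivative_eq_intros v[OF x] w[OF x] refl | simp add: field_simps)+
  have "\<exists>d. \<forall>x\<in>{0..L}. (w x)\<^sup>2 / 4 + U (v x) = d"
    using ED by (intro has_field_derivative_zero_constant) auto
  then have En: "(w x)\<^sup>2 / 4 + U (v x) = E" if "x \<in> {0..L}" for x
    using that L w0 unfolding E_def by (metis add_0 atLeastAtMost_iff div_0 less_imp_le order_refl zero_power2)
  have "ln (exp (v 0)) \<le> exp (v 0) - 1" by (rule ln_le_minus_one) simp
  moreover have "ln (exp (v 0)) \<noteq> exp (v 0) - 1"
    using ln_eq_minus_one[of "exp (v 0)"] k by auto
  ultimately have Epos: "E > 0" by (simp add: E_def U_def)
  have EL: "E = a\<^sup>2 - 1 - v L" using En[of L] L a by (simp add: U_def field_simps)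
  \<comment> \<open>The constant \<open>1\<close> is an upper barrier: its Wronskian expression
    exceeds that of \<open>q\<close> by \<open>2 * (exp (v x) - exp (v 0)) \<ge> 0\<close>.\<close>
  have ql: "q L \<le> 1"
  proof -
    have "0 \<le> 1 - q L"
    proof (rule barrier[where g = "\<lambda>x. 1 - q x" and w = w and a = 0])
      fix x assume x: "x \<in> {0..L}"
      show "((\<lambda>x. 1 - q x) has_real_derivative - q' x) (at x within {0..L})"
        by (rule derivative_eq_intros q[OF x] refl)+ simp
    next
      fix x assume x: "0 < x" "x < L"
      have "exp (v 0) \<le> exp (v x)" using vmono[of 0 x] x by simp
      then show "0 \<le> w x * - q' x - 2 * (1 - exp (v x)) * (1 - q x)"
        using wr[of x] x k by (simp add: algebra_simps)
    qed (use L w wpos w0 q0 k in auto)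
    then show ?thesis by simp
  qed
  show ?thesis
  \<comment> \<open>The sign of \<open>a\<^sup>2 - 1\<close> decides whether an upper or a lower
    bound for \<open>q L\<close> is wanted. For \<open>a \<le> 1\<close> the bound
    \<open>q L \<le> 1\<close> is enough, since
    \<open>exp (v 0) < 3 * a\<^sup>2 / 4\<close>.\<close>
  proof (cases "a \<le> 1")
    case True
    have "exp (v 0) < a\<^sup>2"
    proof -
      have "exp (v 0) < exp (v L)" using vmono[of 0 L] L by simp
      also have "\<dots> \<le> a\<^sup>2" unfolding a(3) using zero_le_power2[of a] by linarith
      finally show ?thesis .
    qed
    then have "0 < (a\<^sup>2 - 1) * 1 + k" using k by simp
    also have "(a\<^sup>2 - 1) * 1 \<le> (a\<^sup>2 - 1) * q L"
      using True a ql by (intro mult_left_mono_neg) (auto simp: power_le_one)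
    finally show ?thesis by simp
  next
    case False
    have a1: "a\<^sup>2 - 1 > 0" using False a by (simp add: one_less_power)
    have lower: "k / E * ((w y)\<^sup>2 / 12) \<le> q y" if y: "0 < y" "y \<le> L" "v y < 0" for y
    proof -
      have vneg: "v x < 0" if "x \<in> {0..y}" for x
        using vmono[of x y] y that by (cases "x = y") auto
      define B where "B = (\<lambda>x. U (v x) / (exp (v x) - 1))"
      define b where "b = (\<lambda>x. 1 - U (v x) * exp (v x) / (exp (v x) - 1)\<^sup>2)"
      \<comment> \<open>Here \<open>b\<close> is the derivative of \<open>B\<close> with respect to
        \<open>v\<close>. As \<open>U (v 0) = E\<close> and \<open>U'\<close> equals
        \<open>- k\<close> at \<open>v 0\<close>, the barrier starts with value \<open>1\<close> and
        slope \<open>0\<close>, like \<open>q\<close>. The weight \<open>1 / 12\<close> is the one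
        that cancels the first-order term of \<open>b - 1 / 2\<close> at
        \<open>v = 0\<close>.\<close>
      define \<theta> where "\<theta> = (\<lambda>x. k / E * ((w x)\<^sup>2 / 12 - B x))"
      define \<theta>' where "\<theta>' = (\<lambda>x. k / E * (w x * (2 * (1 - exp (v x))) / 6 - b x * w x))"
      have sub: "{0..y} \<subseteq> {0..L}" using y by auto
      have BD: "(B has_real_derivative b x * w x) (at x within {0..y})" if x: "x \<in> {0..y}" for x
      proof -
        have x': "x \<in> {0..L}" using x sub by blast
        have nz: "exp (v x) - 1 \<noteq> 0" using vneg[OF x] by simp
        note vD = DERIV_subset[OF v[OF x'] sub]
        have "(B has_real_derivative ((exp (v x) * w x - w x) * (exp (v x) - 1) - U (v x) * (exp (v x) * w x))
          / ((exp (v x) - 1) * (exp (v x) - 1))) (at x within {0..y})"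
          unfolding B_def U_def
          by (rule derivative_eq_intros vD refl nz | simp add: nz)+
        also have "((exp (v x) * w x - w x) * (exp (v x) - 1) - U (v x) * (exp (v x) * w x))
          / ((exp (v x) - 1) * (exp (v x) - 1)) = b x * w x"
        proof -
          have "(((Y + 1) * r - r) * Y - s * ((Y + 1) * r)) / (Y * Y) = (1 - s * (Y + 1) / Y\<^sup>2) * r"
            if "Y \<noteq> 0" for Y r s :: real
            using that by (simp add: field_simps power2_eq_square)
          from this[OF nz, of "w x" "U (v x)"] show ?thesis by (simp add: b_def)
        qed
        finally show ?thesis .
      qed
      have \<theta>D: "(\<theta> has_real_derivative \<theta>' x) (at x within {0..y})" if x: "x \<in> {0..y}" for x
      proof -
        have x': "x \<in> {0..L}" using x sub by blast
        show ?thesis unfolding \<theta>_def \<theta>'_def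
          by (rule derivative_eq_intros DERIV_subset[OF w[OF x'] sub] BD[OF x] refl | simp)+
      qed
      have \<theta>0: "\<theta> 0 = 1" "\<theta>' 0 = 0"
        using k Epos w0 by (simp_all add: \<theta>_def \<theta>'_def B_def E_def[symmetric] divide_simps)
      have "0 \<le> q y - \<theta> y"
      proof (rule barrier[where g = "\<lambda>x. q x - \<theta> x" and g' = "\<lambda>x. q' x - \<theta>' x" and w = w and a = 0])
        fix x assume x: "x \<in> {0..y}"
        then have x': "x \<in> {0..L}" using sub by blast
        show "((\<lambda>x. q x - \<theta> x) has_real_derivative q' x - \<theta>' x) (at x within {0..y})"
          by (rule DERIV_diff[OF DERIV_subset[OF q[OF x'] sub] \<theta>D[OF x]])
        show "(w has_real_derivative 2 * (1 - exp (v x))) (at x within {0..y})"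
          by (rule DERIV_subset[OF w[OF x'] sub])
      next
        fix x assume x: "0 < x" "x < y"
        then have x': "x \<in> {0..L}" "x \<in> {0..y}" using y by auto
        define Y where "Y = exp (v x) - 1"
        have Y: "Y < 0" "Y > -1" using vneg[OF x'(2)] by (auto simp: Y_def)
        have Ux: "U (v x) = Y - ln (1 + Y)" by (simp add: Y_def U_def)
        have "0 \<le> 3 * Y\<^sup>2 - 6 * U (v x) * (1 + Y) + Y ^ 3"
          using cubic_log_ineq[OF Y(2)] unfolding Ux by (simp add: algebra_simps power2_eq_square power3_eq_cube)
        also have "\<dots> = 6 * Y\<^sup>2 * (b x - 1 / 2 + Y / 6)"
        proof -
          have "b x = 1 - U (v x) * (1 + Y) / Y\<^sup>2" by (simp add: b_def Y_def)
          then show ?thesis using Y(1) by (simp add: field_simps power2_eq_square power3_eq_cube)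
        qed
        finally have "0 \<le> b x - 1 / 2 + Y / 6" using Y by (simp add: zero_le_mult_iff)
        then have nn: "0 \<le> (w x)\<^sup>2 * (b x - 1 / 2 + Y / 6)" by simp
        have BY: "B x * Y = U (v x)" using Y by (simp add: B_def Y_def)
        have nY: "1 - exp (v x) = - Y" by (simp add: Y_def)
        \<comment> \<open>By conservation of energy this expression is \<open>- 2 * k\<close> minus
          a nonnegative term, whereas for \<open>q\<close> it is exactly \<open>- 2 * k\<close>. The
          difference has the sign that \<open>barrier\<close> requires.\<close>
        have "w x * \<theta>' x - 2 * (1 - exp (v x)) * \<theta> x =
          k / E * (w x * (w x * (2 * (- Y)) / 6 - b x * w x) - 2 * (- Y) * ((w x)\<^sup>2 / 12 - B x))"
          unfolding \<theta>_def \<theta>'_def nY by (rule fac)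
        also have "w x * (w x * (2 * (- Y)) / 6 - b x * w x) - 2 * (- Y) * ((w x)\<^sup>2 / 12 - B x)
          = - ((w x)\<^sup>2 * (b x - 1 / 2 + Y / 6)) - ((w x)\<^sup>2 / 2 + 2 * (B x * Y))"
          by (simp add: field_simps power2_eq_square)
        also have "(w x)\<^sup>2 / 2 + 2 * (B x * Y) = 2 * E" using En[OF x'(1)] BY by simp
        also have "k / E * (- ((w x)\<^sup>2 * (b x - 1 / 2 + Y / 6)) - 2 * E) \<le> k / E * (0 - 2 * E)"
          using nn k Epos by (intro mult_left_mono) auto
        also have "\<dots> = - 2 * k" using Epos by simp
        finally show "0 \<le> w x * (q' x - \<theta>' x) - 2 * (1 - exp (v x)) * (q x - \<theta> x)"
          using wr[OF x'(1)] by (simp add: algebra_simps)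
      qed (use y w0 wpos \<theta>0 q0 k in auto)
      moreover have "B y \<le> 0"
        using vneg[of y] y U0[of "v y"] by (simp add: B_def divide_nonneg_neg)
      then have "k / E * ((w y)\<^sup>2 / 12) \<le> \<theta> y"
        unfolding \<theta>_def using k Epos by (intro mult_left_mono) auto
      ultimately show ?thesis by simp
    qed
    show ?thesis
    proof (cases "v L < 0")
      case True
      have "0 \<le> k / E * ((w L)\<^sup>2 / 12)" using k Epos by simp
      then have "0 \<le> q L" using lower[of L] True L by simp
      then show ?thesis using a1 k by (intro add_nonneg_pos mult_nonneg_nonneg) auto
    next
      case False
      have "continuous_on {0..L} v" using v by (rule DERIV_continuous_on)
      then obtain m where m: "0 \<le> m" "m \<le> L" "v m = 0"
        using IVT'[of v 0 0 L] v0 False L by auto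
      have m0: "0 < m" using m v0 by (cases "m = 0") auto
      have mL: "m \<in> {0..L}" using m by simp
      have cont: "continuous_on {0..L} (\<lambda>x. q x - k / E * ((w x)\<^sup>2 / 12))"
        by (intro continuous_intros DERIV_continuous_on[OF q] DERIV_continuous_on[OF w]) auto
      \<comment> \<open>At \<open>m\<close> the quotient in \<open>B\<close> has the form 0/0, so
        the bound reaches \<open>m\<close> only by continuity from the left.\<close>
      have "0 \<le> q m - k / E * ((w m)\<^sup>2 / 12)"
      proof (rule continuous_ge_on_closure[where S = "{0<..<m}" and x = m and f = "\<lambda>x. q x - k / E * ((w x)\<^sup>2 / 12)"])
        show "continuous_on (closure {0<..<m}) (\<lambda>x. q x - k / E * ((w x)\<^sup>2 / 12))"
          using cont m0 m by (auto elim!: continuous_on_subset)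
        show "m \<in> closure {0<..<m}" using m0 by simp
        show "0 \<le> q x - k / E * ((w x)\<^sup>2 / 12)" if "x \<in> {0<..<m}" for x
          using lower[of x] vmono[of x m] m that by simp
      qed
      then have qm: "k / E * ((w m)\<^sup>2 / 12) \<le> q m" by simp
      have "k / E * (a\<^sup>2 / 12 - (1 - exp (- v L))) \<le> q L"
      proof (cases "m = L")
        case True
        then show ?thesis using qm m a by simp
      next
        case False
        then have mL': "m < L" using m by simp
        \<comment> \<open>The second barrier equals \<open>k / E * ((w m)\<^sup>2 / 12)\<close> at
          \<open>m\<close>, where \<open>v\<close> vanishes, so it continues the first bound. Now
          \<open>w m > 0\<close>, and an inequality of values is enough to start.\<close>
        define \<theta> where "\<theta> = (\<lambda>x. k / E * ((w x)\<^sup>2 / 12 - (1 - exp (- v x))))"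
        define \<theta>' where "\<theta>' = (\<lambda>x. k / E * (w x * (2 * (1 - exp (v x))) / 6 - exp (- v x) * w x))"
        have sub: "{m..L} \<subseteq> {0..L}" using m by auto
        have "0 \<le> q L - \<theta> L"
        proof (rule barrier[where g = "\<lambda>x. q x - \<theta> x" and g' = "\<lambda>x. q' x - \<theta>' x" and w = w and a = m])
          fix x assume x: "x \<in> {m..L}"
          then have x': "x \<in> {0..L}" using sub by blast
          have "(\<theta> has_real_derivative \<theta>' x) (at x within {m..L})"
            unfolding \<theta>_def \<theta>'_def
            by (rule derivative_eq_intros DERIV_subset[OF w[OF x'] sub] DERIV_subset[OF v[OF x'] sub] refl | simp)+
          then show "((\<lambda>x. q x - \<theta> x) has_real_derivative q' x - \<theta>' x) (at x within {m..L})"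
            by (rule DERIV_diff[OF DERIV_subset[OF q[OF x'] sub]])
          show "(w has_real_derivative 2 * (1 - exp (v x))) (at x within {m..L})"
            by (rule DERIV_subset[OF w[OF x'] sub])
        next
          fix x assume x: "m < x" "x < L"
          then have x': "x \<in> {0..L}" using m by auto
          define Y where "Y = exp (v x)"
          have Y: "Y > 0" "exp (- v x) = 1 / Y" by (auto simp: Y_def exp_minus field_simps)
          have "0 \<le> ((Y - 2)\<^sup>2 + 2) / (6 * Y)" using Y by (intro divide_nonneg_nonneg) auto
          also have "\<dots> = 1 / Y - 1 / 2 + (Y - 1) / 6"
            using Y by (simp add: field_simps power2_eq_square)
          finally have nn: "0 \<le> (w x)\<^sup>2 * (1 / Y - 1 / 2 + (Y - 1) / 6)" by simp
          \<comment> \<open>For the first barrier \<open>B * U'\<close> equalled \<open>U\<close>;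
            for the simpler \<open>B\<close> it only dominates \<open>U\<close>, which is the right
            direction.\<close>
          have "U (v x) \<le> (1 - 1 / Y) * (Y - 1)"
          proof -
            have "1 - v x \<le> 1 / Y" using exp_ge_add_one_self[of "- v x"] Y by simp
            moreover have "(1 - 1 / Y) * (Y - 1) = Y - 2 + 1 / Y" using Y by (simp add: field_simps)
            ultimately show ?thesis by (simp add: U_def Y_def)
          qed
          then have eE: "2 * E \<le> (w x)\<^sup>2 / 2 + 2 * ((1 - 1 / Y) * (Y - 1))" using En[OF x'] by simp
          have "w x * \<theta>' x - 2 * (1 - exp (v x)) * \<theta> x =
            k / E * (w x * (w x * (2 * (1 - Y)) / 6 - 1 / Y * w x) - 2 * (1 - Y) * ((w x)\<^sup>2 / 12 - (1 - 1 / Y)))"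
            unfolding \<theta>_def \<theta>'_def Y(2) Y_def[symmetric] by (rule fac)
          also have "w x * (w x * (2 * (1 - Y)) / 6 - 1 / Y * w x) - 2 * (1 - Y) * ((w x)\<^sup>2 / 12 - (1 - 1 / Y))
            = - ((w x)\<^sup>2 * (1 / Y - 1 / 2 + (Y - 1) / 6)) - ((w x)\<^sup>2 / 2 + 2 * ((1 - 1 / Y) * (Y - 1)))"
            using Y(1) by (simp add: field_simps power2_eq_square)
          also have "k / E * \<dots> \<le> k / E * (- 2 * E)"
            using nn eE k Epos by (intro mult_left_mono) auto
          also have "\<dots> = - 2 * k" using Epos by simp
          finally show "0 \<le> w x * (q' x - \<theta>' x) - 2 * (1 - exp (v x)) * (q x - \<theta> x)"
            using wr[OF x'] by (simp add: algebra_simps)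
        next
          show "0 < w m \<and> 0 \<le> q m - \<theta> m \<or>
            w m = 0 \<and> q m - \<theta> m = 0 \<and> q' m - \<theta>' m = 0 \<and> 0 < 2 * (1 - exp (v m))"
            using qm m wpos[OF m0] by (simp add: \<theta>_def)
        qed (use mL' m0 wpos in auto)
        then show ?thesis by (simp add: \<theta>_def a)
      qed
      then have "(a\<^sup>2 - 1) * (k / E * (a\<^sup>2 / 12 - (1 - exp (- v L)))) \<le> (a\<^sup>2 - 1) * q L"
        using a1 by (intro mult_left_mono) auto
      moreover have "0 < (a\<^sup>2 - 1) * (k / E * (a\<^sup>2 / 12 - (1 - exp (- v L)))) + k"
      proof -
        \<comment> \<open>With \<open>y = exp (v L)\<close> and \<open>E\<close> from energy
          conservation at \<open>L\<close>, everything is a function of \<open>y\<close> alone, and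
          the endpoint inequality applies.\<close>
        define y where "y = exp (v L)"
        have y: "y \<ge> 1" "v L = ln y" "a\<^sup>2 = 4 * y / 3" using False a by (auto simp: y_def)
        have ey: "exp (- v L) = 1 / y" by (simp add: y_def exp_minus field_simps)
        have "0 < (a\<^sup>2 - 1) * (a\<^sup>2 / 12 - (1 - exp (- v L))) + E"
        proof -
          have "(4 * y / 3 - 1) * (4 * y / 3 / 12 - (1 - 1 / y)) + (4 * y / 3 - 1 - ln y) =
              (4 * y / 3 - 1) * (y / 9 + 1 / y) - ln y"
            by (simp add: algebra_simps)
          then show ?thesis unfolding EL ey unfolding y(2,3) using toda_endpoint_ineq[OF y(1)] by simp
        qed
        then have "0 < k / E * ((a\<^sup>2 - 1) * (a\<^sup>2 / 12 - (1 - exp (- v L))) + E)"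
          using k Epos by simp
        also have "\<dots> = (a\<^sup>2 - 1) * (k / E * (a\<^sup>2 / 12 - (1 - exp (- v L)))) + k"
        proof -
          have kE: "k / E * E = k" using Epos by simp
          show ?thesis unfolding distrib_left kE by (simp only: mult.left_commute)
        qed
        finally show ?thesis .
      qed
      ultimately show ?thesis by (meson add_right_mono less_le_trans)
    qed
  qed
qed

section \<open>Nondegeneracy at the vertex\<close>

context log_lobe
begin

definition \<phi>'' :: "real \<Rightarrow> real" where "\<phi>'' x = (c - ln ((\<phi> x)\<^sup>2)) * \<phi> x"

lemma half_subset: "{0..L} \<subseteq> {-L..L}" using L_pos by auto

lemma V_continuous: "continuous_on {-L..L} V"
proof -
  have "continuous_on {-L..L} \<phi>" using D by (rule DERIV_continuous_on)
  then show ?thesis unfolding V_def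
    using pos by (intro continuous_intros) (auto simp: less_imp_neq[symmetric])
qed

lemma slope_ode: "ode2 {-L..L} V \<phi>' \<phi>''"
  unfolding ode2_def
proof (intro ballI conjI)
  fix x assume x: "x \<in> {-L..L}"
  show "(\<phi>' has_real_derivative \<phi>'' x) (at x within {-L..L})" unfolding \<phi>''_def by (rule D'[OF x])
  show "(\<phi>'' has_real_derivative V x * \<phi>' x) (at x within {-L..L})"
    unfolding \<phi>''_def V_def by (rule linearization_deriv[where \<phi> = \<phi> and \<phi>' = \<phi>', OF D[OF x] pos[OF x]])
qed

lemma \<phi>''_L: "\<phi>'' L = (a\<^sup>2 - 1) * \<phi> L"
  by (simp add: \<phi>''_def vertex_value)

lemma slope_L_neg: "\<phi>' L < 0" using slope_neg L_pos by simp

text \<open>The factor \<open>-3\<close> is \<open>1 - 4\<close>: at \<open>L\<close> the potential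
  part is \<open>- (a * \<phi> L)\<^sup>2\<close>, and the vertex condition turns it into
  \<open>- 4 * (\<phi>' L)\<^sup>2\<close>.\<close>

lemma energy:
  assumes "x \<in> {-L..L}"
  shows "(\<phi>' x)\<^sup>2 + (\<phi> x)\<^sup>2 * (ln ((\<phi> x)\<^sup>2) - c - 1) = - 3 * (\<phi>' L)\<^sup>2"
proof -
  let ?E = "\<lambda>x. (\<phi>' x)\<^sup>2 + (\<phi> x)\<^sup>2 * (ln ((\<phi> x)\<^sup>2) - c - 1)"
  have "\<exists>k. \<forall>z\<in>{-L..L}. ?E z = k"
    using energy_deriv[OF D D' pos] by (intro has_field_derivative_zero_constant) auto
  then have "?E x = ?E L" using assms L_pos by force
  moreover have "(a * \<phi> L)\<^sup>2 = 4 * (\<phi>' L)\<^sup>2"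
    using arg_cong[OF vertex, of "\<lambda>x. x\<^sup>2"] by (simp add: power_mult_distrib)
  then have "?E L = - 3 * (\<phi>' L)\<^sup>2" by (simp add: vertex_value power_mult_distrib mult.commute)
  ultimately show ?thesis by simp
qed

lemma \<phi>''_0_neg: "\<phi>'' 0 < 0"
proof -
  have z: "0 \<in> {-L..L}" using L_pos by auto
  have "\<phi>'' 0 \<le> 0"
  proof (rule deriv_nonpos_if_antimono)
    show "(\<phi>' has_real_derivative \<phi>'' 0) (at 0 within {0..L})"
      using ode2D(1)[OF slope_ode z] half_subset by (rule DERIV_subset)
    show "\<phi>' y \<le> \<phi>' 0" if "y \<in> {0..L}" "0 \<le> y" for y
      using slope_neg[of y] slope_0 that by (cases "y = 0") auto
    show "\<exists>h. 0 < h \<and> h < d \<and> 0 + h \<in> {0..L}" if "d > 0" for d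
      using that L_pos by (intro exI[of _ "min d L / 2"]) auto
  qed
  moreover have "\<phi>'' 0 \<noteq> 0"
  proof
    assume "\<phi>'' 0 = 0"
    then have "\<phi>' L = 0"
      using ode2_double_zero(1)[OF _ V_continuous slope_ode z slope_0, of L] L_pos by (auto simp: is_interval_cc)
    then show False using slope_L_neg by simp
  qed
  ultimately show ?thesis by simp
qed

text \<open>With \<open>\<epsilon> = 3 (\<phi>' L)\<^sup>2\<close>, the substitution \<open>v = ln \<epsilon> - ln (\<phi>\<^sup>2)\<close> turns the profile into a Toda
  oscillator, and the even solution \<open>u\<close> of the linearized equation into its variation.\<close>

lemma vertex_nondegenerate:
  assumes u: "ode2 {0..L} V u u'" and u0: "u 0 = 1" "u' 0 = 0"
  shows "0 < 4 * \<phi>' L * u' L - \<phi>'' L * u L"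
proof -
  \<comment> \<open>This is minus the conserved energy. Normalized by it, the oscillator has its
    equilibrium at \<open>v = 0\<close>, and \<open>exp (v L) = 3 * a\<^sup>2 / 4\<close>.\<close>
  define \<epsilon> where "\<epsilon> = 3 * (\<phi>' L)\<^sup>2"
  have \<epsilon>: "\<epsilon> > 0" using slope_L_neg by (simp add: \<epsilon>_def)
  define v where "v = (\<lambda>x. ln \<epsilon> - ln ((\<phi> x)\<^sup>2))"
  define w where "w = (\<lambda>x. - 2 * \<phi>' x / \<phi> x)"
  have in2: "x \<in> {-L..L}" if "x \<in> {0..L}" for x using that half_subset by blast
  note p = pos[OF in2]
  have ev: "exp (v x) = \<epsilon> / (\<phi> x)\<^sup>2" if "x \<in> {0..L}" for x
    using \<epsilon> p[OF that] by (simp add: v_def exp_diff)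
  have \<phi>2: "\<phi>'' x / \<phi> x = (\<phi>' x / \<phi> x)\<^sup>2 - 1 + exp (v x)" if x: "x \<in> {0..L}" for x
  proof -
    have "(\<phi> x)\<^sup>2 * (c - ln ((\<phi> x)\<^sup>2)) = (\<phi>' x)\<^sup>2 - (\<phi> x)\<^sup>2 + \<epsilon>"
      using energy[OF in2[OF x]] by (simp add: \<epsilon>_def algebra_simps)
    then have "c - ln ((\<phi> x)\<^sup>2) = ((\<phi>' x)\<^sup>2 - (\<phi> x)\<^sup>2 + \<epsilon>) / (\<phi> x)\<^sup>2"
      using p[OF x] by (metis less_irrefl nonzero_mult_div_cancel_left power2_less_0 power_eq_0_iff)
    then show ?thesis
      using p[OF x] by (simp add: ev[OF x] \<phi>''_def add_divide_distrib diff_divide_distrib power_divide)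
  qed
  note D0 = DERIV_subset[OF D[OF in2] half_subset]
  have D1: "(\<phi>' has_real_derivative \<phi>'' x) (at x within {0..L})" if "x \<in> {0..L}" for x
    using D'[OF in2[OF that]] half_subset unfolding \<phi>''_def by (rule DERIV_subset)
  define k where "k = 1 - exp (v 0)"
  have z: "0 \<in> {0..L}" and l: "L \<in> {0..L}" using L_pos by auto
  have \<phi>0: "\<phi>'' 0 = - k * \<phi> 0"
    using \<phi>2[OF z] p[OF z] by (simp add: slope_0 k_def field_simps)
  then have k: "k > 0" using \<phi>''_0_neg p[OF z] by (simp add: zero_less_mult_iff)
  define \<gamma> where "\<gamma> = (1 - k) * \<phi> 0"
  have \<gamma>: "\<gamma> > 0" using p[OF z] by (simp add: \<gamma>_def k_def)
  have \<gamma>0: "\<gamma> * \<phi> 0 = \<epsilon>" using ev[OF z] p[OF z] by (simp add: \<gamma>_def k_def power2_eq_square)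
  \<comment> \<open>If the maximum \<open>\<phi> 0\<close> is lowered at rate
    \<open>\<gamma> / 2\<close>, then \<open>\<phi>\<close> changes by
    \<open>- (\<gamma> / 2) * u\<close> and the logarithm of minus the energy changes at rate
    \<open>k\<close>. So this is the resulting derivative of \<open>v\<close>;
    \<open>\<gamma>\<close> is chosen to make \<open>q 0 = 1\<close>.\<close>
  define q where "q = (\<lambda>x. k + \<gamma> * (u x / \<phi> x))"
  define q' where "q' = (\<lambda>x. \<gamma> * ((u' x * \<phi> x - u x * \<phi>' x) / (\<phi> x * \<phi> x)))"
  have W: "\<phi>' x * u' x - \<phi>'' x * u x = k * \<phi> 0" if x: "x \<in> {0..L}" for x
  proof -
    have "((\<lambda>x. u' x * \<phi>' x - u x * \<phi>'' x) has_real_derivative 0) (at x within {0..L})" if "x \<in> {0..L}" for x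
      using ode2_wronskian[OF u ode2_subset[OF slope_ode half_subset] that] by simp
    then have "\<exists>d. \<forall>x\<in>{0..L}. u' x * \<phi>' x - u x * \<phi>'' x = d"
      by (intro has_field_derivative_zero_constant) auto
    then have "u' x * \<phi>' x - u x * \<phi>'' x = u' 0 * \<phi>' 0 - u 0 * \<phi>'' 0"
      using x z by force
    then show ?thesis using u0 \<phi>0 by (simp add: slope_0 mult.commute)
  qed
  have key: "0 < (a\<^sup>2 - 1) * q L + k"
  proof (rule toda_variation[where v = v and w = w and q = q and q' = q' and L = L])
    fix x assume x: "x \<in> {0..L}"
    have ne: "\<phi> x \<noteq> 0" using p[OF x] by simp
    show "(v has_real_derivative w x) (at x within {0..L})"
      unfolding v_def w_def
      by (rule derivative_eq_intros D0[OF x] refl | use p[OF x] in \<open>simp add: power2_eq_square\<close>)+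
    have "(w has_real_derivative - 2 * ((\<phi>'' x * \<phi> x - \<phi>' x * \<phi>' x) / (\<phi> x * \<phi> x))) (at x within {0..L})"
      unfolding w_def
      by (rule derivative_eq_intros D0[OF x] D1[OF x] refl ne | simp add: algebra_simps ne diff_divide_distrib)+
    also have "- 2 * ((\<phi>'' x * \<phi> x - \<phi>' x * \<phi>' x) / (\<phi> x * \<phi> x)) = - 2 * (\<phi>'' x / \<phi> x - (\<phi>' x / \<phi> x)\<^sup>2)"
      using ne by (simp add: field_simps power2_eq_square)
    also have "\<dots> = 2 * (1 - exp (v x))" using \<phi>2[OF x] by simp
    finally show "(w has_real_derivative 2 * (1 - exp (v x))) (at x within {0..L})" .
    show "(q has_real_derivative q' x) (at x within {0..L})"
      unfolding q_def q'_def
      by (rule derivative_eq_intros D0[OF x] ode2D(1)[OF u x] refl ne | simp)+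
    have ph: "\<phi>'' x = \<phi> x * ((\<phi>' x / \<phi> x)\<^sup>2 - 1 + exp (v x))" using \<phi>2[OF x] ne by (simp add: field_simps)
    have "w x * q' x - 2 * (1 - exp (v x)) * q x =
        - 2 * \<gamma> / (\<phi> x)\<^sup>2 * (\<phi>' x * u' x - \<phi>'' x * u x) + 2 * k * exp (v x) - 2 * k"
      using ne unfolding w_def q'_def q_def ph by (simp add: field_simps power2_eq_square)
    also have "- 2 * \<gamma> / (\<phi> x)\<^sup>2 * (\<phi>' x * u' x - \<phi>'' x * u x) = - 2 * k * exp (v x)"
      unfolding W[OF x] ev[OF x] \<gamma>0[symmetric] by simp
    finally show "w x * q' x - 2 * (1 - exp (v x)) * q x = - 2 * k" by simp
  next
    show "w x > 0" if "0 < x" "x \<le> L" for x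
      using slope_neg[OF that] p[of x] that by (simp add: w_def divide_neg_pos)
    show "q 0 = 1" using p[OF z] by (simp add: q_def u0 \<gamma>_def)
    show "w L = a" using vertex p[OF l] by (simp add: w_def)
    have "(a * \<phi> L)\<^sup>2 = 4 * (\<phi>' L)\<^sup>2"
      using arg_cong[OF vertex, of "\<lambda>x. x\<^sup>2"] by (simp add: power_mult_distrib)
    then show "exp (v L) = 3 * a\<^sup>2 / 4"
      using p[OF l] by (simp add: ev[OF l] \<epsilon>_def field_simps power_mult_distrib)
  qed (use L_pos a_pos k u0 slope_0 in \<open>auto simp: w_def q'_def k_def\<close>)
  \<comment> \<open>The constant Wronskian \<open>W\<close> removes \<open>u' L\<close>. Then
    \<open>\<phi>'' L\<close>, \<open>u L\<close> and \<open>\<phi> L\<close> are expressed by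
    \<open>a\<close>, \<open>q L\<close> and \<open>\<gamma>\<close>, and the Toda inequality
    appears with the positive factor \<open>4 * \<phi> 0 / a\<^sup>2\<close>.\<close>
  have e1: "4 * \<phi>' L * u' L - \<phi>'' L * u L = 4 * (k * \<phi> 0) + 3 * (\<phi>'' L * u L)"
  proof -
    have "\<phi>' L * u' L = \<phi>'' L * u L + k * \<phi> 0" using W[OF l] by simp
    then show ?thesis by (simp add: mult.assoc)
  qed
  have e2: "\<phi>'' L * u L = (a\<^sup>2 - 1) * (\<phi> L)\<^sup>2 * ((q L - k) / \<gamma>)"
    using \<gamma> p[OF l] by (simp add: \<phi>''_L q_def power2_eq_square)
  have e3: "(\<phi> L)\<^sup>2 = \<gamma> * \<phi> 0 * 4 / (3 * a\<^sup>2)"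
  proof -
    have "(a * \<phi> L)\<^sup>2 = 4 * (\<phi>' L)\<^sup>2"
      using arg_cong[OF vertex, of "\<lambda>x. x\<^sup>2"] by (simp add: power_mult_distrib)
    then show ?thesis unfolding \<gamma>0 \<epsilon>_def using a_pos by (simp add: field_simps power_mult_distrib)
  qed
  have e4: "4 * (k * \<phi> 0) + 3 * ((a\<^sup>2 - 1) * (\<gamma> * \<phi> 0 * 4 / (3 * a\<^sup>2)) * ((q L - k) / \<gamma>))
      = 4 * \<phi> 0 / a\<^sup>2 * ((a\<^sup>2 - 1) * q L + k)"
    using \<gamma> a_pos by (simp add: field_simps)
  have "0 < 4 * \<phi> 0 / a\<^sup>2 * ((a\<^sup>2 - 1) * q L + k)" using key a_pos p[OF z] by simp
  then show ?thesis unfolding e1 unfolding e2 unfolding e3 unfolding e4 .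
qed

end

section \<open>Shooting\<close>

text \<open>Picone's identity: the quantity is monotone for \<open>b \<ge> 0\<close> whatever the
  sign of \<open>f\<close>. Divided by \<open>p\<^sup>2\<close> it is half the derivative of
  \<open>(f / p)\<^sup>2\<close>, so it controls the size of \<open>f\<close> relative to
  \<open>p\<close>.\<close>

lemma picone_deriv:
  assumes p: "ode2 T Q p p'" and f: "ode2 T R f f'" and R: "R x = Q x + b" and x: "x \<in> T" "p x > 0"
  shows "((\<lambda>x. f x * f' x - (f x)\<^sup>2 * p' x / p x) has_real_derivative
    (f' x - f x * p' x / p x)\<^sup>2 + b * (f x)\<^sup>2) (at x within T)"
proof -
  have ne: "p x \<noteq> 0" using x by simp
  have "((\<lambda>x. f x * f' x - (f x)\<^sup>2 * p' x / p x) has_real_derivative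
    f' x * f' x + R x * f x * f x -
     ((2 * f x * f' x * p' x + Q x * p x * (f x)\<^sup>2) * p x - (f x)\<^sup>2 * p' x * p' x) / (p x * p x)) (at x within T)"
    by (rule derivative_eq_intros ode2D[OF p x(1)] ode2D[OF f x(1)] refl ne | simp add: algebra_simps)+
  also have "f' x * f' x + R x * f x * f x -
     ((2 * f x * f' x * p' x + Q x * p x * (f x)\<^sup>2) * p x - (f x)\<^sup>2 * p' x * p' x) / (p x * p x) =
     (f' x - f x * p' x / p x)\<^sup>2 + b * (f x)\<^sup>2"
    using ne unfolding R by (simp add: field_simps power2_eq_square)
  finally show ?thesis .
qed

lemma quotient_square_deriv:
  assumes p: "ode2 T Q p p'" and f: "ode2 T R f f'" and x: "x \<in> T" "p x > 0"
  shows "((\<lambda>x. (f x)\<^sup>2 / (p x)\<^sup>2) has_real_derivative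
    2 * (f x * f' x - (f x)\<^sup>2 * p' x / p x) / (p x)\<^sup>2) (at x within T)"
proof -
  have ne: "p x \<noteq> 0" using x by simp
  have "((\<lambda>x. (f x)\<^sup>2 / (p x)\<^sup>2) has_real_derivative
    (2 * f x * f' x * (p x)\<^sup>2 - (f x)\<^sup>2 * (2 * p x * p' x)) / ((p x)\<^sup>2 * (p x)\<^sup>2)) (at x within T)"
    by (rule derivative_eq_intros ode2D[OF p x(1)] ode2D[OF f x(1)] refl ne | simp add: ne)+
  also have "(2 * f x * f' x * (p x)\<^sup>2 - (f x)\<^sup>2 * (2 * p x * p' x)) / ((p x)\<^sup>2 * (p x)\<^sup>2) =
    2 * (f x * f' x - (f x)\<^sup>2 * p' x / p x) / (p x)\<^sup>2"
    using ne by (simp add: field_simps power2_eq_square)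
  finally show ?thesis .
qed

text \<open>Picone's quantity vanishes at \<open>z\<close> and does not decrease, so
  \<open>(f / p)\<^sup>2\<close> does not decrease after \<open>z\<close>. Once \<open>f\<close> has
  become negative it therefore cannot return to zero.\<close>

lemma sturm_no_return:
  assumes p: "ode2 {a..b} Q p p'" and pp: "\<And>x. a < x \<Longrightarrow> x \<le> b \<Longrightarrow> p x > 0"
    and f: "ode2 {a..b} R f f'" and R: "\<And>x. x \<in> {a..b} \<Longrightarrow> R x = Q x + c" "c \<ge> 0"
    and z: "a < z" "f z = 0" "f' z < 0" and y: "z < y" "y \<le> b"
  shows "f y < 0"
proof -
  have sub: "{z..b} \<subseteq> {a..b}" using z by auto
  note p' = ode2_subset[OF p sub] and f' = ode2_subset[OF f sub]
  have R': "R x = Q x + c" if "x \<in> {z..b}" for x using R that sub by blast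
  have pp': "p x > 0" if "x \<in> {z..b}" for x using pp that z by auto
  have nn: "0 \<le> f x * f' x - (f x)\<^sup>2 * p' x / p x" if x: "x \<in> {z..b}" for x
  proof -
    have "f z * f' z - (f z)\<^sup>2 * p' z / p z \<le> f x * f' x - (f x)\<^sup>2 * p' x / p x"
    proof (rule nonneg_deriv_mono[where f = "\<lambda>x. f x * f' x - (f x)\<^sup>2 * p' x / p x" and T = "{z..b}"])
      fix t assume t: "t \<in> {z..b}"
      show "((\<lambda>x. f x * f' x - (f x)\<^sup>2 * p' x / p x) has_real_derivative
         (f' t - f t * p' t / p t)\<^sup>2 + c * (f t)\<^sup>2) (at t within {z..b})"
        by (rule picone_deriv[OF p' f' R'[OF t] t pp'[OF t]])
      show "0 \<le> (f' t - f t * p' t / p t)\<^sup>2 + c * (f t)\<^sup>2" using R(2) by simp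
    qed (use x y in \<open>auto simp: is_interval_cc\<close>)
    then show ?thesis using z by simp
  qed
  have sq: "(f s)\<^sup>2 / (p s)\<^sup>2 \<le> (f t)\<^sup>2 / (p t)\<^sup>2" if "z \<le> s" "s \<le> t" "t \<le> b" for s t
  proof (rule nonneg_deriv_mono[where f = "\<lambda>x. (f x)\<^sup>2 / (p x)\<^sup>2" and T = "{z..b}"])
    fix x assume x: "x \<in> {z..b}"
    show "((\<lambda>x. (f x)\<^sup>2 / (p x)\<^sup>2) has_real_derivative
      2 * (f x * f' x - (f x)\<^sup>2 * p' x / p x) / (p x)\<^sup>2) (at x within {z..b})"
      by (rule quotient_square_deriv[OF p' f' x pp'[OF x]])
    show "0 \<le> 2 * (f x * f' x - (f x)\<^sup>2 * p' x / p x) / (p x)\<^sup>2"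
      using nn[OF x] by (intro divide_nonneg_nonneg) auto
  qed (use that in \<open>auto simp: is_interval_cc\<close>)
  obtain d where d: "d > 0" "\<And>h. 0 < h \<Longrightarrow> z + h \<in> {z..b} \<Longrightarrow> h < d \<Longrightarrow> f (z + h) < f z"
    using has_real_derivative_neg_dec_right[OF ode2D(1)[OF f', of z]] z y by auto
  define h where "h = min d (y - z) / 2"
  have h: "0 < h" "h < d" "z + h < y" using d y by (auto simp: h_def min_def field_simps)
  define s where "s = z + h"
  have s: "z < s" "s < y" "f s < 0" using d(2)[of h] h y z by (auto simp: s_def)
  have nz: "f t \<noteq> 0" if "s \<le> t" "t \<le> b" for t
  proof
    assume "f t = 0"
    then have "(f s)\<^sup>2 / (p s)\<^sup>2 \<le> 0" using sq[of s t] s that by simp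
    moreover have "0 < (f s)\<^sup>2 / (p s)\<^sup>2" using s pp'[of s] y by simp
    ultimately show False by simp
  qed
  show ?thesis
  proof (rule ccontr)
    assume "\<not> f y < 0"
    have "continuous_on {s..y} f"
      by (rule continuous_on_subset[OF ode2_continuous(1)[OF f]]) (use s z y in auto)
    then obtain t where "s \<le> t" "t \<le> y" "f t = 0"
      using IVT'[of f s 0 y] s \<open>\<not> f y < 0\<close> by auto
    then show False using nz[of t] y by simp
  qed
qed

lemma first_zero:
  fixes f :: "real \<Rightarrow> real"
  assumes f: "continuous_on {a..b} f" "f a > 0" and x: "x \<in> {a..b}" "f x \<le> 0"
  obtains z where "a < z" "z \<le> x" "f z = 0" "\<And>t. a \<le> t \<Longrightarrow> t < z \<Longrightarrow> f t > 0"
proof -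
  have c: "continuous_on {a..x} f" by (rule continuous_on_subset[OF f(1)]) (use x in auto)
  then obtain t where t: "a \<le> t" "t \<le> x" "f t = 0" using IVT2'[of f x 0 a] f(2) x by auto
  have "closed {t \<in> {a..x}. f t = 0}" by (rule continuous_closed_preimage_constant[OF c]) simp
  then have "compact {t \<in> {a..x}. f t = 0}"
    using compact_Int_closed[OF compact_Icc, of "{t \<in> {a..x}. f t = 0}" a x] by (simp add: Int_def conj_ac)
  then obtain z where z: "z \<in> {t \<in> {a..x}. f t = 0}" "\<And>s. s \<in> {t \<in> {a..x}. f t = 0} \<Longrightarrow> z \<le> s"
    using compact_attains_inf[of "{t \<in> {a..x}. f t = 0}"] t by auto
  show ?thesis
  proof (rule that)
    show "a < z" using z f(2) by (cases "z = a") auto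
    show "z \<le> x" "f z = 0" using z by auto
    fix s assume s: "a \<le> s" "s < z"
    show "f s > 0"
    proof (rule ccontr)
      assume "\<not> f s > 0"
      moreover have "continuous_on {a..s} f" by (rule continuous_on_subset[OF c]) (use s z in auto)
      ultimately obtain r where "a \<le> r" "r \<le> s" "f r = 0" using IVT2'[of f s 0 a] f(2) s by auto
      then show False using z(2)[of r] s z(1) by auto
    qed
  qed
qed

lemma deriv_nonpos_if_nonneg_left:
  fixes f :: "real \<Rightarrow> real"
  assumes "(f has_real_derivative D) (at z within {a..b})" "a < z" "z \<le> b" "f z = 0"
    "\<And>t. a \<le> t \<Longrightarrow> t < z \<Longrightarrow> f t \<ge> 0"
  shows "D \<le> 0"
proof (rule ccontr)
  assume "\<not> D \<le> 0"
  then obtain d where d: "d > 0" "\<And>h. 0 < h \<Longrightarrow> z - h \<in> {a..b} \<Longrightarrow> h < d \<Longrightarrow> f (z - h) < f z"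
    using has_real_derivative_pos_inc_left[OF assms(1)] by auto
  define h where "h = min d (z - a) / 2"
  have h: "0 < h" "h < d" "a \<le> z - h" using d assms(2) by (auto simp: h_def min_def field_simps)
  then show False using d(2)[of h] assms(3,4) assms(5)[of "z - h"] by simp
qed

section \<open>The harmonic oscillator on the half-line and the shooting pair\<close>

context log_lobe
begin

definition y :: "real \<Rightarrow> real" where "y x = x - L + a"

definition W :: "real \<Rightarrow> real" where "W x = (y x)\<^sup>2 - 3"

text \<open>The first excited state of the harmonic oscillator in the variable \<open>y\<close>, up
  to sign the derivative of the Gaussian; the shift \<open>3\<close> in \<open>W\<close> makes its
  eigenvalue zero.\<close>

definition g0 :: "real \<Rightarrow> real" where "g0 x = y x * exp (- (y x)\<^sup>2 / 2)"

definition g0' :: "real \<Rightarrow> real" where "g0' x = (1 - (y x)\<^sup>2) * exp (- (y x)\<^sup>2 / 2)"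

lemma y_pos: "x \<ge> L \<Longrightarrow> y x > 0" using a_pos by (simp add: y_def)

lemma g0_pos: "x \<ge> L \<Longrightarrow> g0 x > 0" using y_pos by (simp add: g0_def)

lemma W_continuous: "continuous_on A W"
  unfolding W_def y_def by (intro continuous_intros)

lemma y_deriv [derivative_intros]: "(y has_real_derivative 1) (at x within S)"
  unfolding y_def by (auto intro!: derivative_eq_intros)

lemma g0_ode: "ode2 {L..} W g0 g0'"
proof -
  have e: "((\<lambda>x. exp (- (y x)\<^sup>2 / 2)) has_real_derivative - y x * exp (- (y x)\<^sup>2 / 2)) (at x within S)" for x S
    by (rule derivative_eq_intros y_deriv refl | simp)+
  show ?thesis
    unfolding ode2_def
  proof (intro ballI conjI)
    fix x
    show "(g0 has_real_derivative g0' x) (at x within {L..})"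
      unfolding g0_def g0'_def
      by (rule derivative_eq_intros y_deriv e refl)+ (simp add: algebra_simps power2_eq_square)
    show "(g0' has_real_derivative W x * g0 x) (at x within {L..})"
      unfolding g0_def g0'_def W_def
      by (rule derivative_eq_intros y_deriv e refl)+ (simp add: algebra_simps power2_eq_square)
  qed
qed

lemma g0_ratio: "x \<ge> L \<Longrightarrow> g0' x / g0 x = 1 / y x - y x"
  using y_pos[of x] by (simp add: g0_def g0'_def field_simps power2_eq_square)

text \<open>Compared with \<open>g0\<close>, Picone's quantity does not decrease when
  \<open>\<beta> \<le> 0\<close>. If it were positive anywhere, it would stay above some
  \<open>\<delta> > 0\<close>, and then \<open>g\<close> would decay too slowly for its weighted
  integral to be finite.\<close>

lemma half_line_ratio:
  assumes g: "ode2 {L..} (\<lambda>x. W x - \<beta>) g g'" and \<beta>: "\<beta> \<le> 0"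
    and int: "integrable (lebesgue_on {L<..}) (\<lambda>x. x ^ 4 * (g x)\<^sup>2)" and x: "x \<ge> L"
  shows "g x * g' x \<le> (g x)\<^sup>2 * (1 / y x - y x)"
proof (rule ccontr)
  define Y where "Y = (\<lambda>x. g x * g' x - (g x)\<^sup>2 * g0' x / g0 x)"
  have YD: "(Y has_real_derivative (g' t - g t * g0' t / g0 t)\<^sup>2 + - \<beta> * (g t)\<^sup>2) (at t within {L..})"
    if "t \<in> {L..}" for t
    unfolding Y_def by (rule picone_deriv[OF g0_ode g]) (use that g0_pos in auto)
  have Yeq: "Y t = g t * g' t - (g t)\<^sup>2 * (1 / y t - y t)" if "t \<ge> L" for t
    using g0_ratio[OF that] by (simp add: Y_def flip: times_divide_eq_right)
  assume "\<not> ?thesis"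
  then have Yx: "Y x > 0" using Yeq[OF x] by simp
  define \<delta> where "\<delta> = Y x"
  have Ymono: "\<delta> \<le> Y t" if "t \<ge> x" for t
    unfolding \<delta>_def
  proof (rule nonneg_deriv_mono[where f = Y and T = "{L..}", OF _ _ _ that YD])
    show "0 \<le> (g' s - g s * g0' s / g0 s)\<^sup>2 + - \<beta> * (g s)\<^sup>2" for s
      using \<beta> by (intro add_nonneg_nonneg mult_nonneg_nonneg) auto
  qed (use x that in \<open>auto simp: is_interval_ci\<close>)
  \<comment> \<open>\<open>exp (y\<^sup>2)\<close> is the integrating factor of
    \<open>(g\<^sup>2)' + 2 * y * g\<^sup>2 \<ge> 2 * \<delta>\<close>. The correction
    \<open>\<delta> / (2 * y)\<close> uses up one \<open>\<delta>\<close> and leaves slope at least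
    \<open>\<delta>\<close> for \<open>h\<close>.\<close>
  define h where "h = (\<lambda>t. ((g t)\<^sup>2 - \<delta> / 2 / y t) * exp ((y t)\<^sup>2))"
  have hmono: "h x + \<delta> * (t - x) \<le> h t" if t: "t \<ge> x" for t
  proof -
    have "h x - \<delta> * x \<le> h t - \<delta> * t"
    proof (rule nonneg_deriv_mono[where f = "\<lambda>t. h t - \<delta> * t" and T = "{L..}", OF _ _ _ t])
      fix s assume s: "s \<in> {L..}"
      have ys: "y s > 0" using y_pos s by simp
      show "((\<lambda>t. h t - \<delta> * t) has_real_derivative
         (2 * (g s * g' s) + \<delta> / 2 / (y s)\<^sup>2 + 2 * y s * ((g s)\<^sup>2 - \<delta> / 2 / y s)) * exp ((y s)\<^sup>2) - \<delta>)
        (at s within {L..})"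
        unfolding h_def
        by (rule derivative_eq_intros ode2D[OF g s] y_deriv refl | use ys in \<open>simp add: algebra_simps power2_eq_square\<close>)+
      assume sx: "x < s"
      have "\<delta> \<le> 2 * (g s * g' s) + \<delta> / 2 / (y s)\<^sup>2 + 2 * y s * ((g s)\<^sup>2 - \<delta> / 2 / y s)"
      proof -
        have 1: "2 * (g s * g' s) = 2 * Y s + 2 * ((g s)\<^sup>2 / y s) - 2 * y s * (g s)\<^sup>2"
          using Yeq[of s] s by (simp add: algebra_simps)
        have 2: "2 * y s * ((g s)\<^sup>2 - \<delta> / 2 / y s) = 2 * y s * (g s)\<^sup>2 - \<delta>"
          using ys by (simp add: field_simps)
        have "0 \<le> (g s)\<^sup>2 / y s" "0 \<le> \<delta> / 2 / (y s)\<^sup>2" using ys Yx by (auto simp: \<delta>_def)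
        then show ?thesis using Ymono[of s] sx unfolding 1 2 by linarith
      qed
      also have "\<dots> \<le> \<dots> * exp ((y s)\<^sup>2)"
        using calculation Yx by (intro mult_le_cancel_left1[THEN iffD2]) (auto simp: \<delta>_def)
      finally show "0 \<le> (2 * (g s * g' s) + \<delta> / 2 / (y s)\<^sup>2 + 2 * y s * ((g s)\<^sup>2 - \<delta> / 2 / y s)) * exp ((y s)\<^sup>2) - \<delta>"
        by simp
    qed (use x t in \<open>auto simp: is_interval_ci\<close>)
    then show ?thesis by (simp add: algebra_simps)
  qed
  define X where "X = max 1 (x + \<bar>h x\<bar> / \<delta>)"
  have \<delta>: "\<delta> > 0" using Yx by (simp add: \<delta>_def)
  \<comment> \<open>Once \<open>h\<close> is nonnegative, \<open>(g t)\<^sup>2\<close> is at least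
    \<open>\<delta> / (2 * y t)\<close>. As \<open>y t \<le> t ^ 4 * (1 + a)\<close> for
    \<open>t \<ge> 1\<close>, the weight turns this into a constant lower bound.\<close>
  have "\<delta> / (2 * (1 + a)) \<le> 0"
  proof (rule integrable_half_line_lower_bound[OF int, of X])
    fix t assume t: "t > L" "t \<ge> X"
    have t1: "t \<ge> 1" and tx: "t \<ge> x" and "\<bar>h x\<bar> / \<delta> \<le> t - x"
      using t(2) \<delta> by (auto simp: X_def add_increasing2) (smt (verit) divide_nonneg_pos)
    then have "\<bar>h x\<bar> \<le> \<delta> * (t - x)" using \<delta> by (simp add: pos_divide_le_eq mult.commute)
    then have "0 \<le> h t" using hmono[OF tx] by linarith
    then have lo: "\<delta> / 2 / y t \<le> (g t)\<^sup>2" by (simp add: h_def zero_le_mult_iff)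
    have yt: "y t > 0" using y_pos t by simp
    have "y t \<le> t * (1 + a)"
      using t1 a_pos L_pos by (simp add: y_def algebra_simps add_increasing mult_le_cancel_right1)
    also have "\<dots> \<le> t ^ 4 * (1 + a)"
      using power_increasing[of 1 4 t] t1 a_pos by (intro mult_right_mono) auto
    finally have "1 / (1 + a) \<le> t ^ 4 / y t"
      using yt a_pos by (simp add: field_simps)
    then have "\<delta> / 2 * (1 / (1 + a)) \<le> \<delta> / 2 * (t ^ 4 / y t)"
      using \<delta> by (intro mult_left_mono) auto
    then have "\<delta> / (2 * (1 + a)) \<le> t ^ 4 * (\<delta> / 2 / y t)"
      by (simp add: mult.commute)
    also have "\<dots> \<le> t ^ 4 * (g t)\<^sup>2" using lo by (intro mult_left_mono) auto
    finally show "\<delta> / (2 * (1 + a)) \<le> t ^ 4 * (g t)\<^sup>2" .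
  qed simp
  then show False using \<delta> a_pos by (simp add: divide_le_0_iff)
qed

text \<open>By the ratio bound \<open>(g / g0)\<^sup>2\<close> does not increase, so a zero persists
  to the right, and a nontrivial solution cannot vanish on an interval.\<close>

lemma half_line_zero:
  assumes g: "ode2 {L..} (\<lambda>x. W x - \<beta>) g g'" and \<beta>: "\<beta> \<le> 0"
    and int: "integrable (lebesgue_on {L<..}) (\<lambda>x. x ^ 4 * (g x)\<^sup>2)"
    and z: "z \<ge> L" "g z = 0" and x: "x \<ge> L"
  shows "g x = 0 \<and> g' x = 0"
proof -
  have zero: "g t = 0" if t: "t \<ge> z" for t
  proof -
    have "- ((g z)\<^sup>2 / (g0 z)\<^sup>2) \<le> - ((g t)\<^sup>2 / (g0 t)\<^sup>2)"
    proof (rule nonneg_deriv_mono[where f = "\<lambda>t. - ((g t)\<^sup>2 / (g0 t)\<^sup>2)" and T = "{L..}", OF _ _ _ t])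
      fix s assume s: "s \<in> {L..}"
      then have gs: "g0 s > 0" using g0_pos by simp
      show "((\<lambda>t. - ((g t)\<^sup>2 / (g0 t)\<^sup>2)) has_real_derivative
          - (2 * (g s * g' s - (g s)\<^sup>2 * g0' s / g0 s) / (g0 s)\<^sup>2)) (at s within {L..})"
        by (rule DERIV_minus[OF quotient_square_deriv[OF g0_ode g s gs]])
      have "g s * g' s - (g s)\<^sup>2 * g0' s / g0 s \<le> 0"
        using half_line_ratio[OF g \<beta> int, of s] g0_ratio[of s] s by (simp flip: times_divide_eq_right)
      then show "0 \<le> - (2 * (g s * g' s - (g s)\<^sup>2 * g0' s / g0 s) / (g0 s)\<^sup>2)"
        by (simp add: divide_nonpos_nonneg)
    qed (use z t in \<open>auto simp: is_interval_ci\<close>)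
    then have "(g t)\<^sup>2 / (g0 t)\<^sup>2 \<le> 0" using z by simp
    moreover have "g0 t > 0" using g0_pos t z by simp
    ultimately show ?thesis by (simp add: divide_le_0_iff)
  qed
  \<comment> \<open>\<open>z\<close> may be the vertex itself; at \<open>z + 1\<close> the solution
    vanishes on a full neighbourhood, so its derivative is zero too.\<close>
  have zz: "z + 1 \<in> {L..}" using z by simp
  have "(g has_real_derivative g' (z + 1)) (at (z + 1) within {z..z+2})"
    by (rule DERIV_subset[OF ode2D(1)[OF g zz]]) (use z in auto)
  then have "(g has_real_derivative g' (z + 1)) (at (z + 1))" by (simp add: at_within_Icc_at)
  moreover have "(g has_real_derivative 0) (at (z + 1))"
    by (rule has_field_derivative_transform_within_open[of "\<lambda>_. 0" _ _ "{z<..}"]) (use zero in auto)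
  ultimately have g1: "g' (z + 1) = 0" by (rule DERIV_unique)
  have c: "continuous_on {L..} (\<lambda>x. W x - \<beta>)" by (intro continuous_intros W_continuous)
  show ?thesis
    using ode2_double_zero[OF is_interval_ci c g zz zero g1, of x] x by simp
qed

text \<open>No decay is demanded, so such a pair exists for every \<open>\<beta>\<close>. The factor
  \<open>2\<close> is the Kirchhoff condition for the even extension of \<open>u\<close>, whose
  slopes at the two ends of the ring are opposite.\<close>

definition shoots where
  "shoots \<beta> u u' g g' \<longleftrightarrow> ode2 {0..L} (\<lambda>x. V x - \<beta>) u u' \<and> u 0 = 1 \<and> u' 0 = 0 \<and>
     ode2 {L..} (\<lambda>x. W x - \<beta>) g g' \<and> g L = u L \<and> g' L = 2 * u' L"

lemma shootsD:
  assumes "shoots \<beta> u u' g g'"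
  shows "ode2 {0..L} (\<lambda>x. V x - \<beta>) u u'" "u 0 = 1" "u' 0 = 0"
    "ode2 {L..} (\<lambda>x. W x - \<beta>) g g'" "g L = u L" "g' L = 2 * u' L"
  using assms by (auto simp: shoots_def)

lemma V\<beta>_continuous: "continuous_on {0..L} (\<lambda>x. V x - \<beta>)"
  by (intro continuous_intros continuous_on_subset[OF V_continuous half_subset])

lemma W\<beta>_continuous: "continuous_on A (\<lambda>x. W x - \<beta>)"
  by (intro continuous_intros W_continuous)

lemma shoots_exists: "\<exists>u u' g g'. shoots \<beta> u u' g g'"
proof -
  \<comment> \<open>The existence result is for half-lines, hence the potential is continued by its
    value at \<open>L\<close>.\<close>
  have "continuous_on {0..} (\<lambda>x. V (min x L) - \<beta>)"
    by (intro continuous_intros continuous_on_compose2[OF V_continuous]) (use L_pos in auto)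
  then obtain u u' where u: "ode2 {0..} (\<lambda>x. V (min x L) - \<beta>) u u'" "u 0 = 1" "u' 0 = 0"
    by (rule ode2_exists[of 0])
  have u2: "ode2 {0..L} (\<lambda>x. V x - \<beta>) u u'"
    by (rule ode2_cong[OF ode2_subset[OF u(1)]]) auto
  obtain g g' where "ode2 {L..} (\<lambda>x. W x - \<beta>) g g'" "g L = u L" "g' L = 2 * u' L"
    by (rule ode2_exists[OF W\<beta>_continuous])
  then show ?thesis using u2 u(2,3) unfolding shoots_def by blast
qed

lemma shoots_nontrivial:
  assumes "shoots \<beta> u u' g g'" shows "\<not> (z \<in> {0..L} \<and> u z = 0 \<and> u' z = 0)"
  using ode2_double_zero(1)[OF is_interval_cc V\<beta>_continuous shootsD(1)[OF assms], of z 0] L_pos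
    shootsD(2)[OF assms] by auto

lemma half_slope_ode: "ode2 {0..L} V (\<lambda>x. - \<phi>' x) (\<lambda>x. - \<phi>'' x)"
  using ode2_subset[OF slope_ode half_subset] unfolding ode2_def
  by (auto intro!: derivative_eq_intros)

text \<open>Comparison with \<open>- \<phi>'\<close>, which is positive on the ring to the right of
  its zero at \<open>0\<close>: an even solution changes sign at most once.\<close>

lemma even_no_return:
  assumes f: "ode2 {0..L} (\<lambda>x. V x - \<beta>) f f'" and "\<beta> \<le> 0" "0 < z" "f z = 0" "f' z < 0" "z < x" "x \<le> L"
  shows "f x < 0"
  by (rule sturm_no_return[OF half_slope_ode _ f, of "- \<beta>" z x])
    (use assms slope_neg in auto)

lemma shoots_first_zero:
  assumes s: "shoots \<beta> u u' g g'" and \<beta>: "\<beta> \<le> 0" and x: "x \<in> {0..L}" "u x \<le> 0"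
  obtains z where "0 < z" "z \<le> x" "u z = 0" "u' z < 0" "\<And>t. 0 \<le> t \<Longrightarrow> t < z \<Longrightarrow> u t > 0"
    "\<And>t. z < t \<Longrightarrow> t \<le> L \<Longrightarrow> u t < 0"
proof -
  note S = shootsD[OF s]
  obtain z where z: "0 < z" "z \<le> x" "u z = 0" "\<And>t. 0 \<le> t \<Longrightarrow> t < z \<Longrightarrow> u t > 0"
    by (rule first_zero[OF ode2_continuous(1)[OF S(1)] _ x]) (use S in auto)
  have zi: "z \<in> {0..L}" using z x by auto
  have "u' z \<le> 0"
    by (rule deriv_nonpos_if_nonneg_left[OF ode2D(1)[OF S(1) zi]]) (use z zi in \<open>auto simp: less_imp_le\<close>)
  then have u'z: "u' z < 0" using shoots_nontrivial[OF s, of z] z(3) zi by auto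
  show ?thesis
    by (rule that[OF z(1-3) u'z z(4)]) (use even_no_return[OF S(1) \<beta> z(1,3) u'z] in auto)
qed

text \<open>The vertex condition gives \<open>\<phi>'' L = 4 * \<phi>' L * m\<close>, so the
  inequality factors through \<open>\<phi>' L < 0\<close>. The constant \<open>m\<close> is half the
  logarithmic derivative of \<open>g0\<close> at \<open>L\<close>.\<close>

lemma vertex_nondegenerate':
  assumes "shoots 0 p p' g g'"
  shows "p' L < (1 / a - a) / 2 * p L"
proof -
  define m where "m = (1 / a - a) / 2"
  have "0 < 4 * \<phi>' L * p' L - \<phi>'' L * p L"
    using vertex_nondegenerate[of p p'] shootsD(1-3)[OF assms] by simp
  moreover have "\<phi>'' L = 4 * \<phi>' L * m"
  proof -
    have "4 * \<phi>' L * m = 2 * (2 * \<phi>' L) * m" by simp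
    also have "\<dots> = 2 * (- a * \<phi> L) * m" by (simp only: vertex)
    also have "\<dots> = (a\<^sup>2 - 1) * \<phi> L" using a_pos by (simp add: m_def field_simps power2_eq_square)
    finally show ?thesis using \<phi>''_L by simp
  qed
  ultimately have "0 < 4 * \<phi>' L * (p' L - m * p L)" by (simp add: algebra_simps)
  then show ?thesis using slope_L_neg by (simp add: zero_less_mult_iff m_def)
qed

text \<open>If \<open>u\<close> had a zero, the even solution \<open>p\<close> at
  \<open>\<beta> = 0\<close> would have one no later, and comparing the two past these zeros would
  reverse the vertex inequality for \<open>p\<close>. On the half-line a zero would make
  \<open>g\<close> vanish identically.\<close>

lemma eigen_positive:
  assumes s: "shoots \<beta> u u' g g'" and \<beta>: "\<beta> \<le> 0"
    and int: "integrable (lebesgue_on {L<..}) (\<lambda>x. x ^ 4 * (g x)\<^sup>2)"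
  shows "(\<forall>x\<in>{0..L}. u x > 0) \<and> (\<forall>x\<ge>L. g x > 0)"
proof -
  note S = shootsD[OF s]
  have Li: "L \<in> {0..L}" using L_pos by simp
  have gnz: "g x \<noteq> 0" if "x \<ge> L" for x
    using half_line_zero[OF S(4) \<beta> int that, of L] shoots_nontrivial[OF s, of L] Li S(5,6) by auto
  have upos: "u x > 0" if x: "x \<in> {0..L}" for x
  proof (rule ccontr)
    assume "\<not> u x > 0"
    then obtain z where z: "0 < z" "z \<le> x" "u z = 0" "u' z < 0" "\<And>t. 0 \<le> t \<Longrightarrow> t < z \<Longrightarrow> u t > 0"
      "\<And>t. z < t \<Longrightarrow> t \<le> L \<Longrightarrow> u t < 0"
      using shoots_first_zero[OF s \<beta> x] by (metis linorder_not_less)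
    have "z \<noteq> L" using gnz[of L] S(5) z(3) by auto
    then have zL: "z < L" using z x by auto
    then have zi: "z \<in> {0..L}" using z by simp
    have uL: "u L < 0" using z(6) zL by simp
    obtain p p' h h' where p: "shoots 0 p p' h h'" using shoots_exists by blast
    note P = shootsD[OF p]
    have D: "((\<lambda>x. u' x * p x - u x * p' x) has_real_derivative - \<beta> * u t * p t) (at t within {0..L})"
      if "t \<in> {0..L}" for t
      using ode2_wronskian[OF S(1) P(1) that] by simp
    \<comment> \<open>Otherwise the Wronskian of \<open>u\<close> and \<open>p\<close>, zero at
      \<open>0\<close>, would not decrease up to \<open>z\<close>, where it equals
      \<open>u' z * p z < 0\<close>.\<close>
    have "\<exists>r\<in>{0..z}. p r \<le> 0"
    proof (rule ccontr)
      assume "\<not> ?thesis"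
      then have pp: "p r > 0" if "r \<in> {0..z}" for r using that by force
      have "u' 0 * p 0 - u 0 * p' 0 \<le> u' z * p z - u z * p' z"
        by (rule nonneg_deriv_mono[where f = "\<lambda>x. u' x * p x - u x * p' x", OF _ _ zi _ D])
          (use z pp \<beta> L_pos in \<open>auto simp: is_interval_cc less_imp_le mult_nonpos_nonneg intro!: mult_nonpos_nonneg[OF mult_nonpos_nonneg]\<close>)
      then have "0 \<le> u' z * p z" using S P z by simp
      then show False using z(1,4) pp[of z] by (simp add: zero_le_mult_iff)
    qed
    then obtain r where r: "r \<in> {0..z}" "p r \<le> 0" by blast
    have rL: "r \<in> {0..L}" using r zL by auto
    obtain z1 where z1: "0 < z1" "z1 \<le> r" "p z1 = 0" "\<And>t. z1 < t \<Longrightarrow> t \<le> L \<Longrightarrow> p t < 0"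
      using shoots_first_zero[OF p order_refl rL r(2)] by metis
    have pneg: "p t \<le> 0" if "z \<le> t" "t \<le> L" for t
      using z1 r that by (cases "t = z1") (auto simp: less_imp_le)
    have "u' z * p z - u z * p' z \<le> u' L * p L - u L * p' L"
    proof (rule nonneg_deriv_mono[where f = "\<lambda>x. u' x * p x - u x * p' x", OF _ zi Li _ D])
      fix t assume t: "z < t" "t < L"
      have "0 \<le> u t * p t" using z(6)[of t] pneg[of t] t by (simp add: mult_nonpos_nonpos)
      then have "0 \<le> - \<beta> * (u t * p t)" by (rule mult_nonneg_nonneg[rotated]) (use \<beta> in simp)
      then show "0 \<le> - \<beta> * u t * p t" by (simp add: mult.assoc)
    qed (use zL in \<open>auto simp: is_interval_cc\<close>)
    moreover have "0 \<le> u' z * p z" using z(4) pneg[of z] zL by (simp add: mult_nonpos_nonpos)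
    ultimately have DL: "u L * p' L \<le> u' L * p L" using z(3) by simp
    \<comment> \<open>Since \<open>u L < 0\<close> and \<open>p L \<le> 0\<close>, dividing by these
      values reverses the inequalities: the half-line bound for \<open>u\<close> and the Wronskian
      bound \<open>DL\<close> combine to \<open>m * p L \<le> p' L\<close>.\<close>
    define m where "m = (1 / a - a) / 2"
    have "u L * (2 * u' L) \<le> (u L)\<^sup>2 * (1 / a - a)"
      using half_line_ratio[OF S(4) \<beta> int, of L] S(5,6) by (simp add: y_def)
    then have "u L * u' L \<le> u L * (m * u L)" by (simp add: m_def power2_eq_square field_simps)
    then have "m * u L \<le> u' L" using uL by (simp add: mult_le_cancel_left)
    then have "u' L * p L \<le> m * u L * p L" using pneg[of L] zL by (intro mult_right_mono_neg) auto
    then have "u L * p' L \<le> u L * (m * p L)" using DL by (simp add: mult_ac)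
    then have "m * p L \<le> p' L" using uL by (simp add: mult_le_cancel_left)
    then show False using vertex_nondegenerate'[OF p] by (simp add: m_def)
  qed
  have gpos: "g x > 0" if x: "x \<ge> L" for x
  proof (rule ccontr)
    assume "\<not> g x > 0"
    have "continuous_on {L..x} g" by (rule continuous_on_subset[OF ode2_continuous(1)[OF S(4)]]) auto
    then obtain t where "L \<le> t" "t \<le> x" "g t = 0"
      using IVT2'[of g x 0 L] \<open>\<not> g x > 0\<close> upos[OF Li] S(5) x by auto
    then show False using gnz by simp
  qed
  show ?thesis using upos gpos by blast
qed

text \<open>The Wronskian with \<open>g0\<close> is a constant \<open>C\<close>, negative by the
  vertex inequality. As \<open>g0\<^sup>2 \<le> 1\<close>, the quotient \<open>g / g0\<close>
  decreases at least at rate \<open>- C\<close> and must become negative.\<close>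

lemma shoots_zero_not_positive:
  assumes s: "shoots 0 p p' g g'"
  obtains x where "x \<ge> L" "g x < 0"
proof -
  note S = shootsD[OF s]
  define C where "C = (2 * p' L - (1 / a - a) * p L) * g0 L"
  have C: "C < 0" using vertex_nondegenerate'[OF s] g0_pos[of L] unfolding C_def
    by (intro mult_neg_pos) (auto simp: field_simps)
  have "((\<lambda>x. g' x * g0 x - g x * g0' x) has_real_derivative 0) (at x within {L..})" if "x \<in> {L..}" for x
    using ode2_wronskian[OF S(4) g0_ode that] by simp
  then have "\<exists>k. \<forall>x\<in>{L..}. g' x * g0 x - g x * g0' x = k"
    by (intro has_field_derivative_zero_constant convex_real_interval) auto
  moreover have "g' L * g0 L - g L * g0' L = C"
  proof -
    have e: "g0' L = (1 / a - a) * g0 L"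
      using g0_ratio[of L] g0_pos[of L] by (simp add: y_def divide_eq_eq)
    show ?thesis unfolding C_def S(5,6) e by (simp add: algebra_simps)
  qed
  ultimately have Wr: "g' x * g0 x - g x * g0' x = C" if "x \<ge> L" for x using that by auto
  have le: "g x / g0 x \<le> g L / g0 L + C * (x - L)" if x: "x \<ge> L" for x
  proof -
    have "C * L - g L / g0 L \<le> C * x - g x / g0 x"
    proof (rule nonneg_deriv_mono[where f = "\<lambda>x. C * x - g x / g0 x" and T = "{L..}", OF _ _ _ x])
      fix t assume t: "t \<in> {L..}"
      have gt: "g0 t > 0" using g0_pos t by simp
      have "((\<lambda>x. C * x - g x / g0 x) has_real_derivative
         C - (g' t * g0 t - g t * g0' t) / (g0 t * g0 t)) (at t within {L..})"
        by (rule derivative_eq_intros ode2D[OF S(4) t] ode2D[OF g0_ode t] refl | use gt in simp)+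
      then show "((\<lambda>x. C * x - g x / g0 x) has_real_derivative C - C / (g0 t * g0 t)) (at t within {L..})"
        using Wr t by simp
      have "(y t)\<^sup>2 \<le> exp ((y t)\<^sup>2)" using exp_ge_add_one_self[of "(y t)\<^sup>2"] by linarith
      then have "(y t)\<^sup>2 * exp (- (y t)\<^sup>2) \<le> 1" by (simp add: exp_minus field_simps)
      moreover have "g0 t * g0 t = (y t)\<^sup>2 * exp (- (y t)\<^sup>2)"
        by (simp add: g0_def power2_eq_square flip: exp_add)
      ultimately have "g0 t * g0 t \<le> 1" by simp
      then show "0 \<le> C - C / (g0 t * g0 t)" using C gt by (simp add: field_simps mult_le_cancel_left2)
    qed (use x in \<open>auto simp: is_interval_ci\<close>)
    then show ?thesis by (simp add: algebra_simps)
  qed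
  define x where "x = L + (\<bar>g L / g0 L\<bar> + 1) / (- C)"
  have "0 \<le> (\<bar>g L / g0 L\<bar> + 1) / (- C)" using C by (intro divide_nonneg_pos) auto
  then have x: "x \<ge> L" by (simp add: x_def)
  have "C * (x - L) = - (\<bar>g L / g0 L\<bar> + 1)" using C by (simp add: x_def)
  then have "g x / g0 x \<le> g L / g0 L - (\<bar>g L / g0 L\<bar> + 1)" using le[OF x] by linarith
  also have "\<dots> < 0" using abs_ge_self[of "g L / g0 L"] by linarith
  finally have "g x < 0" using g0_pos[OF x] by (simp add: divide_less_0_iff)
  then show ?thesis using that x by blast
qed

end

lemma deriv_nonneg_if_nonneg_right:
  fixes f :: "real \<Rightarrow> real"
  assumes "(f has_real_derivative D) (at z within S)" "z < b" "{z..b} \<subseteq> S" "f z = 0"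
    "\<And>t. z < t \<Longrightarrow> t \<le> b \<Longrightarrow> f t \<ge> 0"
  shows "D \<ge> 0"
proof (rule ccontr)
  assume "\<not> D \<ge> 0"
  then obtain d where d: "d > 0" "\<And>h. 0 < h \<Longrightarrow> z + h \<in> S \<Longrightarrow> h < d \<Longrightarrow> f (z + h) < f z"
    using has_real_derivative_neg_dec_right[OF assms(1)] by auto
  define h where "h = min d (b - z) / 2"
  have h: "0 < h" "h < d" "z + h \<le> b" using d assms(2) by (auto simp: h_def min_def field_simps)
  then have "z + h \<in> S" using assms(3) by auto
  then show False using d(2)[of h] h assms(4) assms(5)[of "z + h"] by simp
qed

lemma exp_bound_extend:
  fixes h :: "real \<Rightarrow> real"
  assumes h: "continuous_on {L..} h" and C: "\<And>x. x \<ge> X \<Longrightarrow> \<bar>h x\<bar> \<le> C * exp (- x)"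
  obtains C' where "\<And>x. x \<ge> L \<Longrightarrow> \<bar>h x\<bar> \<le> C' * exp (- x)"
proof -
  have "continuous_on {L..X} h" using h by (rule continuous_on_subset) auto
  then obtain B where B: "B \<ge> 0" "\<And>x. x \<in> {L..X} \<Longrightarrow> \<bar>h x\<bar> \<le> B"
    using continuous_on_Icc_bounded by metis
  have "\<bar>h x\<bar> \<le> max C (B * exp X) * exp (- x)" if x: "x \<ge> L" for x
  proof (cases "x \<ge> X")
    case True
    have "\<bar>h x\<bar> \<le> C * exp (- x)" by (rule C[OF True])
    also have "\<dots> \<le> max C (B * exp X) * exp (- x)" by (intro mult_right_mono) auto
    finally show ?thesis .
  next
    case False
    have "\<bar>h x\<bar> \<le> B * 1" using B(2)[of x] x False by simp
    also have "\<dots> \<le> B * (exp X * exp (- x))"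
      using False B(1) by (intro mult_left_mono) (auto simp flip: exp_add)
    also have "\<dots> = (B * exp X) * exp (- x)" by simp
    also have "\<dots> \<le> max C (B * exp X) * exp (- x)" by (intro mult_right_mono) auto
    finally show ?thesis .
  qed
  then show ?thesis using that by blast
qed

section \<open>Existence and uniqueness of the non-positive eigenvalue\<close>

context log_lobe
begin

lemma W_ge_1: "x \<ge> L + 2 \<Longrightarrow> \<beta> \<le> 0 \<Longrightarrow> 1 \<le> W x - \<beta>"
proof -
  assume x: "x \<ge> L + 2" and \<beta>: "\<beta> \<le> 0"
  have "2\<^sup>2 \<le> (y x)\<^sup>2" using x a_pos by (intro power_mono) (auto simp: y_def)
  then show "1 \<le> W x - \<beta>" using \<beta> by (simp add: W_def)
qed

lemma shoots_continuous_dependence: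
  assumes s: "shoots \<beta>0 u u' g g'" and b: "b \<ge> L" and e: "e > 0"
  obtains \<eta> where "\<eta> > 0" "\<And>\<beta> v v' h h'. \<bar>\<beta> - \<beta>0\<bar> < \<eta> \<Longrightarrow> shoots \<beta> v v' h h' \<Longrightarrow>
    (\<forall>x\<in>{0..L}. \<bar>v x - u x\<bar> < e) \<and> (\<forall>x\<in>{L..b}. \<bar>h x - g x\<bar> < e \<and> \<bar>h' x - g' x\<bar> < e)"
proof -
  note S = shootsD[OF s]
  have sub: "{L..b} \<subseteq> {L..}" by auto
  obtain \<eta>2 where \<eta>2: "\<eta>2 > 0" "\<And>\<delta> v v' x. \<lbrakk>\<bar>\<delta>\<bar> < \<eta>2; ode2 {L..b} (\<lambda>x. W x - \<beta>0 + \<delta>) v v';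
     \<bar>v L - g L\<bar> < \<eta>2; \<bar>v' L - g' L\<bar> < \<eta>2; x \<in> {L..b}\<rbrakk> \<Longrightarrow> \<bar>v x - g x\<bar> < e \<and> \<bar>v' x - g' x\<bar> < e"
    using ode2_continuous_dependence[OF b W\<beta>_continuous ode2_subset[OF S(4) sub] e] by metis
  \<comment> \<open>The slope is doubled at the vertex, so half the tolerance of the half-line is
    demanded on the ring.\<close>
  define e1 where "e1 = min e (\<eta>2 / 2)"
  have e1: "e1 > 0" using e \<eta>2 by (simp add: e1_def)
  have L0: "0 \<le> L" using L_pos by simp
  obtain \<eta>1 where \<eta>1: "\<eta>1 > 0" "\<And>\<delta> v v' x. \<lbrakk>\<bar>\<delta>\<bar> < \<eta>1; ode2 {0..L} (\<lambda>x. V x - \<beta>0 + \<delta>) v v';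
     \<bar>v 0 - u 0\<bar> < \<eta>1; \<bar>v' 0 - u' 0\<bar> < \<eta>1; x \<in> {0..L}\<rbrakk> \<Longrightarrow> \<bar>v x - u x\<bar> < e1 \<and> \<bar>v' x - u' x\<bar> < e1"
    using ode2_continuous_dependence[OF L0 V\<beta>_continuous S(1) e1] by metis
  show ?thesis
  proof (rule that[of "min \<eta>1 \<eta>2"])
    show "min \<eta>1 \<eta>2 > 0" using \<eta>1 \<eta>2 by simp
    fix \<beta> v v' h h' assume \<beta>: "\<bar>\<beta> - \<beta>0\<bar> < min \<eta>1 \<eta>2" and sh: "shoots \<beta> v v' h h'"
    note T = shootsD[OF sh]
    have v: "\<bar>v x - u x\<bar> < e1 \<and> \<bar>v' x - u' x\<bar> < e1" if "x \<in> {0..L}" for x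
    proof (rule \<eta>1(2)[OF _ _ _ _ that])
      show "\<bar>\<beta>0 - \<beta>\<bar> < \<eta>1" using \<beta> by (simp add: abs_minus_commute)
      show "ode2 {0..L} (\<lambda>x. V x - \<beta>0 + (\<beta>0 - \<beta>)) v v'" by (rule ode2_cong[OF T(1)]) simp
    qed (use S T \<eta>1 in auto)
    have vL: "\<bar>v L - u L\<bar> < \<eta>2 / 2" "\<bar>v' L - u' L\<bar> < \<eta>2 / 2" using v[of L] L0 by (auto simp: e1_def)
    have h: "\<bar>h x - g x\<bar> < e \<and> \<bar>h' x - g' x\<bar> < e" if "x \<in> {L..b}" for x
    proof (rule \<eta>2(2)[OF _ _ _ _ that])
      show "\<bar>\<beta>0 - \<beta>\<bar> < \<eta>2" using \<beta> by (simp add: abs_minus_commute)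
      show "ode2 {L..b} (\<lambda>x. W x - \<beta>0 + (\<beta>0 - \<beta>)) h h'"
        by (rule ode2_cong[OF ode2_subset[OF T(4) sub]]) simp
      show "\<bar>h L - g L\<bar> < \<eta>2" using vL \<eta>2(1) S(5) T(5) by simp
      show "\<bar>h' L - g' L\<bar> < \<eta>2" using vL unfolding S(6) T(6) by linarith
    qed
    show "(\<forall>x\<in>{0..L}. \<bar>v x - u x\<bar> < e) \<and> (\<forall>x\<in>{L..b}. \<bar>h x - g x\<bar> < e \<and> \<bar>h' x - g' x\<bar> < e)"
      using v h by (auto simp: e1_def)
  qed
qed

text \<open>A zero of a nonnegative solution is a double zero, which uniqueness excludes. At the
  vertex the sign of \<open>u' L\<close> from the right is taken from \<open>g\<close>, through
  \<open>g' L = 2 * u' L\<close>.\<close>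

lemma shoots_positive_if_nonneg:
  assumes s: "shoots \<beta> u u' g g'" and u: "\<And>x. x \<in> {0..L} \<Longrightarrow> u x \<ge> 0" and g: "\<And>x. x \<ge> L \<Longrightarrow> g x \<ge> 0"
  shows "(\<forall>x\<in>{0..L}. u x > 0) \<and> (\<forall>x\<ge>L. g x > 0)"
proof -
  note S = shootsD[OF s]
  have gL: "g' L \<ge> 0" if "g L = 0"
    by (rule deriv_nonneg_if_nonneg_right[OF ode2D(1)[OF S(4), of L], of "L + 1"]) (use that g in auto)
  have unz: "u z \<noteq> 0" if z: "z \<in> {0..L}" for z
  proof
    assume uz: "u z = 0"
    have z0: "0 < z" using uz z S(2) by (cases "z = 0") auto
    have "u' z \<le> 0"
      by (rule deriv_nonpos_if_nonneg_left[OF ode2D(1)[OF S(1) z] z0 _ uz]) (use z u in auto)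
    moreover have "u' z \<ge> 0"
    proof (cases "z = L")
      case True
      then show ?thesis using gL uz S(5,6) by simp
    next
      case False
      show ?thesis
        by (rule deriv_nonneg_if_nonneg_right[OF ode2D(1)[OF S(1) z], of L]) (use z u uz False in auto)
    qed
    ultimately show False using shoots_nontrivial[OF s, of z] z uz by auto
  qed
  have gnz: "g z \<noteq> 0" if z: "z \<ge> L" for z
  proof
    assume gz: "g z = 0"
    have zL: "L < z" using gz z unz[of L] S(5) L_pos by (cases "z = L") auto
    have zi: "z \<in> {L..}" using z by simp
    have "g' z \<le> 0"
      by (rule deriv_nonpos_if_nonneg_left[of g _ z L z])
        (use zL g gz DERIV_subset[OF ode2D(1)[OF S(4) zi], of "{L..z}"] in auto)
    moreover have "g' z \<ge> 0"
      by (rule deriv_nonneg_if_nonneg_right[OF ode2D(1)[OF S(4) zi], of "z + 1"]) (use zL g gz in auto)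
    ultimately have "g' z = 0" by simp
    from ode2_double_zero[OF is_interval_ci W\<beta>_continuous S(4) zi gz this, of L]
    show False using shoots_nontrivial[OF s, of L] S(5,6) L_pos by auto
  qed
  show ?thesis
    using u g unz gnz by (metis less_eq_real_def)
qed

text \<open>Beyond \<open>L + 2\<close> the potential is at least \<open>1\<close>, so a positive
  decreasing solution satisfies \<open>g + g' \<le> 0\<close> there, and \<open>g * exp x\<close>
  does not increase.\<close>

lemma positive_decay:
  assumes g: "ode2 {L..} (\<lambda>x. W x - \<beta>) g g'" and \<beta>: "\<beta> \<le> 0"
    and pos: "\<And>x. x \<ge> L \<Longrightarrow> g x > 0" and neg: "\<And>x. x \<ge> L + 2 \<Longrightarrow> g' x < 0"
  obtains C where "\<And>x. x \<ge> L \<Longrightarrow> \<bar>g x\<bar> \<le> C * exp (- x)" "\<And>x. x \<ge> L \<Longrightarrow> \<bar>g' x\<bar> \<le> C * exp (- x)"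
proof -
  define X where "X = L + 2"
  have sub: "{X..} \<subseteq> {L..}" by (auto simp: X_def)
  have D: "(g has_real_derivative g' x) (at x within {X..})"
    "(g' has_real_derivative (W x - \<beta>) * g x) (at x within {X..})" if "x \<in> {X..}" for x
    using ode2D[OF ode2_subset[OF g sub] that] .
  have gpp: "g x \<le> (W x - \<beta>) * g x" if "x \<ge> X" for x
    using mult_right_mono[OF W_ge_1[OF _ \<beta>], of x "g x"] pos[of x] that by (simp add: X_def)
  \<comment> \<open>\<open>(g + g') * exp (- x)\<close> does not decrease because
    \<open>g'' \<ge> g\<close>. If it were positive once, \<open>g\<close> would stay above
    \<open>\<sigma>\<close>, and then \<open>g'' \<ge> \<sigma>\<close> would drive the negative
    slope up to zero.\<close>
  have sneg: "g x + g' x \<le> 0" if x: "x \<ge> X" for x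
  proof (rule ccontr)
    assume "\<not> ?thesis"
    define \<sigma> where "\<sigma> = g x + g' x"
    have \<sigma>: "\<sigma> > 0" using \<open>\<not> _\<close> by (simp add: \<sigma>_def)
    have ge: "\<sigma> \<le> g t" if t: "t \<ge> x" for t
    proof -
      have "(g x + g' x) * exp (- x) \<le> (g t + g' t) * exp (- t)"
      proof (rule nonneg_deriv_mono[where f = "\<lambda>t. (g t + g' t) * exp (- t)" and T = "{X..}", OF _ _ _ t])
        fix r assume r: "r \<in> {X..}"
        show "((\<lambda>t. (g t + g' t) * exp (- t)) has_real_derivative ((W r - \<beta>) * g r - g r) * exp (- r)) (at r within {X..})"
          by (rule derivative_eq_intros D[OF r] refl)+ (simp add: algebra_simps)
        show "0 \<le> ((W r - \<beta>) * g r - g r) * exp (- r)" using gpp[of r] r by simp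
      qed (use x t in \<open>auto simp: is_interval_ci\<close>)
      then have "\<sigma> * exp (- x) * exp t \<le> g t + g' t"
        unfolding \<sigma>_def by (simp add: exp_minus field_simps)
      moreover have "\<sigma> * 1 \<le> \<sigma> * (exp (- x) * exp t)"
        using \<sigma> t by (intro mult_left_mono) (auto simp flip: exp_add)
      ultimately show ?thesis using neg[of t] x t by (simp add: X_def mult.assoc)
    qed
    define t where "t = x + \<bar>g' x\<bar> / \<sigma>"
    have t: "t \<ge> x" using \<sigma> by (simp add: t_def)
    have "g' x - \<sigma> * x \<le> g' t - \<sigma> * t"
    proof (rule nonneg_deriv_mono[where f = "\<lambda>t. g' t - \<sigma> * t" and T = "{X..}", OF _ _ _ t])
      fix r assume r: "r \<in> {X..}"
      show "((\<lambda>t. g' t - \<sigma> * t) has_real_derivative (W r - \<beta>) * g r - \<sigma>) (at r within {X..})"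
        by (rule derivative_eq_intros D[OF r] refl)+ simp
      assume "x < r" then show "0 \<le> (W r - \<beta>) * g r - \<sigma>" using gpp[of r] ge[of r] r by simp
    qed (use x t in \<open>auto simp: is_interval_ci\<close>)
    then have "g' x + \<sigma> * (t - x) \<le> g' t" by (simp add: algebra_simps)
    moreover have "\<sigma> * (t - x) = \<bar>g' x\<bar>" using \<sigma> by (simp add: t_def)
    ultimately show False using neg[of t] x t by (simp add: X_def)
  qed
  have bd1: "\<bar>g x\<bar> \<le> g X * exp X * exp (- x)" if x: "x \<ge> X" for x
  proof -
    have "- (g X * exp X) \<le> - (g x * exp x)"
    proof (rule nonneg_deriv_mono[where f = "\<lambda>t. - (g t * exp t)" and T = "{X..}", OF _ _ _ x])
      fix r assume r: "r \<in> {X..}"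
      show "((\<lambda>t. - (g t * exp t)) has_real_derivative - ((g r + g' r) * exp r)) (at r within {X..})"
        by (rule derivative_eq_intros D[OF r] refl)+ (simp add: algebra_simps)
      show "0 \<le> - ((g r + g' r) * exp r)" using sneg[of r] r by (simp add: mult_nonpos_nonneg)
    qed (use x in \<open>auto simp: is_interval_ci\<close>)
    then have "g x * exp x * exp (- x) \<le> g X * exp X * exp (- x)" by (intro mult_right_mono) auto
    moreover have "g x * exp x * exp (- x) = g x" by (simp add: mult.assoc flip: exp_add)
    moreover have "\<bar>g x\<bar> = g x" using pos[of x] x by (simp add: X_def)
    ultimately show ?thesis by linarith
  qed
  obtain C1 where C1: "\<And>x. x \<ge> L \<Longrightarrow> \<bar>g x\<bar> \<le> C1 * exp (- x)"
    using exp_bound_extend[OF ode2_continuous(1)[OF g] bd1] by metis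
  \<comment> \<open>By convexity the slope at \<open>x\<close> is at least the average slope over
    \<open>{x - 1..x}\<close>, so the bound for \<open>g\<close> carries over with the extra factor
    \<open>exp 1\<close>.\<close>
  have bd2: "\<bar>g' x\<bar> \<le> C1 * exp 1 * exp (- x)" if x: "x \<ge> X + 1" for x
  proof -
    have "- (g (x - 1) - g' x * (x - 1)) \<le> - (g x - g' x * x)"
    proof (rule nonneg_deriv_mono[where f = "\<lambda>t. - (g t - g' x * t)" and T = "{X..}"])
      fix r assume r: "r \<in> {X..}"
      show "((\<lambda>t. - (g t - g' x * t)) has_real_derivative g' x - g' r) (at r within {X..})"
        by (rule derivative_eq_intros D[OF r] refl)+ simp
      assume rx: "r < x"
      have "g' r \<le> g' x"
      proof (rule nonneg_deriv_mono[where f = g' and T = "{X..}", OF is_interval_ci r _ _ D(2)])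
        fix t assume "t \<in> {X..}"
        then show "0 \<le> (W t - \<beta>) * g t" using gpp[of t] pos[of t] sub by force
      qed (use rx x in auto)
      then show "0 \<le> g' x - g' r" by simp
    qed (use x in \<open>auto simp: is_interval_ci\<close>)
    then have "- g' x \<le> g (x - 1) - g x" by (simp add: algebra_simps)
    also have "\<dots> \<le> g (x - 1)" using pos[of x] x by (simp add: X_def)
    also have "\<dots> \<le> C1 * exp (- (x - 1))" using C1[of "x - 1"] x by (simp add: X_def)
    also have "\<dots> = C1 * exp 1 * exp (- x)" by (simp flip: exp_add)
    finally show ?thesis using neg[of x] x by (simp add: X_def)
  qed
  obtain C2 where C2: "\<And>x. x \<ge> L \<Longrightarrow> \<bar>g' x\<bar> \<le> C2 * exp (- x)"
    using exp_bound_extend[OF ode2_continuous(2)[OF g] bd2] by metis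
  show ?thesis
  proof (rule that[of "max C1 C2"])
    fix x assume x: "x \<ge> L"
    have "C1 * exp (- x) \<le> max C1 C2 * exp (- x)" "C2 * exp (- x) \<le> max C1 C2 * exp (- x)"
      by (intro mult_right_mono; simp)+
    then show "\<bar>g x\<bar> \<le> max C1 C2 * exp (- x)" "\<bar>g' x\<bar> \<le> max C1 C2 * exp (- x)"
      using C1[OF x] C2[OF x] by linarith+
  qed
qed

text \<open>Positivity persists in the limit because double zeros are impossible, and the vertex
  inequality keeps the supremum away from \<open>0\<close>. Maximality then gives the decreasing
  tail from which decay follows.\<close>

lemma ground_state_exists:
  obtains \<beta> u u' g g' where "\<beta> < 0" "shoots \<beta> u u' g g'" "\<And>x. x \<in> {0..L} \<Longrightarrow> u x > 0"
    "\<And>x. x \<ge> L \<Longrightarrow> g x > 0" "\<And>x. x \<ge> L + 2 \<Longrightarrow> g' x < 0"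
proof -
  have "\<forall>\<beta>. \<exists>u u' g g'. shoots \<beta> u u' g g'" using shoots_exists by blast
  then obtain F F' G G' where FG: "\<And>\<beta>. shoots \<beta> (F \<beta>) (F' \<beta>) (G \<beta>) (G' \<beta>)" by metis
  define P where "P = (\<lambda>\<beta>. (\<forall>x\<in>{0..L}. F \<beta> x > 0) \<and> (\<forall>x\<ge>L. G \<beta> x > 0))"
  define S where "S = {\<beta>. \<beta> \<le> 0 \<and> P \<beta>}"
  have bdd: "bdd_above S" by (rule bdd_aboveI[of _ 0]) (auto simp: S_def)
  have "continuous_on {0..L} V" using V\<beta>_continuous[of 0] by simp
  then obtain M where M: "M \<ge> 0" "\<And>x. x \<in> {0..L} \<Longrightarrow> \<bar>V x\<bar> \<le> M"
    using continuous_on_Icc_bounded by metis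
  \<comment> \<open>At this value both potentials are nonnegative, since \<open>W \<ge> - 3\<close>
    and \<open>\<bar>V\<bar> \<le> M\<close> on the ring, so the shooting pair does not
    decrease.\<close>
  have ne: "- max M 3 \<in> S"
  proof -
    let ?b = "- max M 3"
    note T = shootsD[OF FG[of ?b]]
    have Vb: "V x - ?b \<ge> 0" if "x \<in> {0..L}" for x using M(2)[OF that] by (auto simp: max_def)
    have Wb: "W x - ?b \<ge> 0" for x unfolding W_def using zero_le_power2[of "y x"] by linarith
    have u: "F ?b x \<ge> 1" "F' ?b x \<ge> 0" if x: "x \<in> {0..L}" for x
      using ode2_growth[OF is_interval_cc T(1) Vb, of 0 x] T(2,3) L_pos x by auto
    have "G ?b x \<ge> G ?b L" if x: "x \<ge> L" for x
      using ode2_growth(1)[OF is_interval_ci T(4) Wb, of L x] T(5,6) u[of L] L_pos x by auto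
    then have "G ?b x > 0" if "x \<ge> L" for x using that u(1)[of L] L_pos T(5) by fastforce
    then show ?thesis using u M(1) unfolding S_def P_def by force
  qed
  define \<beta>0 where "\<beta>0 = Sup S"
  have upper: "\<beta> \<le> \<beta>0" if "\<beta> \<in> S" for \<beta> unfolding \<beta>0_def using that bdd by (rule cSup_upper)
  have approx: "\<exists>\<beta>\<in>S. \<bar>\<beta> - \<beta>0\<bar> < \<eta>" if "\<eta> > 0" for \<eta>
  proof -
    have "\<beta>0 - \<eta> < Sup S" using that by (simp add: \<beta>0_def)
    then obtain \<beta> where "\<beta> \<in> S" "\<beta>0 - \<eta> < \<beta>" using less_cSup_iff[OF _ bdd] ne by blast
    then show ?thesis using upper[of \<beta>] by force
  qed
  have neg: "\<beta>0 < 0"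
  proof -
    obtain x where x: "x \<ge> L" "G 0 x < 0" using shoots_zero_not_positive[OF FG] .
    obtain \<eta> where \<eta>: "\<eta> > 0" "\<And>\<beta> v v' h h'. \<bar>\<beta> - 0\<bar> < \<eta> \<Longrightarrow> shoots \<beta> v v' h h' \<Longrightarrow>
      (\<forall>t\<in>{0..L}. \<bar>v t - F 0 t\<bar> < - G 0 x) \<and> (\<forall>t\<in>{L..x}. \<bar>h t - G 0 t\<bar> < - G 0 x \<and> \<bar>h' t - G' 0 t\<bar> < - G 0 x)"
      using shoots_continuous_dependence[OF FG[of 0] x(1), of "- G 0 x"] x(2) by (metis neg_0_less_iff_less)
    have "\<beta> \<le> - \<eta>" if "\<beta> \<in> S" for \<beta>
    proof (rule ccontr)
      assume "\<not> \<beta> \<le> - \<eta>"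
      then have "\<bar>\<beta> - 0\<bar> < \<eta>" using that \<eta>(1) by (auto simp: S_def)
      then have "\<bar>G \<beta> x - G 0 x\<bar> < - G 0 x" using \<eta>(2)[OF _ FG[of \<beta>]] x(1) by auto
      then have "G \<beta> x < 0" by linarith
      moreover have "G \<beta> x > 0" using that x(1) by (simp add: S_def P_def)
      ultimately show False by simp
    qed
    then have "\<beta>0 \<le> - \<eta>" unfolding \<beta>0_def using ne by (intro cSup_least) auto
    then show ?thesis using \<eta>(1) by simp
  qed
  have nonneg: "F \<beta>0 x \<ge> 0" if x: "x \<in> {0..L}" for x
  proof (rule ccontr)
    assume "\<not> F \<beta>0 x \<ge> 0"
    then have e: "- F \<beta>0 x > 0" by simp
    obtain \<eta> where \<eta>: "\<eta> > 0" "\<And>\<beta> v v' h h'. \<bar>\<beta> - \<beta>0\<bar> < \<eta> \<Longrightarrow> shoots \<beta> v v' h h' \<Longrightarrow>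
      (\<forall>t\<in>{0..L}. \<bar>v t - F \<beta>0 t\<bar> < - F \<beta>0 x)"
      using shoots_continuous_dependence[OF FG[of \<beta>0] order_refl e] by metis
    obtain \<beta> where \<beta>: "\<beta> \<in> S" "\<bar>\<beta> - \<beta>0\<bar> < \<eta>" using approx[OF \<eta>(1)] by blast
    have "\<bar>F \<beta> x - F \<beta>0 x\<bar> < - F \<beta>0 x" using \<eta>(2)[OF \<beta>(2) FG] x by blast
    moreover have "F \<beta> x > 0" using \<beta>(1) x by (simp add: S_def P_def)
    ultimately show False by linarith
  qed
  have nonneg': "G \<beta>0 x \<ge> 0" if x: "x \<ge> L" for x
  proof (rule ccontr)
    assume "\<not> G \<beta>0 x \<ge> 0"
    then have e: "- G \<beta>0 x > 0" by simp
    obtain \<eta> where \<eta>: "\<eta> > 0" "\<And>\<beta> v v' h h'. \<bar>\<beta> - \<beta>0\<bar> < \<eta> \<Longrightarrow> shoots \<beta> v v' h h' \<Longrightarrow>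
      (\<forall>t\<in>{L..x}. \<bar>h t - G \<beta>0 t\<bar> < - G \<beta>0 x)"
      using shoots_continuous_dependence[OF FG[of \<beta>0] x e] by metis
    obtain \<beta> where \<beta>: "\<beta> \<in> S" "\<bar>\<beta> - \<beta>0\<bar> < \<eta>" using approx[OF \<eta>(1)] by blast
    have "\<bar>G \<beta> x - G \<beta>0 x\<bar> < - G \<beta>0 x" using \<eta>(2)[OF \<beta>(2) FG] x by auto
    moreover have "G \<beta> x > 0" using \<beta>(1) x by (simp add: S_def P_def)
    ultimately show False by linarith
  qed
  have P0: "P \<beta>0" unfolding P_def by (rule shoots_positive_if_nonneg[OF FG nonneg nonneg'])
  note T = shootsD[OF FG[of \<beta>0]]
  \<comment> \<open>With a nonnegative slope beyond \<open>L + 2\<close> the solution grows from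
    there on. Positivity up to that region is stable under small changes of \<open>\<beta>\<close>,
    so a slightly larger \<open>\<beta>\<close> would still belong to \<open>S\<close>.\<close>
  have decr: "G' \<beta>0 x < 0" if x: "x \<ge> L + 2" for x
  proof (rule ccontr)
    assume nn: "\<not> G' \<beta>0 x < 0"
    have sub: "{x..} \<subseteq> {L..}" using x by auto
    have Wp: "0 \<le> W t - \<beta>" if "t \<in> {L..}" "x \<le> t" "\<beta> \<le> 0" for t \<beta>
      using W_ge_1[of t \<beta>] that x by simp
    define x1 where "x1 = x + 1"
    have "G' \<beta>0 x < G' \<beta>0 x1"
    proof (rule pos_deriv_strict_mono[where T = "{L..}", OF is_interval_ci _ _ _ ode2D(2)[OF T(4)]])
      fix z assume z: "z \<in> {L..}" "x < z"
      show "0 < (W z - \<beta>0) * G \<beta>0 z"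
        using W_ge_1[of z \<beta>0] z x neg P0 by (intro mult_pos_pos) (auto simp: P_def)
    qed (use x in \<open>auto simp: x1_def\<close>)
    then have G1: "G' \<beta>0 x1 > 0" using nn by simp
    have "continuous_on {0..L} (F \<beta>0)" by (rule ode2_continuous(1)[OF T(1)])
    then obtain m1 where m1: "m1 \<in> {0..L}" "\<And>t. t \<in> {0..L} \<Longrightarrow> F \<beta>0 m1 \<le> F \<beta>0 t"
      using continuous_attains_inf[of "{0..L}" "F \<beta>0"] L_pos by auto
    have x1L: "L \<le> x1" using x by (simp add: x1_def)
    have "continuous_on {L..x1} (G \<beta>0)" by (rule continuous_on_subset[OF ode2_continuous(1)[OF T(4)]]) auto
    then obtain m2 where m2: "m2 \<in> {L..x1}" "\<And>t. t \<in> {L..x1} \<Longrightarrow> G \<beta>0 m2 \<le> G \<beta>0 t"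
      using continuous_attains_inf[of "{L..x1}" "G \<beta>0"] x1L by auto
    define e where "e = min (F \<beta>0 m1) (min (G \<beta>0 m2) (G' \<beta>0 x1))"
    have e: "e > 0" using m1(1) m2(1) G1 P0 by (auto simp: e_def P_def)
    obtain \<eta> where \<eta>: "\<eta> > 0" "\<And>\<beta> v v' h h'. \<bar>\<beta> - \<beta>0\<bar> < \<eta> \<Longrightarrow> shoots \<beta> v v' h h' \<Longrightarrow>
      (\<forall>t\<in>{0..L}. \<bar>v t - F \<beta>0 t\<bar> < e) \<and> (\<forall>t\<in>{L..x1}. \<bar>h t - G \<beta>0 t\<bar> < e \<and> \<bar>h' t - G' \<beta>0 t\<bar> < e)"
      using shoots_continuous_dependence[OF FG[of \<beta>0] x1L e] by metis
    define \<beta> where "\<beta> = min 0 (\<beta>0 + \<eta> / 2)"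
    have \<beta>: "\<beta> \<le> 0" "\<beta> > \<beta>0" "\<bar>\<beta> - \<beta>0\<bar> < \<eta>" using \<eta>(1) neg by (auto simp: \<beta>_def)
    note U = shootsD[OF FG[of \<beta>]]
    note close = \<eta>(2)[OF \<beta>(3) FG[of \<beta>]]
    have F1: "F \<beta> t > 0" if t: "t \<in> {0..L}" for t
    proof -
      have "e \<le> F \<beta>0 t" using m1(2)[OF t] by (simp add: e_def)
      moreover have "\<bar>F \<beta> t - F \<beta>0 t\<bar> < e" using close t by blast
      ultimately show ?thesis by linarith
    qed
    have G2: "G \<beta> t > 0" if t: "t \<in> {L..x1}" for t
    proof -
      have "e \<le> G \<beta>0 t" using m2(2)[OF t] by (simp add: e_def)
      moreover have "\<bar>G \<beta> t - G \<beta>0 t\<bar> < e" using close t by blast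
      ultimately show ?thesis by linarith
    qed
    have x1i: "x1 \<in> {L..x1}" using x1L by simp
    have "e \<le> G' \<beta>0 x1" by (simp add: e_def)
    moreover have "\<bar>G' \<beta> x1 - G' \<beta>0 x1\<bar> < e" using close x1i by blast
    ultimately have G3: "G' \<beta> x1 > 0" by linarith
    have Wx1: "0 \<le> W t - \<beta>" if "t \<in> {L..}" "x1 \<le> t" for t
      using Wp[of t \<beta>] that \<beta>(1) by (simp add: x1_def)
    have "G \<beta> t > 0" if t: "t \<ge> L" for t
    proof (cases "t \<le> x1")
      case False
      have "G \<beta> x1 \<le> G \<beta> t"
        by (rule ode2_growth(1)[OF is_interval_ci U(4) Wx1]) (use False t x1L G2[OF x1i] G3 in auto)
      then show ?thesis using G2[OF x1i] by simp
    qed (use G2 t in simp)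
    then have "\<beta> \<in> S" using F1 \<beta>(1) by (simp add: S_def P_def)
    then show False using upper[of \<beta>] \<beta>(2) by simp
  qed
  show ?thesis
    by (rule that[OF neg FG]) (use P0 decr in \<open>auto simp: P_def\<close>)
qed

text \<open>The Wronskian is strictly positive at the vertex and does not decrease on the half-line.
  There both functions eventually decrease and \<open>g2'\<close> is bounded below by convexity, so
  \<open>g1\<close> cannot tend to zero, against integrability.\<close>

lemma eigenvalue_unique:
  assumes s1: "shoots \<beta>1 u1 u1' g1 g1'" and s2: "shoots \<beta>2 u2 u2' g2 g2'" and \<beta>: "\<beta>1 < \<beta>2" "\<beta>2 \<le> 0"
    and i1: "integrable (lebesgue_on {L<..}) (\<lambda>x. x ^ 4 * (g1 x)\<^sup>2)"
    and i2: "integrable (lebesgue_on {L<..}) (\<lambda>x. x ^ 4 * (g2 x)\<^sup>2)"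
  shows False
proof -
  note S = shootsD[OF s1] and T = shootsD[OF s2]
  have \<beta>1: "\<beta>1 \<le> 0" using \<beta> by simp
  have p1: "u1 x > 0" if "x \<in> {0..L}" for x using eigen_positive[OF s1 \<beta>1 i1] that by blast
  have p2: "u2 x > 0" if "x \<in> {0..L}" for x using eigen_positive[OF s2 \<beta>(2) i2] that by blast
  have q1: "g1 x > 0" if "x \<ge> L" for x using eigen_positive[OF s1 \<beta>1 i1] that by blast
  have q2: "g2 x > 0" if "x \<ge> L" for x using eigen_positive[OF s2 \<beta>(2) i2] that by blast
  have "u1' 0 * u2 0 - u1 0 * u2' 0 < u1' L * u2 L - u1 L * u2' L"
  proof (rule pos_deriv_strict_mono[where f = "\<lambda>x. u1' x * u2 x - u1 x * u2' x" and T = "{0..L}"])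
    fix z assume z: "z \<in> {0..L}"
    show "((\<lambda>x. u1' x * u2 x - u1 x * u2' x) has_real_derivative
       (V z - \<beta>1 - (V z - \<beta>2)) * u1 z * u2 z) (at z within {0..L})"
      by (rule ode2_wronskian[OF S(1) T(1) z])
    show "0 < (V z - \<beta>1 - (V z - \<beta>2)) * u1 z * u2 z"
      using p1[OF z] p2[OF z] \<beta> by simp
  qed (use L_pos in \<open>auto simp: is_interval_cc\<close>)
  then have DL: "0 < u1' L * u2 L - u1 L * u2' L" using S T by simp
  define Z where "Z = (\<lambda>x. g1' x * g2 x - g1 x * g2' x)"
  define z0 where "z0 = Z L"
  have z0: "z0 > 0" using DL unfolding z0_def Z_def S(5,6) T(5,6) by (simp add: algebra_simps)
  have Zge: "z0 \<le> Z x" if x: "x \<ge> L" for x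
    unfolding z0_def Z_def
  proof (rule nonneg_deriv_mono[where f = "\<lambda>x. g1' x * g2 x - g1 x * g2' x" and T = "{L..}", OF _ _ _ x])
    fix z assume z: "z \<in> {L..}"
    show "((\<lambda>x. g1' x * g2 x - g1 x * g2' x) has_real_derivative
       (W z - \<beta>1 - (W z - \<beta>2)) * g1 z * g2 z) (at z within {L..})"
      by (rule ode2_wronskian[OF S(4) T(4) z])
    show "0 \<le> (W z - \<beta>1 - (W z - \<beta>2)) * g1 z * g2 z"
      using q1[of z] q2[of z] z \<beta> by simp
  qed (use x in \<open>auto simp: is_interval_ci\<close>)
  have neg: "h' x < 0" if "ode2 {L..} (\<lambda>x. W x - \<beta>) h h'" "\<beta> \<le> 0"
    "integrable (lebesgue_on {L<..}) (\<lambda>x. x ^ 4 * (h x)\<^sup>2)" "h x > 0" "x \<ge> L + 2" for h h' \<beta> x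
  proof -
    have y2: "y x > 1" using that(5) a_pos by (simp add: y_def)
    then have "1 / y x - y x < 0" by (simp add: field_simps) (metis less_trans mult_strict_mono' one_power2 power2_eq_square zero_le_one)
    then have "(h x)\<^sup>2 * (1 / y x - y x) < 0" using that(4) by (simp add: mult_pos_neg)
    then have "h x * h' x < 0" using half_line_ratio[OF that(1-3), of x] that(5) by simp
    then show ?thesis using that(4) by (simp add: mult_less_0_iff)
  qed
  define X where "X = L + 2"
  define B where "B = - g2' X"
  have B: "B > 0" using neg[OF T(4) \<beta>(2) i2 q2, of X] by (simp add: B_def X_def)
  have g2low: "- B \<le> g2' x" if x: "x \<ge> X" for x
  proof -
    have "g2' X \<le> g2' x"
    proof (rule nonneg_deriv_mono[where f = g2' and T = "{L..}", OF is_interval_ci _ _ x ode2D(2)[OF T(4)]])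
      fix z assume "z \<in> {L..}" "X < z"
      then show "0 \<le> (W z - \<beta>2) * g2 z" using W_ge_1[of z \<beta>2] q2[of z] \<beta>(2) by (simp add: X_def)
    qed (use x in \<open>auto simp: X_def\<close>)
    then show ?thesis by (simp add: B_def)
  qed
  have low: "z0 / B \<le> g1 x" if x: "x \<ge> X" for x
  proof -
    have xL: "x \<ge> L" using x by (simp add: X_def)
    have "g1' x * g2 x \<le> 0"
      using neg[OF S(4) \<beta>1 i1 q1, of x] q2[OF xL] x by (simp add: X_def mult_nonpos_nonneg less_imp_le)
    then have "z0 \<le> - (g1 x * g2' x)" using Zge[OF xL] by (simp add: Z_def)
    also have "\<dots> = g1 x * (- g2' x)" by simp
    also have "\<dots> \<le> g1 x * B" using g2low[OF x] q1[OF xL] by (intro mult_left_mono) auto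
    finally show ?thesis using B by (simp add: pos_divide_le_eq)
  qed
  have "(z0 / B)\<^sup>2 \<le> 0"
  proof (rule integrable_half_line_lower_bound[OF i1, of "max 1 X"])
    fix x assume x: "x > L" "max 1 X \<le> x"
    have "1 * (z0 / B)\<^sup>2 \<le> x ^ 4 * (g1 x)\<^sup>2"
      using low[of x] x z0 B by (intro mult_mono power_mono one_le_power) auto
    then show "(z0 / B)\<^sup>2 \<le> x ^ 4 * (g1 x)\<^sup>2" by simp
  qed simp
  then show False using z0 B by simp
qed

end

section \<open>Eigenfunctions of the linearized operator\<close>

lemma Icc_at_nontrivial:
  fixes a b :: real assumes "a < b"
  shows "at a within {a..b} \<noteq> bot" "at b within {a..b} \<noteq> bot" "at a within {a..} \<noteq> bot"
proof -
  show "at a within {a..b} \<noteq> bot" using assms by (simp add: at_within_Icc_at_right)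
  then show "at a within {a..} \<noteq> bot" using at_within_Ici_eq[OF assms, of a] by simp
  show "at b within {a..b} \<noteq> bot" using assms by (simp add: at_within_Icc_at_left)
qed

lemma H2_classical_ring:
  fixes f :: "real \<Rightarrow> 'a::euclidean_space"
  assumes "L > 0" "H2_on (ring_edge L) f" "continuous_on {-L..L} f" "continuous_on {-L..L} r"
    "AE x in lebesgue_on (ring_edge L). weak_deriv (ring_edge L) (weak_deriv (ring_edge L) f) x = r x"
  obtains f' where "\<And>x. x \<in> {-L..L} \<Longrightarrow> (f has_vector_derivative f' x) (at x within {-L..L})"
    "\<And>x. x \<in> {-L..L} \<Longrightarrow> (f' has_vector_derivative r x) (at x within {-L..L})"
proof -
  have cl: "closure (ring_edge L) = {-L..L}" using assms(1) by simp
  have "is_interval (ring_edge L)" by (simp add: is_interval_oo)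
  moreover have "- L / 2 < L / 2" "{- L / 2..L / 2} \<subseteq> ring_edge L" using assms(1) by auto
  ultimately show ?thesis
    using H2_classical[of "ring_edge L" "- L / 2" "L / 2" f r] assms(2-5) that unfolding cl
    by (metis open_greaterThanLessThan)
qed

lemma H2_classical_half_line:
  fixes f :: "real \<Rightarrow> 'a::euclidean_space"
  assumes "H2_on (half_line L) f" "continuous_on {L..} f" "continuous_on {L..} r"
    "AE x in lebesgue_on (half_line L). weak_deriv (half_line L) (weak_deriv (half_line L) f) x = r x"
  obtains f' where "\<And>x. x \<in> {L..} \<Longrightarrow> (f has_vector_derivative f' x) (at x within {L..})"
    "\<And>x. x \<in> {L..} \<Longrightarrow> (f' has_vector_derivative r x) (at x within {L..})"
proof -
  have cl: "closure (half_line L) = {L..}" by simp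
  have "is_interval (half_line L)" by (simp add: is_interval_oi)
  moreover have "L + 1 < L + 2" "{L + 1..L + 2} \<subseteq> half_line L" by auto
  ultimately show ?thesis
    using H2_classical[of "half_line L" "L + 1" "L + 2" f r] assms that unfolding cl
    by (metis open_greaterThan)
qed

text \<open>Both edges are regularized first; the Gaussian tail then supplies
  \<open>\<psi>' L = - a * \<psi> L\<close>, and with it the Kirchhoff condition no longer mentions
  \<open>\<psi>\<close>.\<close>

lemma single_lobe_profile:
  assumes L: "L > 0" and sl: "positive_single_lobe L c \<phi> \<psi>"
  obtains a \<phi>' where "log_lobe L c a \<phi> \<phi>'" "\<And>x. x \<ge> L \<Longrightarrow> ln ((\<psi> x)\<^sup>2) = c + 1 - (x - L + a)\<^sup>2"
    "continuous_on {-L..L} \<phi>"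
proof -
  from sl have dom: "H2_on (ring_edge L) \<phi>" "H2_on (half_line L) \<psi>" "continuous_on {-L..L} \<phi>"
    "continuous_on {L..} \<psi>" "\<phi> L = \<phi> (-L)" "\<phi> L = \<psi> L"
    "vector_derivative \<phi> (at L within {-L..L}) - vector_derivative \<phi> (at (-L) within {-L..L})
       = vector_derivative \<psi> (at L within {L..})"
    and st: "stationary_on (ring_edge L) c \<phi>" "stationary_on (half_line L) c \<psi>"
    and pos: "\<And>x. x \<in> {-L..L} \<Longrightarrow> \<phi> x > 0" "\<And>x. x \<in> {L..} \<Longrightarrow> \<psi> x > 0"
    and mx: "\<And>x. x \<in> {-L..L} \<Longrightarrow> x \<noteq> 0 \<Longrightarrow> \<phi> x < \<phi> 0"
    and anti: "antimono_on {0..L} \<phi>" "strict_antimono_on {L..} \<psi>"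
    unfolding positive_single_lobe_def dom0_def by auto
  have c1: "continuous_on {-L..L} (\<lambda>x. (c - ln ((\<phi> x)\<^sup>2)) * \<phi> x)"
    using pos(1) by (intro continuous_intros dom(3)) (auto simp: less_imp_neq[symmetric])
  have c2: "continuous_on {L..} (\<lambda>x. (c - ln ((\<psi> x)\<^sup>2)) * \<psi> x)"
    using pos(2) by (intro continuous_intros dom(4)) (auto simp: less_imp_neq[symmetric])
  have "AE x in lebesgue_on (ring_edge L). weak_deriv (ring_edge L) (weak_deriv (ring_edge L) \<phi>) x = (c - ln ((\<phi> x)\<^sup>2)) * \<phi> x"
    using st(1) unfolding stationary_on_def by eventually_elim (simp add: algebra_simps)
  from H2_classical_ring[OF L dom(1,3) c1 this] obtain \<phi>' where
    \<phi>': "\<And>x. x \<in> {-L..L} \<Longrightarrow> (\<phi> has_vector_derivative \<phi>' x) (at x within {-L..L})"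
      "\<And>x. x \<in> {-L..L} \<Longrightarrow> (\<phi>' has_vector_derivative (c - ln ((\<phi> x)\<^sup>2)) * \<phi> x) (at x within {-L..L})"
    by metis
  have "AE x in lebesgue_on (half_line L). weak_deriv (half_line L) (weak_deriv (half_line L) \<psi>) x = (c - ln ((\<psi> x)\<^sup>2)) * \<psi> x"
    using st(2) unfolding stationary_on_def by eventually_elim (simp add: algebra_simps)
  from H2_classical_half_line[OF dom(2,4) c2 this] obtain \<psi>' where
    \<psi>': "\<And>x. x \<in> {L..} \<Longrightarrow> (\<psi> has_vector_derivative \<psi>' x) (at x within {L..})"
      "\<And>x. x \<in> {L..} \<Longrightarrow> (\<psi>' has_vector_derivative (c - ln ((\<psi> x)\<^sup>2)) * \<psi> x) (at x within {L..})"
    by metis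
  have "integrable (lebesgue_on {L<..}) (\<lambda>x. (\<psi> x)\<^sup>2)"
    using dom(2) unfolding H2_on_def H1_on_def L2_on_def by simp
  then obtain a where a: "a \<ge> 0" "\<And>x. x \<ge> L \<Longrightarrow> \<psi>' x = - (x - L + a) * \<psi> x"
    "\<And>x. x \<ge> L \<Longrightarrow> ln ((\<psi> x)\<^sup>2) = c + 1 - (x - L + a)\<^sup>2"
    using log_nls_tail[of L \<psi> \<psi>' c] pos(2) anti(2) \<psi>'
    by (metis atLeast_iff has_real_derivative_iff_has_vector_derivative)
  have LL: "- L < L" "L \<in> {-L..L}" "- L \<in> {-L..L}" "L \<in> {L..}" using L by auto
  note vd = vector_derivative_within[OF Icc_at_nontrivial(2)[OF LL(1)] \<phi>'(1)[OF LL(2)]]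
    vector_derivative_within[OF Icc_at_nontrivial(1)[OF LL(1)] \<phi>'(1)[OF LL(3)]]
    vector_derivative_within[OF Icc_at_nontrivial(3)[OF LL(1), simplified] ]
  have vd3: "vector_derivative \<psi> (at L within {L..}) = \<psi>' L"
    by (rule vector_derivative_within[OF Icc_at_nontrivial(3)[of L "L + 1"] \<psi>'(1)[OF LL(4)]]) simp
  have "log_lobe L c a \<phi> \<phi>'"
  proof (rule log_lobeI[OF L])
    show "\<phi>' L - \<phi>' (- L) = - a * \<phi> L"
      using dom(6,7) a(2)[of L] unfolding vd(1,2) vd3 by simp
    show "ln ((\<phi> L)\<^sup>2) = c + 1 - a\<^sup>2" using a(3)[of L] dom(6) by simp
  qed (use pos mx anti dom a \<phi>' in \<open>auto simp: has_real_derivative_iff_has_vector_derivative\<close>)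
  then show ?thesis using that a(3) dom(3) by blast
qed

section \<open>Symmetry of eigenfunctions and reduction to the shooting pair\<close>

context log_lobe
begin

lemma V_even: "x \<in> {-L..L} \<Longrightarrow> V (- x) = V x"
  using even by (simp add: V_def)

lemma ode2_scale: "ode2 T Q f f' \<Longrightarrow> ode2 T Q (\<lambda>x. k * f x) (\<lambda>x. k * f' x)"
  unfolding ode2_def by (auto intro!: derivative_eq_intros)

text \<open>With positive slope at \<open>0\<close>, consider the first later zero \<open>z\<close>,
  which exists because \<open>h L = 0\<close>. The Wronskian with \<open>- \<phi>'\<close> starts at
  zero and does not decrease, forcing \<open>h' z = 0\<close> and hence the trivial solution.
  Applied to \<open>h\<close> and \<open>- h\<close> it kills the odd part.\<close>

lemma odd_vanishes:
  assumes h: "ode2 {0..L} (\<lambda>x. V x - \<beta>) h h'" and \<beta>: "\<beta> \<le> 0" and h0: "h 0 = 0" "h L = 0"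
  shows "h' 0 \<le> 0"
proof (rule ccontr)
  assume "\<not> h' 0 \<le> 0"
  have z: "0 \<in> {0..L}" using L_pos by simp
  obtain d where d: "d > 0" "\<And>t. 0 < t \<Longrightarrow> 0 + t \<in> {0..L} \<Longrightarrow> t < d \<Longrightarrow> h 0 < h (0 + t)"
    using has_real_derivative_pos_inc_right[OF ode2D(1)[OF h z]] \<open>\<not> h' 0 \<le> 0\<close> by auto
  define s where "s = min d L / 2"
  have s: "0 < s" "s < d" "s < L" using d L_pos by (auto simp: s_def min_def)
  have hs: "h t > 0" if "0 < t" "t \<le> s" for t using d(2)[of t] that s h0 by auto
  have "continuous_on {s..L} h" by (rule continuous_on_subset[OF ode2_continuous(1)[OF h]]) (use s in auto)
  then obtain z where z: "s < z" "z \<le> L" "h z = 0" "\<And>t. s \<le> t \<Longrightarrow> t < z \<Longrightarrow> h t > 0"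
    using first_zero[of s L h L] hs[of s] s h0 by auto
  have zi: "z \<in> {0..L}" using z s by auto
  have hp: "h t \<ge> 0" if "0 \<le> t" "t < z" for t
    using hs[of t] z(4)[of t] h0 that by (cases "t = 0"; cases "t \<le> s") (auto simp: less_imp_le)
  have le: "h' z \<le> 0"
    by (rule deriv_nonpos_if_nonneg_left[OF ode2D(1)[OF h zi] _ _ z(3) hp]) (use z s in auto)
  have "h' 0 * - \<phi>' 0 - h 0 * - \<phi>'' 0 \<le> h' z * - \<phi>' z - h z * - \<phi>'' z"
  proof (rule nonneg_deriv_mono[where f = "\<lambda>x. h' x * - \<phi>' x - h x * - \<phi>'' x" and T = "{0..L}", OF _ _ zi])
    fix t assume t: "t \<in> {0..L}"
    show "((\<lambda>x. h' x * - \<phi>' x - h x * - \<phi>'' x) has_real_derivative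
       (V t - \<beta> - V t) * h t * - \<phi>' t) (at t within {0..L})"
      by (rule ode2_wronskian[OF h half_slope_ode t])
    assume "0 < t" "t < z"
    then have "0 \<le> h t" "0 \<le> - \<phi>' t" using hp[of t] slope_neg[of t] z by (auto simp: less_imp_le)
    then show "0 \<le> (V t - \<beta> - V t) * h t * - \<phi>' t" using \<beta> by (intro mult_nonneg_nonneg) auto
  qed (use zi in \<open>auto simp: is_interval_cc\<close>)
  then have "0 \<le> h' z * - \<phi>' z" using h0 z slope_0 by simp
  then have "h' z = 0" using le slope_neg[of z] z s by (auto simp: mult_le_0_iff)
  then have "h' 0 = 0"
    using ode2_double_zero(2)[OF is_interval_cc V\<beta>_continuous h zi z(3)] L_pos by simp
  then show False using \<open>\<not> h' 0 \<le> 0\<close> by simp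
qed

text \<open>The odd part vanishes at \<open>0\<close> and, by the gluing condition, at
  \<open>L\<close>, so it is zero. What remains has the initial data of the shooting pair up to the
  factor \<open>f 0\<close>, on both edges.\<close>

lemma real_eigenfunction_shoots:
  assumes f: "ode2 {-L..L} (\<lambda>x. V x - \<beta>) f f'" and g: "ode2 {L..} (\<lambda>x. W x - \<beta>) g g'"
    and v: "f L = f (- L)" "f L = g L" "f' L - f' (- L) = g' L" and \<beta>: "\<beta> \<le> 0"
    and s: "shoots \<beta> u u' h h'"
  shows "\<And>x. x \<in> {-L..L} \<Longrightarrow> f x = f 0 * u \<bar>x\<bar>" "\<And>x. x \<ge> L \<Longrightarrow> g x = f 0 * h x"
proof -
  note S = shootsD[OF s]
  have fp: "ode2 {0..L} (\<lambda>x. V x - \<beta>) f f'" using f half_subset by (rule ode2_subset)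
  have refl: "((\<lambda>x. f (- x)) has_real_derivative - f' (- x)) (at x within {0..L})"
    "((\<lambda>x. f' (- x)) has_real_derivative - ((V x - \<beta>) * f (- x))) (at x within {0..L})"
    if x: "x \<in> {0..L}" for x
  proof -
    have nx: "- x \<in> {-L..L}" and x': "x \<in> {-L..L}" using x by auto
    have sub: "uminus ` {0..L} \<subseteq> {-L..L}" by auto
    show "((\<lambda>x. f (- x)) has_real_derivative - f' (- x)) (at x within {0..L})"
      by (rule has_real_derivative_reflect[OF DERIV_subset[OF ode2D(1)[OF f nx] sub]])
    show "((\<lambda>x. f' (- x)) has_real_derivative - ((V x - \<beta>) * f (- x))) (at x within {0..L})"
      using has_real_derivative_reflect[OF DERIV_subset[OF ode2D(2)[OF f nx] sub]] V_even[OF x'] by simp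
  qed
  define d where "d = (\<lambda>x. f x - f (- x))"
  define d' where "d' = (\<lambda>x. f' x + f' (- x))"
  have d: "ode2 {0..L} (\<lambda>x. V x - \<beta>) d d'"
    unfolding ode2_def
  proof (intro ballI conjI)
    fix x assume x: "x \<in> {0..L}"
    show "(d has_real_derivative d' x) (at x within {0..L})"
      using DERIV_diff[OF ode2D(1)[OF fp x] refl(1)[OF x]] by (simp add: d_def d'_def)
    show "(d' has_real_derivative (V x - \<beta>) * d x) (at x within {0..L})"
      using DERIV_add[OF ode2D(2)[OF fp x] refl(2)[OF x]] by (simp add: d_def d'_def algebra_simps)
  qed
  have o0: "d 0 = 0" "d L = 0" using v(1) by (auto simp: d_def)
  have mo: "ode2 {0..L} (\<lambda>x. V x - \<beta>) (\<lambda>x. - 1 * d x) (\<lambda>x. - 1 * d' x)" by (rule ode2_scale[OF d])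
  have "d' 0 \<le> 0" by (rule odd_vanishes[OF d \<beta> o0])
  moreover have "- 1 * d' 0 \<le> 0" by (rule odd_vanishes[OF mo \<beta>]) (use o0 in auto)
  ultimately have d'0: "d' 0 = 0" by simp
  have z: "0 \<in> {0..L}" using L_pos by simp
  have oz: "d x = 0 \<and> d' x = 0" if "x \<in> {0..L}" for x
    using ode2_double_zero[OF is_interval_cc V\<beta>_continuous d z o0(1) d'0 that] by blast
  have f'0: "f' 0 = 0" using d'0 by (simp add: d'_def)
  have fu: "f x = f 0 * u x \<and> f' x = f 0 * u' x" if x: "x \<in> {0..L}" for x
    using ode2_unique[OF V\<beta>_continuous fp ode2_scale[OF S(1), of "f 0"] _ _ x] S(2,3) f'0 by simp
  show "f x = f 0 * u \<bar>x\<bar>" if x: "x \<in> {-L..L}" for x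
  proof (cases "x \<ge> 0")
    case True
    then show ?thesis using fu[of x] x by simp
  next
    case False
    then have "f (- x) = f x" using oz[of "- x"] x by (simp add: d_def)
    then show ?thesis using fu[of "- x"] x False by simp
  qed
  have Li: "L \<in> {0..L}" using L_pos by simp
  have gL: "g L = f 0 * h L" "g' L = f 0 * h' L"
    using fu[OF Li] oz[OF Li] v S(5,6) by (auto simp: d'_def)
  show "g x = f 0 * h x" if x: "x \<ge> L" for x
  proof -
    have sub: "{L..x} \<subseteq> {L..}" by auto
    show ?thesis
      using ode2_unique(1)[OF W\<beta>_continuous ode2_subset[OF g sub] ode2_scale[OF ode2_subset[OF S(4) sub], of "f 0"], of x]
        gL x by simp
  qed
qed

end

section \<open>From a decaying shooting pair to an eigenfunction in the domain\<close>

lemma has_real_derivative_Un: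
  "(f has_real_derivative D) (at x within S) \<Longrightarrow> (f has_real_derivative D) (at x within T) \<Longrightarrow>
    (f has_real_derivative D) (at x within S \<union> T)"
  unfolding has_field_derivative_iff by (rule Lim_Un)

lemma has_real_derivative_outside:
  "x \<notin> closure S \<Longrightarrow> (f has_real_derivative D) (at (x::real) within S)"
  using not_in_closure_trivial_limitI[of x S] by (simp add: has_field_derivative_iff)

lemma even_derivative:
  fixes f :: "real \<Rightarrow> real"
  assumes x: "x \<in> {-L..L}"
    and r: "x \<ge> 0 \<Longrightarrow> (f has_real_derivative D) (at x within {0..L})"
    and l: "x \<le> 0 \<Longrightarrow> ((\<lambda>t. f (- t)) has_real_derivative - D) (at (- x) within {0..L})"
  shows "(f has_real_derivative D) (at x within {-L..L})"
proof -
  have "(f has_real_derivative D) (at x within {-L..0} \<union> {0..L})"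
  proof (rule has_real_derivative_Un)
    show "(f has_real_derivative D) (at x within {0..L})"
      using r by (cases "x \<ge> 0") (auto intro!: has_real_derivative_outside)
    show "(f has_real_derivative D) (at x within {-L..0})"
    proof (cases "x \<le> 0")
      case True
      have "uminus ` {-L..0} = {0..L}" by simp
      then show ?thesis
        using has_real_derivative_reflect[of "\<lambda>t. f (- t)" "- D" x "{-L..0}"] l[OF True] by simp
    qed (auto intro!: has_real_derivative_outside)
  qed
  moreover have "{-L..0} \<union> {0..L} = {-L..L}" using x by auto
  ultimately show ?thesis by simp
qed

text \<open>\<open>u' 0 = 0\<close> makes the two branches of the derivative agree at the origin,
  where the pieces are glued.\<close>

lemma ode2_even_extension:
  assumes u: "ode2 {0..L} Q u u'" "u' 0 = 0" and Q: "\<And>x. x \<in> {-L..L} \<Longrightarrow> Q (- x) = Q x"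
  shows "ode2 {-L..L} Q (\<lambda>x. u \<bar>x\<bar>) (\<lambda>x. if 0 \<le> x then u' x else - u' (- x))"
  unfolding ode2_def
proof (intro ballI conjI; rule even_derivative)
  fix x assume x: "x \<in> {-L..L}"
  let ?d = "if 0 \<le> x then u' x else - u' (- x)"
  show "((\<lambda>x. u \<bar>x\<bar>) has_real_derivative ?d) (at x within {0..L})" if "x \<ge> 0"
    by (rule has_field_derivative_transform_within[of u, OF _ zero_less_one])
      (use x that ode2D(1)[OF u(1)] in auto)
  show "((\<lambda>t. u \<bar>- t\<bar>) has_real_derivative - ?d) (at (- x) within {0..L})" if "x \<le> 0"
    by (rule has_field_derivative_transform_within[of u, OF _ zero_less_one])
      (use x that ode2D(1)[OF u(1), of "- x"] u(2) in \<open>auto split: if_splits\<close>)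
  let ?f = "\<lambda>x. if 0 \<le> x then u' x else - u' (- x)"
  show "(?f has_real_derivative Q x * u \<bar>x\<bar>) (at x within {0..L})" if "x \<ge> 0"
    by (rule has_field_derivative_transform_within[of u', OF _ zero_less_one])
      (use x that ode2D(2)[OF u(1)] in auto)
  show "((\<lambda>t. ?f (- t)) has_real_derivative - (Q x * u \<bar>x\<bar>)) (at (- x) within {0..L})" if "x \<le> 0"
    by (rule has_field_derivative_transform_within[of "\<lambda>t. - u' t", OF _ zero_less_one])
      (use x that DERIV_minus[OF ode2D(2)[OF u(1), of "- x"]] u(2) Q[OF x] in auto)
qed auto

lemma L2_on_ring_continuous:
  fixes h :: "real \<Rightarrow> 'a::euclidean_space"
  assumes "continuous_on {-L..L} h"
  shows "L2_on (ring_edge L) h"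
proof -
  have sub: "ring_edge L \<subseteq> {-L..L}" by auto
  have "h \<in> borel_measurable (lebesgue_on (ring_edge L))"
    by (intro continuous_imp_measurable_on_sets_lebesgue continuous_on_subset[OF assms sub]) simp
  moreover have "(\<lambda>x. (norm (h x))\<^sup>2) absolutely_integrable_on {-L..L}"
    by (intro absolutely_integrable_continuous_real continuous_intros assms)
  then have "(\<lambda>x. (norm (h x))\<^sup>2) absolutely_integrable_on (ring_edge L)"
    by (rule set_integrable_subset) auto
  then have "integrable (lebesgue_on (ring_edge L)) (\<lambda>x. (norm (h x))\<^sup>2)"
    by (simp add: set_integrable_def integrable_restrict_space)
  ultimately show ?thesis by (simp add: L2_on_def)
qed

lemma L2_on_half_line_exp:
  fixes h :: "real \<Rightarrow> 'a::euclidean_space"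
  assumes h: "continuous_on {L..} h" and K: "\<And>x. x > L \<Longrightarrow> (norm (h x))\<^sup>2 \<le> K * exp (- x)"
  shows "L2_on (half_line L) h"
proof -
  have sub: "half_line L \<subseteq> {L..}" by auto
  have m: "h \<in> borel_measurable (lebesgue_on (half_line L))"
    by (intro continuous_imp_measurable_on_sets_lebesgue continuous_on_subset[OF h sub]) simp
  have "(\<lambda>x. exp (- x)) integrable_on {L..}"
    using integrable_on_exp_minus_to_infinity[of 1 L] by simp
  then have "(\<lambda>x. exp (- x)) absolutely_integrable_on {L..}"
    by (rule nonnegative_absolutely_integrable_1) (rule exp_ge_zero)
  then have "(\<lambda>x. exp (- x)) absolutely_integrable_on (half_line L)"
    by (rule set_integrable_subset) auto
  then have "integrable (lebesgue_on (half_line L)) (\<lambda>x. exp (- x))"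
    by (simp add: set_integrable_def integrable_restrict_space)
  then have i: "integrable (lebesgue_on (half_line L)) (\<lambda>x. K * exp (- x))" by (rule integrable_mult_right)
  have "integrable (lebesgue_on (half_line L)) (\<lambda>x. (norm (h x))\<^sup>2)"
  proof (rule Bochner_Integration.integrable_bound[OF i])
    show "(\<lambda>x. (norm (h x))\<^sup>2) \<in> borel_measurable (lebesgue_on (half_line L))" using m by measurable
    show "AE x in lebesgue_on (half_line L). norm ((norm (h x))\<^sup>2) \<le> norm (K * exp (- x))"
    proof (rule AE_I2)
      fix x assume "x \<in> space (lebesgue_on (half_line L))"
      then have "(norm (h x))\<^sup>2 \<le> K * exp (- x)" by (intro K) simp
      also have "\<dots> \<le> norm (K * exp (- x))" unfolding real_norm_def by (rule abs_ge_self)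
      finally show "norm ((norm (h x))\<^sup>2) \<le> norm (K * exp (- x))" by simp
    qed
  qed
  then show ?thesis using m by (simp add: L2_on_def)
qed

text \<open>The fourth power of \<open>x / 4 \<le> exp (x / 4)\<close>; the constant is
  \<open>4 ^ 4\<close>.\<close>

lemma power4_le_exp:
  fixes x :: real assumes "x \<ge> 0" shows "x ^ 4 \<le> 256 * exp x"
proof -
  have "x / 4 \<le> exp (x / 4)" using exp_ge_add_one_self[of "x / 4"] by linarith
  then have "(x / 4) ^ 4 \<le> exp (x / 4) ^ 4" using assms by (intro power_mono) auto
  also have "exp (x / 4) ^ 4 = exp x" by (simp flip: exp_of_nat_mult)
  finally show ?thesis by (simp add: power_divide)
qed

text \<open>\<open>\<psi>\<close> enters the operator only through the logarithm in the potential,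
  so its Gaussian form is all that has to be known about it.\<close>

locale lobe_state = log_lobe +
  fixes \<psi> :: "real \<Rightarrow> real"
  assumes tail: "\<And>x. x \<ge> L \<Longrightarrow> ln ((\<psi> x)\<^sup>2) = c + 1 - (x - L + a)\<^sup>2"
begin

lemma potential_ring: "(c - 2) - ln (\<bar>\<phi> x\<bar>\<^sup>2) = V x"
  by (simp add: V_def)

lemma potential_half_line: "x \<ge> L \<Longrightarrow> (c - 2) - ln (\<bar>\<psi> x\<bar>\<^sup>2) = W x"
  by (simp add: tail W_def y_def)

abbreviation "A \<equiv> L1_op L c \<phi> \<psi>"

text \<open>The potentials are real, so real and imaginary parts are eigenfunctions separately. The
  weight condition passes to \<open>h\<close> after division by \<open>f 0\<close>, hence the last
  proviso.\<close>

lemma eigenspace_shoots: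
  assumes e: "(f, g) \<in> eigenspace L A \<beta>" and \<beta>: "\<beta> \<le> 0" and s: "shoots \<beta> u u' h h'"
  shows "x \<in> {-L..L} \<Longrightarrow> f x = f 0 * of_real (u \<bar>x\<bar>)" "x \<ge> L \<Longrightarrow> g x = f 0 * of_real (h x)"
    "f 0 \<noteq> 0 \<Longrightarrow> integrable (lebesgue_on {L<..}) (\<lambda>x. x ^ 4 * (h x)\<^sup>2)"
proof -
  have dom: "H2_on (ring_edge L) f" "H2_on (half_line L) g" "continuous_on {-L..L} f" "continuous_on {L..} g"
    "f L = f (-L)" "f L = g L"
    "vector_derivative f (at L within {-L..L}) - vector_derivative f (at (-L) within {-L..L})
       = vector_derivative g (at L within {L..})"
    and L2: "L2_on (half_line L) (\<lambda>x. x\<^sup>2 *\<^sub>R g x)"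
    and eq: "AE x in lebesgue_on (ring_edge L). schroedinger_on (ring_edge L) c \<phi> f x = of_real \<beta> * f x"
      "AE x in lebesgue_on (half_line L). schroedinger_on (half_line L) c \<psi> g x = of_real \<beta> * g x"
    using e unfolding eigenspace_def dom_op_def dom0_def eq_L2_def L1_op_def graph_scale_def by auto
  let ?r = "\<lambda>x. complex_of_real (V x - \<beta>) * f x" and ?q = "\<lambda>x. complex_of_real (W x - \<beta>) * g x"
  have c1: "continuous_on {-L..L} ?r" by (intro continuous_intros V_continuous dom)
  have c2: "continuous_on {L..} ?q" by (intro continuous_intros W_continuous dom)
  have "AE x in lebesgue_on (ring_edge L). weak_deriv (ring_edge L) (weak_deriv (ring_edge L) f) x = ?r x"
    using eq(1) unfolding schroedinger_on_def potential_ring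
    by eventually_elim (simp add: algebra_simps)
  from H2_classical_ring[OF L_pos dom(1,3) c1 this] obtain f' where
    f': "\<And>x. x \<in> {-L..L} \<Longrightarrow> (f has_vector_derivative f' x) (at x within {-L..L})"
      "\<And>x. x \<in> {-L..L} \<Longrightarrow> (f' has_vector_derivative ?r x) (at x within {-L..L})"
    by metis
  have "AE x in lebesgue_on (half_line L). weak_deriv (half_line L) (weak_deriv (half_line L) g) x = ?q x"
    using eq(2) AE_space
  proof eventually_elim
    case (elim x)
    then show ?case using potential_half_line[of x] unfolding schroedinger_on_def by (simp add: algebra_simps)
  qed
  from H2_classical_half_line[OF dom(2,4) c2 this] obtain g' where
    g': "\<And>x. x \<in> {L..} \<Longrightarrow> (g has_vector_derivative g' x) (at x within {L..})"
      "\<And>x. x \<in> {L..} \<Longrightarrow> (g' has_vector_derivative ?q x) (at x within {L..})"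
    by metis
  have LL: "- L < L" "L \<in> {-L..L}" "- L \<in> {-L..L}" "L \<in> {L..}" using L_pos by auto
  have nb: "at L within {L..} \<noteq> bot" by (rule Icc_at_nontrivial(3)[of L "L + 1"]) simp
  have kirch: "f' L - f' (- L) = g' L"
    using dom(7) unfolding vector_derivative_within[OF Icc_at_nontrivial(2)[OF LL(1)] f'(1)[OF LL(2)]]
      vector_derivative_within[OF Icc_at_nontrivial(1)[OF LL(1)] f'(1)[OF LL(3)]]
      vector_derivative_within[OF nb g'(1)[OF LL(4)]] .
  have main: "(\<forall>x\<in>{-L..L}. P (f x) = P (f 0) * u \<bar>x\<bar>) \<and> (\<forall>x\<ge>L. P (g x) = P (f 0) * h x)"
    if P: "bounded_linear P" "\<And>r z. P (of_real r * z) = r * P z" for P :: "complex \<Rightarrow> real"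
  proof -
    note bl = bounded_linear.has_vector_derivative[OF P(1)]
    have o1: "ode2 {-L..L} (\<lambda>x. V x - \<beta>) (\<lambda>x. P (f x)) (\<lambda>x. P (f' x))"
      unfolding ode2_def has_real_derivative_iff_has_vector_derivative
      using bl[OF f'(1)] bl[OF f'(2)] unfolding P(2) by blast
    have o2: "ode2 {L..} (\<lambda>x. W x - \<beta>) (\<lambda>x. P (g x)) (\<lambda>x. P (g' x))"
      unfolding ode2_def has_real_derivative_iff_has_vector_derivative
      using bl[OF g'(1)] bl[OF g'(2)] unfolding P(2) by blast
    have k: "P (f' L) - P (f' (- L)) = P (g' L)"
      unfolding kirch[symmetric] by (rule linear_diff[OF bounded_linear.linear[OF P(1)], symmetric])
    have glue: "P (f L) = P (f (- L))" "P (f L) = P (g L)"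
      using dom(5,6) by auto
    note R = real_eigenfunction_shoots[OF o1 o2 glue k \<beta> s]
    show ?thesis using R by blast
  qed
  have Re: "(\<forall>x\<in>{-L..L}. Re (f x) = Re (f 0) * u \<bar>x\<bar>) \<and> (\<forall>x\<ge>L. Re (g x) = Re (f 0) * h x)"
    by (rule main) (auto intro: bounded_linear_Re)
  have Im: "(\<forall>x\<in>{-L..L}. Im (f x) = Im (f 0) * u \<bar>x\<bar>) \<and> (\<forall>x\<ge>L. Im (g x) = Im (f 0) * h x)"
    by (rule main) (auto intro: bounded_linear_Im)
  show "f x = f 0 * of_real (u \<bar>x\<bar>)" if "x \<in> {-L..L}" for x
  proof -
    have "Re (f x) = Re (f 0) * u \<bar>x\<bar>" "Im (f x) = Im (f 0) * u \<bar>x\<bar>" using Re Im that by blast+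
    then show ?thesis by (intro complex_eqI) simp_all
  qed
  show gx: "g x = f 0 * of_real (h x)" if "x \<ge> L" for x
  proof -
    have "Re (g x) = Re (f 0) * h x" "Im (g x) = Im (f 0) * h x" using Re Im that by blast+
    then show ?thesis by (intro complex_eqI) simp_all
  qed
  assume nz: "f 0 \<noteq> 0"
  have "integrable (lebesgue_on {L<..}) (\<lambda>x. (norm (x\<^sup>2 *\<^sub>R g x))\<^sup>2)"
    using L2 unfolding L2_on_def by simp
  then have "integrable (lebesgue_on {L<..}) (\<lambda>x. (norm (f 0))\<^sup>2 * (x ^ 4 * (h x)\<^sup>2))"
    by (rule Bochner_Integration.integrable_cong[THEN iffD1, rotated 2])
      (auto simp: gx norm_mult power_mult_distrib simp flip: power_mult)
  then show "integrable (lebesgue_on {L<..}) (\<lambda>x. x ^ 4 * (h x)\<^sup>2)" using nz by simp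
qed

text \<open>Vanishing off the edges matches the choice of representatives in the domain, so that
  multiples of this pair can exhaust an eigenspace as a set of functions.\<close>

definition eigen_pair :: "(real \<Rightarrow> real) \<Rightarrow> (real \<Rightarrow> real) \<Rightarrow> complex graph_fun" where
  "eigen_pair u g = ((\<lambda>x. if x \<in> {-L..L} then of_real (u \<bar>x\<bar>) else 0), (\<lambda>x. if x \<in> {L..} then of_real (g x) else 0))"

text \<open>The squares of \<open>g\<close> and \<open>g'\<close> are bounded by
  \<open>C\<^sup>2 * exp (- 2 * x)\<close>. One factor \<open>exp (- x)\<close> absorbs the
  polynomials from the weight and from \<open>W\<close>, the other is integrable.\<close>

lemma eigen_pair_in_eigenspace:
  assumes s: "shoots \<beta> u u' g g'"
    and C: "\<And>x. x \<ge> L \<Longrightarrow> \<bar>g x\<bar> \<le> C * exp (- x)" "\<And>x. x \<ge> L \<Longrightarrow> \<bar>g' x\<bar> \<le> C * exp (- x)"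
  shows "eigen_pair u g \<in> eigenspace L A \<beta>"
proof -
  note S = shootsD[OF s]
  define F where "F = fst (eigen_pair u g)"
  define G where "G = snd (eigen_pair u g)"
  have F: "F x = of_real (u \<bar>x\<bar>)" if "x \<in> {-L..L}" for x using that by (simp add: F_def eigen_pair_def)
  have G: "G x = of_real (g x)" if "x \<in> {L..}" for x using that by (simp add: G_def eigen_pair_def)
  let ?w' = "\<lambda>x. if 0 \<le> x then u' x else - u' (- x)"
  have ev: "ode2 {-L..L} (\<lambda>x. V x - \<beta>) (\<lambda>x. u \<bar>x\<bar>) ?w'"
    by (rule ode2_even_extension[OF S(1,3)]) (simp add: V_even)
  define F' where "F' = (\<lambda>x. complex_of_real (?w' x))"
  define F'' where "F'' = (\<lambda>x. complex_of_real ((V x - \<beta>) * u \<bar>x\<bar>))"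
  define G' where "G' = (\<lambda>x. complex_of_real (g' x))"
  define G'' where "G'' = (\<lambda>x. complex_of_real ((W x - \<beta>) * g x))"
  have lift: "((\<lambda>x. complex_of_real (k x)) has_vector_derivative of_real d) (at x within T)"
    if "(k has_real_derivative d) (at x within T)" for k d x T
    using that bounded_linear.has_vector_derivative[OF bounded_linear_of_real]
    by (simp add: has_real_derivative_iff_has_vector_derivative)
  have FD: "(F has_vector_derivative F' x) (at x within {-L..L})" if x: "x \<in> {-L..L}" for x
    using lift[OF ode2D(1)[OF ev x]] F unfolding F'_def
    by (rule has_vector_derivative_transform[OF x, rotated])
  have FD': "(F' has_vector_derivative F'' x) (at x within {-L..L})" if x: "x \<in> {-L..L}" for x
    using lift[OF ode2D(2)[OF ev x]] unfolding F'_def F''_def .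
  have GD: "(G has_vector_derivative G' x) (at x within {L..})" if x: "x \<in> {L..}" for x
    using lift[OF ode2D(1)[OF S(4) x]] G unfolding G'_def
    by (rule has_vector_derivative_transform[OF x, rotated])
  have GD': "(G' has_vector_derivative G'' x) (at x within {L..})" if x: "x \<in> {L..}" for x
    using lift[OF ode2D(2)[OF S(4) x]] unfolding G'_def G''_def .
  have cF: "continuous_on {-L..L} F" "continuous_on {-L..L} F'" "continuous_on {-L..L} F''"
    using continuous_on_vector_derivative[OF FD] continuous_on_vector_derivative[OF FD']
    unfolding F''_def by (auto intro!: continuous_intros V_continuous ode2_continuous(1)[OF ev])
  have cG: "continuous_on {L..} G" "continuous_on {L..} G'" "continuous_on {L..} G''"
    using continuous_on_vector_derivative[OF GD] continuous_on_vector_derivative[OF GD']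
    unfolding G''_def by (auto intro!: continuous_intros W_continuous ode2_continuous(1)[OF S(4)])
  have sub: "ring_edge L \<subseteq> {-L..L}" "half_line L \<subseteq> {L..}" by auto
  have FDi: "(F has_vector_derivative F' x) (at x)" "(F' has_vector_derivative F'' x) (at x)" if "x \<in> ring_edge L" for x
    using FD[of x] FD'[of x] that at_within_interior_Icc[of L x] by auto
  have GDi: "(G has_vector_derivative G' x) (at x)" "(G' has_vector_derivative G'' x) (at x)" if x: "x \<in> half_line L" for x
  proof -
    have "at x within {L..} = at x" using x by (intro at_within_interior) simp
    then show "(G has_vector_derivative G' x) (at x)" "(G' has_vector_derivative G'' x) (at x)"
      using GD[of x] GD'[of x] x by auto
  qed
  have e2: "(exp (- x))\<^sup>2 \<le> exp (- x)" if "x > L" for x :: real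
    using that L_pos by (simp add: power2_eq_square mult_le_cancel_left1)
  have ex: "exp x * (exp (- x))\<^sup>2 = exp (- x)" for x :: real
    by (simp add: power2_eq_square flip: exp_add)
  have gsq: "(g x)\<^sup>2 \<le> C\<^sup>2 * (exp (- x))\<^sup>2" "(g' x)\<^sup>2 \<le> C\<^sup>2 * (exp (- x))\<^sup>2" if "x > L" for x
    using power_mono[OF C(1)[of x], of 2] power_mono[OF C(2)[of x], of 2] that
    by (auto simp: power_mult_distrib)
  have base: "C\<^sup>2 * (exp (- x))\<^sup>2 \<le> C\<^sup>2 * exp (- x)" if "x > L" for x
    using e2[OF that] by (intro mult_left_mono) auto
  have x4: "x ^ 4 * (C\<^sup>2 * (exp (- x))\<^sup>2) \<le> 256 * C\<^sup>2 * exp (- x)" if "x > L" for x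
  proof -
    have "x ^ 4 * (C\<^sup>2 * (exp (- x))\<^sup>2) \<le> (256 * exp x) * (C\<^sup>2 * (exp (- x))\<^sup>2)"
      using that L_pos by (intro mult_right_mono power4_le_exp) auto
    also have "\<dots> = 256 * C\<^sup>2 * (exp x * (exp (- x))\<^sup>2)" by (simp add: mult_ac)
    finally show ?thesis unfolding ex .
  qed
  have LG: "L2_on (half_line L) G"
  proof (rule L2_on_half_line_exp[OF cG(1)])
    fix x assume x: "x > L"
    show "(norm (G x))\<^sup>2 \<le> C\<^sup>2 * exp (- x)" using gsq(1)[OF x] base[OF x] x by (simp add: G)
  qed
  have LG': "L2_on (half_line L) G'"
  proof (rule L2_on_half_line_exp[OF cG(2)])
    fix x assume x: "x > L"
    show "(norm (G' x))\<^sup>2 \<le> C\<^sup>2 * exp (- x)" using gsq(2)[OF x] base[OF x] x by (simp add: G'_def)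
  qed
  have Lx: "L2_on (half_line L) (\<lambda>x. x\<^sup>2 *\<^sub>R G x)"
  proof (rule L2_on_half_line_exp)
    show "continuous_on {L..} (\<lambda>x. x\<^sup>2 *\<^sub>R G x)" by (intro continuous_intros cG)
    fix x assume x: "x > L"
    have "(norm (x\<^sup>2 *\<^sub>R G x))\<^sup>2 = x ^ 4 * (g x)\<^sup>2"
      using x by (simp add: G power_mult_distrib flip: power_mult)
    also have "\<dots> \<le> x ^ 4 * (C\<^sup>2 * (exp (- x))\<^sup>2)" using gsq(1)[OF x] by (intro mult_left_mono) auto
    also have "\<dots> \<le> 256 * C\<^sup>2 * exp (- x)" by (rule x4[OF x])
    finally show "(norm (x\<^sup>2 *\<^sub>R G x))\<^sup>2 \<le> 256 * C\<^sup>2 * exp (- x)" .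
  qed
  \<comment> \<open>\<open>K\<close> dominates both the coefficient \<open>2\<close> of
    \<open>x\<^sup>2\<close> and the constant that remain after
    \<open>(y x)\<^sup>2 \<le> 2 * x\<^sup>2 + 2 * (a - L)\<^sup>2\<close>.\<close>
  define K where "K = 2 + 2 * (a - L)\<^sup>2 + 3 + \<bar>\<beta>\<bar>"
  have Wb: "(W x - \<beta>)\<^sup>2 \<le> K\<^sup>2 * (2 + 2 * x ^ 4)" for x
  proof -
    have "(x + (a - L))\<^sup>2 \<le> 2 * x\<^sup>2 + 2 * (a - L)\<^sup>2"
    proof -
      have "(s + t)\<^sup>2 \<le> 2 * s\<^sup>2 + 2 * t\<^sup>2" for s t :: real
        using zero_le_power2[of "s - t"] unfolding power2_diff power2_sum by linarith
      then show ?thesis .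
    qed
    then have y2: "(y x)\<^sup>2 \<le> 2 * x\<^sup>2 + 2 * (a - L)\<^sup>2" by (simp add: y_def algebra_simps)
    have "\<bar>W x - \<beta>\<bar> \<le> (y x)\<^sup>2 + 3 + \<bar>\<beta>\<bar>"
      using zero_le_power2[of "y x"] unfolding W_def by linarith
    also have "\<dots> \<le> 2 * x\<^sup>2 + (2 * (a - L)\<^sup>2 + 3 + \<bar>\<beta>\<bar>)" using y2 by linarith
    also have "\<dots> \<le> K * x\<^sup>2 + K * 1"
      by (intro add_mono mult_right_mono) (auto simp: K_def)
    finally have "\<bar>W x - \<beta>\<bar> \<le> K * (1 + x\<^sup>2)" by (simp add: algebra_simps)
    then have "\<bar>W x - \<beta>\<bar>\<^sup>2 \<le> (K * (1 + x\<^sup>2))\<^sup>2" by (intro power_mono) auto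
    also have "\<dots> = K\<^sup>2 * (1 + x\<^sup>2)\<^sup>2" by (simp add: power_mult_distrib)
    also have "(1 + x\<^sup>2)\<^sup>2 \<le> 2 + 2 * x ^ 4"
    proof -
      have "(x\<^sup>2)\<^sup>2 = x ^ 4" by (simp flip: power_mult)
      then show ?thesis using zero_le_power2[of "1 - x\<^sup>2"] by (simp add: power2_diff power2_sum)
    qed
    finally show ?thesis by (simp add: mult_left_mono)
  qed
  have LG'': "L2_on (half_line L) G''"
  proof (rule L2_on_half_line_exp[OF cG(3)])
    fix x assume x: "x > L"
    have "(norm (G'' x))\<^sup>2 = (W x - \<beta>)\<^sup>2 * (g x)\<^sup>2"
      by (simp add: G''_def norm_mult power_mult_distrib flip: of_real_diff)
    also have "\<dots> \<le> (K\<^sup>2 * (2 + 2 * x ^ 4)) * (C\<^sup>2 * (exp (- x))\<^sup>2)"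
      using Wb gsq(1)[OF x] by (intro mult_mono) auto
    also have "\<dots> = K\<^sup>2 * (2 * (C\<^sup>2 * (exp (- x))\<^sup>2) + 2 * (x ^ 4 * (C\<^sup>2 * (exp (- x))\<^sup>2)))"
      by (simp add: algebra_simps)
    also have "\<dots> \<le> K\<^sup>2 * (2 * (C\<^sup>2 * exp (- x)) + 2 * (256 * C\<^sup>2 * exp (- x)))"
      by (rule mult_left_mono[OF add_mono[OF mult_left_mono[OF base[OF x]] mult_left_mono[OF x4[OF x]]]]) simp_all
    also have "\<dots> = (514 * K\<^sup>2 * C\<^sup>2) * exp (- x)" by (simp add: algebra_simps)
    finally show "(norm (G'' x))\<^sup>2 \<le> (514 * K\<^sup>2 * C\<^sup>2) * exp (- x)" .
  qed
  have oI: "open (ring_edge L)" "open (half_line L)" by auto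
  have HF: "H2_on (ring_edge L) F"
    "AE x in lebesgue_on (ring_edge L). weak_deriv (ring_edge L) (weak_deriv (ring_edge L) F) x = F'' x"
    by (rule classical_H2[where u' = F' and u'' = F'', OF oI(1)];
      simp add: FDi continuous_on_subset[OF cF(3) sub(1)] cF[THEN L2_on_ring_continuous])+
  have HG: "H2_on (half_line L) G"
    "AE x in lebesgue_on (half_line L). weak_deriv (half_line L) (weak_deriv (half_line L) G) x = G'' x"
    by (rule classical_H2[where u' = G' and u'' = G'', OF oI(2)];
      simp add: GDi continuous_on_subset[OF cG(3) sub(2)] LG LG' LG'')+
  have LL: "- L < L" "L \<in> {-L..L}" "- L \<in> {-L..L}" "L \<in> {L..}" using L_pos by auto
  have nb: "at L within {L..} \<noteq> bot" by (rule Icc_at_nontrivial(3)[of L "L + 1"]) simp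
  have "vector_derivative F (at L within {-L..L}) - vector_derivative F (at (-L) within {-L..L})
       = vector_derivative G (at L within {L..})"
    unfolding vector_derivative_within[OF Icc_at_nontrivial(2)[OF LL(1)] FD[OF LL(2)]]
      vector_derivative_within[OF Icc_at_nontrivial(1)[OF LL(1)] FD[OF LL(3)]]
      vector_derivative_within[OF nb GD[OF LL(4)]] F'_def G'_def
    using L_pos S(6) by (simp flip: of_real_add of_real_diff)
  then have "(F, G) \<in> dom_op L"
    using HF(1) HG(1) cF(1) cG(1) Lx F[OF LL(2)] F[OF LL(3)] G[OF LL(4)] S(5) L_pos
    unfolding dom_op_def dom0_def by (auto simp: F_def G_def eigen_pair_def)
  moreover have "eq_L2 L (A (F, G)) (graph_scale (of_real \<beta>) (F, G))"
    unfolding eq_L2_def L1_op_def graph_scale_def fst_conv snd_conv prod.case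
  proof
    show "AE x in lebesgue_on (ring_edge L). schroedinger_on (ring_edge L) c \<phi> F x = of_real \<beta> * F x"
      using HF(2) AE_space
    proof eventually_elim
      case (elim x)
      then have "F x = of_real (u \<bar>x\<bar>)" using F[of x] by simp
      then show ?case using elim(1) unfolding schroedinger_on_def potential_ring
        by (simp add: F''_def algebra_simps)
    qed
    show "AE x in lebesgue_on (half_line L). schroedinger_on (half_line L) c \<psi> G x = of_real \<beta> * G x"
      using HG(2) AE_space
    proof eventually_elim
      case (elim x)
      then have "G x = of_real (g x)" "(c - 2) - ln (\<bar>\<psi> x\<bar>\<^sup>2) = W x"
        using G[of x] potential_half_line[of x] by auto
      then show ?case using elim(1) unfolding schroedinger_on_def
        by (simp add: G''_def algebra_simps)
    qed
  qed
  ultimately show ?thesis unfolding eigenspace_def F_def G_def by simp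
qed

text \<open>Even for the zero function \<open>weak_deriv\<close> is a choice, known to vanish only
  almost everywhere, so membership in the domain needs an argument.\<close>

lemma zero_in_kernel: "0 \<in> op_kernel L A"
proof -
  have z: "(\<lambda>_. 0 :: complex) = 0" by auto
  have L2: "L2_on I (\<lambda>_. 0 :: complex)" for I by (simp add: L2_on_def)
  have H: "H2_on I (\<lambda>_. 0 :: complex)" "AE x in lebesgue_on I. weak_deriv I (weak_deriv I (\<lambda>_. 0 :: complex)) x = 0"
    if "open I" for I
    using classical_H2[OF that, of "\<lambda>_. 0 :: complex" "\<lambda>_. 0" "\<lambda>_. 0"] L2 by auto
  have LL: "- L < L" using L_pos by simp
  have vd: "vector_derivative (\<lambda>_. 0 :: complex) (at L within {-L..L}) = 0"
    "vector_derivative (\<lambda>_. 0 :: complex) (at (- L) within {-L..L}) = 0"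
    "vector_derivative (\<lambda>_. 0 :: complex) (at L within {L..}) = 0"
    using Icc_at_nontrivial[OF LL] Icc_at_nontrivial(3)[of L "L + 1"]
    by (auto intro!: vector_derivative_within)
  have "((\<lambda>_. 0), (\<lambda>_. 0)) \<in> (dom_op L :: complex graph_fun set)"
    unfolding dom_op_def dom0_def using H L2 vd by simp
  moreover have "eq_L2 L (A ((\<lambda>_. 0), (\<lambda>_. 0))) 0"
    unfolding eq_L2_def L1_op_def schroedinger_on_def
    using H(2)[of "ring_edge L"] H(2)[of "half_line L"] by simp
  ultimately show ?thesis unfolding op_kernel_def zero_prod_def z[symmetric] by simp
qed

theorem spectral_properties:
  "(\<exists>\<beta>0<0. smallest_eigenvalue L A \<beta>0 \<and>
      (\<forall>f g. eigenfunction L A \<beta>0 (f, g) \<longrightarrow>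
         (\<exists>k::complex. k \<noteq> 0 \<and>
            (\<forall>x\<in>{-L..L}. k * f x \<in> \<real> \<and> Re (k * f x) > 0 \<and> k * f (- x) = k * f x) \<and>
            (\<forall>x\<in>{L..}. k * g x \<in> \<real> \<and> Re (k * g x) > 0))) \<and>
      eigen_mult L A \<beta>0 = 1) \<and>
    morse_index L A = 1 \<and> op_kernel L A = {0}"
proof -
  obtain \<beta>0 u u' g g' where \<beta>0: "\<beta>0 < 0" and s: "shoots \<beta>0 u u' g g'"
    and upos: "\<And>x. x \<in> {0..L} \<Longrightarrow> u x > 0" and gpos: "\<And>x. x \<ge> L \<Longrightarrow> g x > 0"
    and dec: "\<And>x. x \<ge> L + 2 \<Longrightarrow> g' x < 0"
    using ground_state_exists by blast
  obtain C where C: "\<And>x. x \<ge> L \<Longrightarrow> \<bar>g x\<bar> \<le> C * exp (- x)" "\<And>x. x \<ge> L \<Longrightarrow> \<bar>g' x\<bar> \<le> C * exp (- x)"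
    using positive_decay[OF shootsD(4)[OF s] less_imp_le[OF \<beta>0] gpos dec] by blast
  define E where "E = eigen_pair u g"
  have E: "E \<in> eigenspace L A \<beta>0" unfolding E_def by (rule eigen_pair_in_eigenspace[OF s C])
  have E0: "fst E 0 = 1" using L_pos shootsD(2)[OF s] by (simp add: E_def eigen_pair_def)
  then have Enz: "E \<noteq> 0" by auto
  \<comment> \<open>Equality of functions on the whole line, not just on the edges: off the edges
    both sides vanish. This makes linear algebra with eigenspaces literal.\<close>
  have rep: "w = graph_scale (fst w 0) (eigen_pair v h)"
    if w: "w \<in> eigenspace L A \<beta>" and \<beta>: "\<beta> \<le> 0" and sh: "shoots \<beta> v v' h h'" for w \<beta> v v' h h'
  proof -
    obtain p q where pq: "w = (p, q)" by (cases w)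
    have out: "p x = 0" if "x \<notin> {-L..L}" for x
      using w that unfolding pq eigenspace_def dom_op_def dom0_def by auto
    have out': "q x = 0" if "x \<notin> {L..}" for x
      using w that unfolding pq eigenspace_def dom_op_def dom0_def by auto
    have "p x = p 0 * fst (eigen_pair v h) x" for x
    proof (cases "x \<in> {-L..L}")
      case True
      then show ?thesis
        using eigenspace_shoots(1)[OF w[unfolded pq] \<beta> sh True] by (simp add: eigen_pair_def)
    next
      case False
      from out[OF False] False show ?thesis by (simp add: eigen_pair_def del: atLeastAtMost_iff)
    qed
    moreover have "q x = p 0 * snd (eigen_pair v h) x" for x
    proof (cases "x \<in> {L..}")
      case True
      then show ?thesis
        using eigenspace_shoots(2)[OF w[unfolded pq] \<beta> sh, of x] by (simp add: eigen_pair_def)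
    next
      case False
      from out'[OF False] False show ?thesis by (simp add: eigen_pair_def del: atLeast_iff)
    qed
    ultimately show ?thesis unfolding pq graph_scale_def fst_conv by (intro arg_cong2[of _ _ _ _ Pair] ext)
  qed
  have int0: "integrable (lebesgue_on {L<..}) (\<lambda>x. x ^ 4 * (g x)\<^sup>2)"
    using eigenspace_shoots(3)[of "fst E" "snd E", OF _ less_imp_le[OF \<beta>0] s] E E0 by simp
  \<comment> \<open>By \<open>rep\<close> a nonzero eigenfunction has a nonzero value at
    \<open>0\<close>, so the shooting pair for \<open>\<beta>\<close> is integrable with the weight
    and competes with the ground state. The case \<open>\<beta> = 0\<close> is included and yields
    the trivial kernel.\<close>
  have only: "\<beta> = \<beta>0" if e: "eigenfunction L A \<beta> w" and \<beta>: "\<beta> \<le> 0" for \<beta> w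
  proof (rule ccontr)
    assume ne: "\<beta> \<noteq> \<beta>0"
    obtain v v' h h' where sh: "shoots \<beta> v v' h h'" using shoots_exists by blast
    have w: "w \<in> eigenspace L A \<beta>" "w \<noteq> 0" using e by (auto simp: eigenfunction_def)
    have nz: "fst w 0 \<noteq> 0"
    proof
      assume z: "fst w 0 = 0"
      have "w = graph_scale 0 (eigen_pair v h)" using rep[OF w(1) \<beta> sh] z by simp
      then have "w = 0" by (simp add: graph_scale_def zero_prod_def fun_eq_iff)
      then show False using w by simp
    qed
    have i: "integrable (lebesgue_on {L<..}) (\<lambda>x. x ^ 4 * (h x)\<^sup>2)"
      using eigenspace_shoots(3)[of "fst w" "snd w", OF _ \<beta> sh] w nz by simp
    show False
    proof (cases "\<beta> < \<beta>0")
      case True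
      show False by (rule eigenvalue_unique[OF sh s True less_imp_le[OF \<beta>0] i int0])
    next
      case False
      then have "\<beta>0 < \<beta>" using ne by simp
      then show False by (rule eigenvalue_unique[OF s sh _ \<beta> int0 i])
    qed
  qed
  have eig0: "is_eigenvalue L A \<beta>0" using E Enz unfolding is_eigenvalue_def eigenfunction_def by blast
  have small: "smallest_eigenvalue L A \<beta>0"
    unfolding smallest_eigenvalue_def
  proof (intro conjI allI impI eig0)
    fix \<gamma> assume "is_eigenvalue L A \<gamma>"
    then obtain w where "eigenfunction L A \<gamma> w" by (auto simp: is_eigenvalue_def)
    then show "\<beta>0 \<le> \<gamma>" using only[of \<gamma> w] \<beta>0 by (cases "\<gamma> \<le> 0") auto
  qed
  have positivity: "\<exists>k::complex. k \<noteq> 0 \<and>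
            (\<forall>x\<in>{-L..L}. k * p x \<in> \<real> \<and> Re (k * p x) > 0 \<and> k * p (- x) = k * p x) \<and>
            (\<forall>x\<in>{L..}. k * q x \<in> \<real> \<and> Re (k * q x) > 0)"
    if e: "eigenfunction L A \<beta>0 (p, q)" for p q
  proof -
    have w: "(p, q) \<in> eigenspace L A \<beta>0" "(p, q) \<noteq> 0" using e by (auto simp: eigenfunction_def)
    have r: "(p, q) = graph_scale (p 0) E" using rep[OF w(1) less_imp_le[OF \<beta>0] s] by (simp add: E_def)
    have nz: "p 0 \<noteq> 0"
    proof
      assume "p 0 = 0"
      then have "(p, q) = 0" using r by (simp add: graph_scale_def zero_prod_def fun_eq_iff)
      then show False using w by simp
    qed
    have p: "p x = p 0 * of_real (u \<bar>x\<bar>)" if "x \<in> {-L..L}" for x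
      using eigenspace_shoots(1)[OF w(1) less_imp_le[OF \<beta>0] s that] .
    have q: "q x = p 0 * of_real (g x)" if "x \<in> {L..}" for x
      using eigenspace_shoots(2)[OF w(1) less_imp_le[OF \<beta>0] s] that by simp
    have up: "u \<bar>x\<bar> > 0" if "x \<in> {-L..L}" for x using upos[of "\<bar>x\<bar>"] that by auto
    have kp: "1 / p 0 * p x = of_real (u \<bar>x\<bar>)" if "x \<in> {-L..L}" for x using p[OF that] nz by simp
    have kq: "1 / p 0 * q x = of_real (g x)" if "x \<in> {L..}" for x using q[OF that] nz by simp
    show ?thesis
    proof (intro exI[of _ "1 / p 0"] conjI ballI)
      show "1 / p 0 \<noteq> 0" using nz by simp
      fix x assume x: "x \<in> {-L..L}"
      then have mx: "- x \<in> {-L..L}" by auto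
      show "1 / p 0 * p x \<in> \<real>" "Re (1 / p 0 * p x) > 0" "1 / p 0 * p (- x) = 1 / p 0 * p x"
        unfolding kp[OF x] kp[OF mx] using up[OF x] by auto
    next
      fix x assume x: "x \<in> {L..}"
      show "1 / p 0 * q x \<in> \<real>" "Re (1 / p 0 * q x) > 0"
        unfolding kq[OF x] using gpos[of x] x by auto
    qed
  qed
  have span: "eigenspace L A \<beta>0 \<subseteq> graph_span {E}"
  proof
    fix w assume "w \<in> eigenspace L A \<beta>0"
    then have "w = graph_scale (fst w 0) E" using rep[OF _ less_imp_le[OF \<beta>0] s] by (simp add: E_def)
    then show "w \<in> graph_span {E}" by (metis graph_fun.span_base graph_fun.span_scale singletonI)
  qed
  have dim: "graph_dim (eigenspace L A \<beta>0) = 1"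
    by (rule graph_fun.dim_unique[OF _ span]) (use E Enz in auto)
  have "\<exists>B. finite B \<and> eigenspace L A \<beta>0 \<subseteq> graph_span B"
    by (intro exI[of _ "{E}"] conjI span) simp
  then have mult: "eigen_mult L A \<beta>0 = 1"
    unfolding eigen_mult_def dim by (simp only: if_True one_enat_def)
  have "\<beta> = \<beta>0" if \<beta>: "\<beta> < 0" "is_eigenvalue L A \<beta>" for \<beta>
  proof -
    obtain w where "eigenfunction L A \<beta> w" using \<beta>(2) unfolding is_eigenvalue_def by blast
    then show ?thesis using \<beta>(1) by (intro only) auto
  qed
  then have "{\<beta>. \<beta> < 0 \<and> is_eigenvalue L A \<beta>} = {\<beta>0}" using eig0 \<beta>0 by blast
  then have morse: "morse_index L A = 1" unfolding morse_index_def using mult by simp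
  have kernel: "op_kernel L A = {0}"
  proof -
    have "w = 0" if "w \<in> op_kernel L A" for w
    proof (rule ccontr)
      assume "w \<noteq> 0"
      have "graph_scale (of_real 0) w = 0" by (simp add: graph_scale_def zero_prod_def fun_eq_iff)
      then have "eigenfunction L A 0 w"
        using that \<open>w \<noteq> 0\<close> by (simp add: eigenfunction_def op_kernel_def eigenspace_def)
      then show False using only[of 0 w] \<beta>0 by simp
    qed
    then show ?thesis using zero_in_kernel by auto
  qed
  show ?thesis using \<beta>0 small positivity mult morse kernel by blast
qed

end

theorem theorem1p3:
  fixes L c :: real and \<phi> \<psi> :: "real \<Rightarrow> real"
  assumes "L > 0"
    and "positive_single_lobe L c \<phi> \<psi>"
  shows "(\<exists>\<beta>0<0.
      smallest_eigenvalue L (L1_op L c \<phi> \<psi>) \<beta>0 \<and>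
      (\<forall>f g. eigenfunction L (L1_op L c \<phi> \<psi>) \<beta>0 (f, g) \<longrightarrow>
         (\<exists>k::complex. k \<noteq> 0 \<and>
            (\<forall>x\<in>{-L..L}. k * f x \<in> \<real> \<and> Re (k * f x) > 0 \<and> k * f (- x) = k * f x) \<and>
            (\<forall>x\<in>{L..}. k * g x \<in> \<real> \<and> Re (k * g x) > 0))) \<and>
      eigen_mult L (L1_op L c \<phi> \<psi>) \<beta>0 = 1) \<and>
    morse_index L (L1_op L c \<phi> \<psi>) = 1 \<and>
    op_kernel L (L1_op L c \<phi> \<psi>) = {0}"
proof -
  obtain a \<phi>' where a: "log_lobe L c a \<phi> \<phi>'" "\<And>x. x \<ge> L \<Longrightarrow> ln ((\<psi> x)\<^sup>2) = c + 1 - (x - L + a)\<^sup>2"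
    using single_lobe_profile[OF assms] by blast
  interpret lobe_state L c a \<phi> \<phi>' \<psi>
    using a by (simp add: lobe_state_def lobe_state_axioms_def)
  show ?thesis by (rule spectral_properties)
qed

end
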